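(* Let $q$ be a positive integer, $Z>0$, $\gamma:=(6\pi^2/q)^{2/3}$. Define the momentum functional, for $\tau\in\mathcal{J}$, $$\mathcal{E}_{\mathrm{mTF}}(\tau)=\int_{\mathbb{R}^3}\xi^2\tau(\xi)\,\mathrm{d}\xi-\tfrac32\gamma^{-1/2}Z\int_{\mathbb{R}^3}\tau(\xi)^{2/3}\,\mathrm{d}\xi+\tfrac34\gamma^{-1/2}\iint\Big(\tau_<(\xi,\xi')\tau_>(\xi,\xi')^{2/3}-\tfrac15\tau_<(\xi,\xi')^{5/3}\Big)\mathrm{d}\xi\,\mathrm{d}\xi',$$ where $\tau_<=\min\{\tau(\xi),\tau(\xi')\}$, $\tau_>=\max\{\tau(\xi),\tau(\xi')\}$, and the Thomas–Fermi functional, for $\rho\in\mathcal{I}$, $$\mathcal{E}_{\mathrm{TF}}(\rho)=\tfrac35\gamma\int_{\mathbb{R}^3}\rho(x)^{5/3}\,\mathrm{d}x-\int_{\mathbb{R}^3}\frac{Z}{|x|}\rho(x)\,\mathrm{d}x+\tfrac12\iint\frac{\rho(x)\rho(y)}{|x-y|}\,\mathrm{d}x\,\mathrm{d}y.$$ Then: 1. For all $N\ge0$, $\inf_{\tau\in\mathcal{J}_{\partial N}}\mathcal{E}_{\mathrm{mTF}}(\tau)=\inf_{\rho\in\mathcal{I}_{\partial N}}\mathcal{E}_{\mathrm{TF}}(\rho)$. 2. Let $0\le N\le Z$ and let $\rho_m$ be the minimizer of $\mathcal{E}_{\mathrm{TF}}$ on $\mathcal{I}_{\partial N}$. Then $T(\rho_m)$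 is the unique minimizer of $\mathcal{E}_{\mathrm{mTF}}$ on $\mathcal{J}_{\partial N}$. 3. For $N>Z$ there exists no minimizer of $\mathcal{E}_{\mathrm{mTF}}$ on $\mathcal{J}_{\partial N}$. 4. For every $N\ge 0$ there exists a unique minimizer $\tau_m$ of $\mathcal{E}_{\mathrm{mTF}}$ on $\mathcal{J}_N$; moreover $\tau_m\in\mathcal{J}_{\partial\min\{N,Z\}}$.
   Context: Sets: $\mathcal{I}:=\{\rho\in L^1(\mathbb{R}^3)\cap L^{5/3}(\mathbb{R}^3):\rho\ge0\}$, $\mathcal{I}_{\partial N}:=\{\rho\in\mathcal{I}:\int\rho=N\}$; $\mathcal{J}:=\{\tau\in L^1(\mathbb{R}^3,(1+\xi^2)\mathrm{d}\xi):\tau\ge0\}$, $\mathcal{J}_N:=\{\tau\in\mathcal{J}:\int\tau\le N\}$, $\mathcal{J}_{\partial N}:=\{\tau\in\mathcal{J}:\int\tau=N\}$. For $\rho\in L^1(\mathbb{R}^3)$ its Fermi radius is $r(s):=\sup\{|y|:\gamma^{1/2}|\rho(y)|^{1/3}\ge s\}$ for $s\ge0$, and the transform $T$ is defined by $T(\rho)(\xi):=\gamma^{-3/2}r(|\xi|)^3$ for $\xi\in\mathbb{R}^3$.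
   Formalization: The Fermi radius is taken in the essential sense (least R such that γ^{1/2}|ρ(y)|^{1/3} < s for almost every |y| > R), since the pointwise supremum depends on the representative of ρ in L^1; both agree for the radially decreasing minimizer and s > 0. *)

theory Defs
  imports "HOL-Analysis.Analysis"
begin

text \<open>Functions on R^3 are modelled as real-valued functions on real^3; Lebesgue measure is lborel.
  Elements of L^p are handled via representatives; nonnegativity and uniqueness are almost everywhere.\<close>

definition gammaTF :: "nat \<Rightarrow> real" where
  "gammaTF q = (6 * pi\<^sup>2 / real q) powr (2/3)"

definition I_set :: "(real^3 \<Rightarrow> real) set" where
  "I_set = {\<rho>. integrable lborel \<rho> \<and> integrable lborel (\<lambda>x. \<bar>\<rho> x\<bar> powr (5/3))
               \<and> (AE x in lborel. 0 \<le> \<rho> x)}"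

definition I_bd :: "real \<Rightarrow> (real^3 \<Rightarrow> real) set" where
  "I_bd N = {\<rho> \<in> I_set. integral\<^sup>L lborel \<rho> = N}"

definition J_set :: "(real^3 \<Rightarrow> real) set" where
  "J_set = {\<tau>. \<tau> \<in> borel_measurable lborel
               \<and> integrable lborel (\<lambda>\<xi>. (1 + (norm \<xi>)\<^sup>2) * \<tau> \<xi>)
               \<and> (AE \<xi> in lborel. 0 \<le> \<tau> \<xi>)}"

definition J_le :: "real \<Rightarrow> (real^3 \<Rightarrow> real) set" where
  "J_le N = {\<tau> \<in> J_set. integral\<^sup>L lborel \<tau> \<le> N}"

definition J_bd :: "real \<Rightarrow> (real^3 \<Rightarrow> real) set" where
  "J_bd N = {\<tau> \<in> J_set. integral\<^sup>L lborel \<tau> = N}"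

text \<open>Fermi radius, taken in the essential (representative-independent) sense:
  the least R \<ge> 0 such that almost every y with norm y > R satisfies
  gamma^(1/2) |rho y|^(1/3) < s.\<close>
definition fermi_radius :: "nat \<Rightarrow> (real^3 \<Rightarrow> real) \<Rightarrow> real \<Rightarrow> real" where
  "fermi_radius q \<rho> s = Inf {R. 0 \<le> R \<and>
      (AE y in lborel. norm y > R \<longrightarrow> sqrt (gammaTF q) * \<bar>\<rho> y\<bar> powr (1/3) < s)}"

definition Ttrans :: "nat \<Rightarrow> (real^3 \<Rightarrow> real) \<Rightarrow> (real^3 \<Rightarrow> real)" where
  "Ttrans q \<rho> \<xi> = gammaTF q powr (-3/2) * (fermi_radius q \<rho> (norm \<xi>)) ^ 3"

definition E_mTF :: "nat \<Rightarrow> real \<Rightarrow> (real^3 \<Rightarrow> real) \<Rightarrow> real" where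
  "E_mTF q Z \<tau> =
     (\<integral>\<xi>. (norm \<xi>)\<^sup>2 * \<tau> \<xi> \<partial>lborel)
     - 3/2 * gammaTF q powr (-1/2) * Z * (\<integral>\<xi>. \<tau> \<xi> powr (2/3) \<partial>lborel)
     + 3/4 * gammaTF q powr (-1/2) *
        (\<integral>p. (min (\<tau> (fst p)) (\<tau> (snd p))) * (max (\<tau> (fst p)) (\<tau> (snd p))) powr (2/3)
               - 1/5 * (min (\<tau> (fst p)) (\<tau> (snd p))) powr (5/3) \<partial>(lborel \<Otimes>\<^sub>M lborel))"

definition E_TF :: "nat \<Rightarrow> real \<Rightarrow> (real^3 \<Rightarrow> real) \<Rightarrow> real" where
  "E_TF q Z \<rho> =
     3/5 * gammaTF q * (\<integral>x. \<rho> x powr (5/3) \<partial>lborel)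
     - (\<integral>x. Z / norm x * \<rho> x \<partial>lborel)
     + 1/2 * (\<integral>p. \<rho> (fst p) * \<rho> (snd p) / norm (fst p - snd p) \<partial>(lborel \<Otimes>\<^sub>M lborel))"

definition is_minimizer :: "('a \<Rightarrow> real) \<Rightarrow> 'a set \<Rightarrow> 'a \<Rightarrow> bool" where
  "is_minimizer E S x \<longleftrightarrow> x \<in> S \<and> (\<forall>y\<in>S. E x \<le> E y)"

definition is_unique_minimizer :: "((real^3 \<Rightarrow> real) \<Rightarrow> real) \<Rightarrow> (real^3 \<Rightarrow> real) set \<Rightarrow> (real^3 \<Rightarrow> real) \<Rightarrow> bool" where
  "is_unique_minimizer E S f \<longleftrightarrow> is_minimizer E S f \<and>
     (\<forall>g. is_minimizer E S g \<longrightarrow> (AE \<xi> in lborel. g \<xi> = f \<xi>))"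

end

theory Submission
  imports Defs
begin

text \<open>
  Put \<open>w = sqrt \<gamma>\<close> and \<open>lev x = (|x| / w)^3\<close>. Up to a constant factor the transform sends \<open>f\<close> to the
  function \<open>x \<mapsto> |{y. lev x < f y}|\<close>, so densities \<open>\<rho>\<close> and momentum distributions \<open>\<tau>\<close> are the two
  marginals of one set in phase space. By Tonelli, \<open>E_mTF \<tau>\<close> equals the functional \<open>E_max\<close> of the
  transformed density, which is the Thomas-Fermi functional with \<open>1 / |x - y|\<close> replaced by
  \<open>1 / max |x| |y|\<close>, plus the difference of the kinetic energies. This difference is nonnegative by
  the bathtub principle and vanishes only if the phase-space set consists of centred balls.

  The kernel \<open>1 / max |x| |y|\<close> is positive definite, so \<open>E_max\<close> is strictly convex; minimizing sequences
  converge almost everywhere and the limit satisfies the Euler-Lagrange equation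
  \<open>\<gamma> \<rho>^(2/3) = (Z / |x| - U - \<mu>)^+\<close>. Its right-hand side is radial and, because the mass cannot
  exceed \<open>Z\<close>, decreasing. By Newton's theorem the same density solves the Euler-Lagrange equation
  for the Coulomb kernel, hence it minimizes the Thomas-Fermi functional as well. For \<open>N > Z\<close> the excess
  mass is spread thinly over a large ball at arbitrarily small cost.
\<close>

section \<open>Radial integrals\<close>

text \<open>The momentum interaction is exactly that of centred balls under \<open>kmax\<close>, so
  the momentum problem never sees the angular part of a density. Minimizing with \<open>kmax\<close>
  first pays off because its potential depends on |x| only: a minimizer is radial without any
  rearrangement argument. The two infima are never compared directly; both are identified with the
  energy of one common radial density. Existence uses no weak compactness: the kinetic energy is
  uniformly convex with a fifth-power modulus in the cube roots, so a minimizing sequence with a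
  geometric rate converges pointwise, and Fatou finishes. Fatou may lose mass, hence the constraint
  is relaxed to mass at most N; the exact mass is recovered from the Euler-Lagrange equation by
  comparing the enclosed charge with Z. Positive definiteness of both kernels is obtained by writing
  them as Gram kernels with nonnegative factors, so that everything stays within extended
  nonnegative integrals and Tonelli applies without integrability conditions.\<close>

lemma nn_integral_norm_power:
  fixes f :: "real \<Rightarrow> ennreal"
  assumes [measurable]: "f \<in> borel_measurable borel"
  shows "(\<integral>\<^sup>+x. f (norm x ^ DIM('a)) \<partial>(lborel :: 'a::euclidean_space measure))
         = ennreal (unit_ball_vol DIM('a)) * (\<integral>\<^sup>+t. f t * indicator {0..} t \<partial>lborel)"
proof -
  let ?d = "DIM('a)" let ?c = "unit_ball_vol (real DIM('a))"
  let ?D = "density lborel (\<lambda>s::real. ennreal ?c * indicator {..0} s)"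
  \<comment> \<open>A ball of radius r has volume c r^d, so the image of Lebesgue measure under
    |x|^d is uniform on the half-line. The sign is reversed because measures are compared on the
    sets \<open>{a<..}\<close>, which must have finite measure; after the reversal they pull back to
    balls.\<close>
  have eq: "distr (lborel :: 'a measure) borel (\<lambda>x. - (norm x ^ ?d)) = ?D"
  proof (rule measure_eqI_lessThan)
    fix a :: real
    have L: "emeasure (distr (lborel :: 'a measure) borel (\<lambda>x. - (norm x ^ ?d))) {a<..}
             = ennreal (?c * (if a < 0 then - a else 0))"
    proof (cases "a < 0")
      case True
      have "(\<lambda>x::'a. - (norm x ^ ?d)) -` {a<..} \<inter> space lborel = ball 0 (root ?d (- a))"
      proof (intro set_eqI iffI)
        fix x :: 'a
        have *: "norm x < root ?d (- a) \<longleftrightarrow> norm x ^ ?d < - a"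
          by (metis DIM_positive norm_ge_zero real_root_less_iff real_root_power_cancel)
        { assume "x \<in> (\<lambda>x::'a. - (norm x ^ ?d)) -` {a<..} \<inter> space lborel"
          thus "x \<in> ball 0 (root ?d (- a))" using * by auto }
        { assume "x \<in> ball 0 (root ?d (- a))"
          thus "x \<in> (\<lambda>x::'a. - (norm x ^ ?d)) -` {a<..} \<inter> space lborel" using * by auto }
      qed
      moreover have "0 \<le> root ?d (- a)" "root ?d (- a) ^ ?d = - a"
        using True by (simp_all add: real_root_pow_pos2 real_root_ge_zero)
      ultimately show ?thesis
        using True by (simp add: emeasure_distr emeasure_ball)
    next
      case False
      have "(\<lambda>x::'a. - (norm x ^ ?d)) -` {a<..} \<inter> space lborel = {}"
      proof -
        have "\<not> a < - (norm x ^ ?d)" for x :: 'a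
          using False zero_le_power[OF norm_ge_zero, of x ?d] by linarith
        thus ?thesis by blast
      qed
      thus ?thesis using False by (simp add: emeasure_distr)
    qed
    have R: "emeasure ?D {a<..} = ennreal (?c * (if a < 0 then - a else 0))"
    proof -
      have "emeasure ?D {a<..} = ennreal ?c * (\<integral>\<^sup>+s. indicator {a<..0} s \<partial>lborel)"
        by (subst emeasure_density, simp, simp, subst nn_integral_cmult[symmetric], simp)
           (auto intro!: nn_integral_cong simp: indicator_def)
      also have "\<dots> = ennreal (?c * (if a < 0 then - a else 0))"
        by (cases "a < 0") (simp_all add: ennreal_mult'[symmetric])
      finally show ?thesis .
    qed
    show "emeasure (distr (lborel :: 'a measure) borel (\<lambda>x. - (norm x ^ ?d))) {a<..} < \<infinity>"
      using L by simp
    show "emeasure (distr (lborel :: 'a measure) borel (\<lambda>x. - (norm x ^ ?d))) {a<..} = emeasure ?D {a<..}"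
      using L R by simp
  qed simp_all
  have "(\<integral>\<^sup>+x. f (norm x ^ ?d) \<partial>(lborel :: 'a measure))
        = (\<integral>\<^sup>+s. f (- s) \<partial>(distr (lborel :: 'a measure) borel (\<lambda>x. - (norm x ^ ?d))))"
    by (subst nn_integral_distr) auto
  also have "\<dots> = (\<integral>\<^sup>+s. ennreal ?c * (indicator {..0} s * f (- s)) \<partial>lborel)"
    unfolding eq by (subst nn_integral_density) (auto simp: mult_ac)
  also have "\<dots> = ennreal ?c * (\<integral>\<^sup>+s. indicator {..0} s * f (- s) \<partial>lborel)"
    by (subst nn_integral_cmult) auto
  also have "(\<integral>\<^sup>+s. indicator {..0} s * f (- s) \<partial>lborel) = (\<integral>\<^sup>+t. f t * indicator {0..} t \<partial>lborel)"
    by (subst nn_integral_real_affine[of _ "-1" 0]) (auto intro!: nn_integral_cong simp: indicator_def)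
  finally show ?thesis .
qed

lemma cube_powr_third:
  assumes "0 \<le> (a::real)"
  shows "(a ^ 3) powr (p / 3) = a powr p"
proof (cases "a = 0")
  case False
  hence "a ^ 3 = a powr 3" using assms by simp
  hence "(a ^ 3) powr (p / 3) = a powr (3 * (p / 3))" by (simp only: powr_powr)
  thus ?thesis by simp
qed simp

lemma nn_integral_norm_powr_ball:
  assumes "- 3 < p" "0 \<le> R"
  shows "(\<integral>\<^sup>+x. ennreal (norm x powr p) * indicator {x. norm x < R} x \<partial>(lborel :: (real^3) measure))
         = ennreal (4 * pi / (p + 3) * R powr (p + 3))"
proof -
  have [simp]: "t ^ 3 < R ^ 3 \<longleftrightarrow> t < R" if "0 \<le> t" for t
    using that assms by (metis power_less_imp_less_base power_strict_mono zero_less_numeral)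
  have "(\<integral>\<^sup>+x. ennreal (norm x powr p) * indicator {x. norm x < R} x \<partial>(lborel :: (real^3) measure))
     = (\<integral>\<^sup>+x. (\<lambda>t. ennreal (t powr (p/3)) * indicator {..<R^3} t) (norm x ^ DIM(real^3)) \<partial>(lborel :: (real^3) measure))"
  proof (rule nn_integral_cong)
    fix x :: "real^3"
    have "(norm x ^ 3) powr (p / 3) = norm x powr p"
      by (rule cube_powr_third) simp
    thus "ennreal (norm x powr p) * indicator {x. norm x < R} x =
       (\<lambda>t. ennreal (t powr (p/3)) * indicator {..<R^3} t) (norm x ^ DIM(real^3))"
      by (simp add: indicator_def)
  qed
  also have "\<dots> = ennreal (4 / 3 * pi) *
      (\<integral>\<^sup>+t. ennreal (t powr (p/3)) * indicator {..<R^3} t * indicator {0..} t \<partial>lborel)"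
    by (subst nn_integral_norm_power) (auto simp: unit_ball_vol_3)
  also have "(\<integral>\<^sup>+t. ennreal (t powr (p/3)) * indicator {..<R^3} t * indicator {0..} t \<partial>lborel)
      = (\<integral>\<^sup>+t. ennreal (t powr (p/3)) * indicator {0..R^3} t \<partial>lborel)"
    by (intro nn_integral_cong_AE, rule AE_mp[OF AE_lborel_singleton[of "R^3"]])
       (auto simp: indicator_def)
  also have "\<dots> = ennreal ((R ^ 3) powr (p / 3 + 1) / (p / 3 + 1))"
    using assms by (intro nn_integral_has_integral_lebesgue' has_integral_powr_from_0) auto
  also have "(R ^ 3) powr (p / 3 + 1) = R powr (p + 3)"
    using cube_powr_third[OF assms(2), of "p + 3"] by (simp add: add_divide_distrib)
  finally show ?thesis
    using assms by (simp add: ennreal_mult'[symmetric] field_simps)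
qed

lemma emeasure_norm_less:
  assumes "0 \<le> R"
  shows "emeasure lborel {x::real^3. norm x < R} = ennreal (4 / 3 * pi * R ^ 3)"
proof -
  have "{x::real^3. norm x < R} = ball 0 R" by auto
  thus ?thesis using assms by (simp add: emeasure_ball unit_ball_vol_3)
qed

lemma AE_norm_neq: "AE x in (lborel :: (real^3) measure). norm x \<noteq> R"
proof -
  have "sphere 0 R \<in> null_sets (lborel :: (real^3) measure)"
    using negligible_sphere[of "0::real^3" R]
    by (auto simp: null_sets_completion_iff negligible_iff_null_sets negligible_convex_frontier)
  hence "AE x in lborel. x \<notin> sphere (0::real^3) R" by (rule AE_not_in)
  thus ?thesis by auto
qed

section \<open>Invariance of Lebesgue measure under rotations and affine maps\<close>

lemma lborel_distr_orthogonal: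
  fixes f :: "real^3 \<Rightarrow> real^3"
  assumes f: "orthogonal_transformation f"
  shows "distr lborel borel f = lborel"
proof (rule lborel_eqI[symmetric])
  have [measurable]: "f \<in> borel_measurable borel"
    using f by (intro borel_measurable_continuous_onI linear_continuous_on
        linear_conv_bounded_linear[THEN iffD1] orthogonal_transformation_linear)
  fix l u :: "real^3"
  assume lu: "\<And>b. b \<in> Basis \<Longrightarrow> l \<bullet> b \<le> u \<bullet> b"
  have inv: "orthogonal_transformation (inv f)" "bij f"
    using f by (auto intro: orthogonal_transformation_inv orthogonal_transformation_bij)
  have pre: "f -` box l u = inv f ` box l u"
    using inv(2) by (simp add: bij_vimage_eq_inv_image)
  have bx: "box l u \<in> lmeasurable" by simp
  have lm: "f -` box l u \<in> lmeasurable"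
    unfolding pre by (rule measurable_orthogonal_image[OF inv(1) bx])
  have bo: "f -` box l u \<in> sets borel"
    using measurable_sets[of f borel borel "box l u"] by auto
  have "emeasure lborel (f -` box l u) = emeasure lebesgue (f -` box l u)"
    using bo by (simp add: emeasure_completion)
  also have "\<dots> = ennreal (measure lebesgue (f -` box l u))"
    using lm by (simp add: emeasure_eq_measure2 fmeasurableD2)
  also have "\<dots> = ennreal (measure lebesgue (box l u))"
    unfolding pre by (simp add: measure_orthogonal_image[OF inv(1) bx])
  also have "\<dots> = (\<Prod>b\<in>Basis. (u - l) \<bullet> b)"
    using lu by (simp add: measure_lborel_box_eq) 
  finally show "emeasure (distr lborel borel f) (box l u) = (\<Prod>b\<in>Basis. (u - l) \<bullet> b)"
    by (simp add: emeasure_distr)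
qed simp

lemma nn_integral_orthogonal:
  fixes f :: "real^3 \<Rightarrow> real^3"
  assumes f: "orthogonal_transformation f" and [measurable]: "h \<in> borel_measurable borel"
  shows "(\<integral>\<^sup>+x. h (f x) \<partial>lborel) = (\<integral>\<^sup>+x. h x \<partial>lborel)"
proof -
  have [measurable]: "f \<in> borel_measurable borel"
    using f by (intro borel_measurable_continuous_onI linear_continuous_on
        linear_conv_bounded_linear[THEN iffD1] orthogonal_transformation_linear)
  have "(\<integral>\<^sup>+x. h x \<partial>(distr lborel borel f)) = (\<integral>\<^sup>+x. h (f x) \<partial>lborel)"
    by (subst nn_integral_distr) auto
  thus ?thesis by (simp add: lborel_distr_orthogonal[OF f])
qed

lemma nn_integral_affine3:
  fixes t :: "real^3"
  assumes c: "0 < c" and [measurable]: "h \<in> borel_measurable borel"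
  shows "(\<integral>\<^sup>+x. h x \<partial>lborel) = ennreal (c ^ 3) * (\<integral>\<^sup>+x. h (t + c *\<^sub>R x) \<partial>lborel)"
proof -
  have "(\<integral>\<^sup>+x. h x \<partial>lborel)
      = (\<integral>\<^sup>+x. h x \<partial>(density (distr lborel borel (\<lambda>x. t + c *\<^sub>R x)) (\<lambda>_. \<bar>c\<bar>^DIM(real^3))))"
    using c by (subst lborel_affine[of c t, symmetric]) auto
  also have "\<dots> = (\<integral>\<^sup>+x. ennreal (\<bar>c\<bar>^DIM(real^3)) * h (t + c *\<^sub>R x) \<partial>lborel)"
    by (subst nn_integral_density, simp, simp, subst nn_integral_distr) simp_all
  also have "\<dots> = ennreal (c ^ 3) * (\<integral>\<^sup>+x. h (t + c *\<^sub>R x) \<partial>lborel)"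
    using c by (subst nn_integral_cmult) simp_all
  finally show ?thesis .
qed

lemma nn_integral_translate3:
  fixes t :: "real^3"
  assumes [measurable]: "h \<in> borel_measurable borel"
  shows "(\<integral>\<^sup>+x. h (x - t) \<partial>lborel) = (\<integral>\<^sup>+x. h x \<partial>lborel)"
  using nn_integral_affine3[of 1 "\<lambda>x. h (x - t)" t] by simp

section \<open>Newton's theorem\<close>

text \<open>Separates the first axis from the orthogonal plane, where radial integration can be used
  once more.\<close>

lemma nn_integral_coordinates3:
  assumes [measurable]: "h \<in> borel_measurable (borel :: (real^3) measure)"
  shows "(\<integral>\<^sup>+x. h x \<partial>lborel) = (\<integral>\<^sup>+a. (\<integral>\<^sup>+p. h (vector [a, fst p, snd p]) \<partial>lborel) \<partial>lborel)"
proof -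
  let ?V = "\<lambda>q::real \<times> real \<times> real. vector [fst q, fst (snd q), snd (snd q)] :: real^3"
  have V: "?V q = (\<chi> i. if i = 1 then fst q else if i = 2 then fst (snd q) else snd (snd q))" for q
    unfolding vec_eq_iff by (auto simp: forall_3)
  have Vm[measurable]: "?V \<in> borel_measurable borel"
  proof (unfold V, intro borel_measurable_continuous_onI continuous_on_vec_lambda)
    fix i :: 3
    show "continuous_on UNIV (\<lambda>q::real \<times> real \<times> real.
        if i = 1 then fst q else if i = 2 then fst (snd q) else snd (snd q))"
      by (cases "i = 1"; cases "i = 2") (auto intro!: continuous_intros)
  qed
  have vecm[measurable]: "(\<lambda>p. vector [a, fst p, snd p] :: real^3) \<in> borel_measurable borel" for a :: real
    using measurable_compose[OF _ Vm, of "\<lambda>p. (a, p)" borel]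
    by (auto simp: borel_prod[symmetric])
  have bij3: "(\<Prod>b\<in>Basis. (u - l) \<bullet> b) = (u$1 - l$1) * ((u$2 - l$2) * (u$3 - l$3))" for u l :: "real^3"
  proof -
    have B: "(Basis :: (real^3) set) = (\<lambda>i. axis i 1) ` UNIV"
      by (auto simp: Basis_vec_def)
    have "inj (\<lambda>i::3. axis i (1::real))" by (auto simp: inj_def axis_eq_axis)
    hence "(\<Prod>b\<in>Basis. (u - l) \<bullet> b) = (\<Prod>i\<in>(UNIV :: 3 set). (u - l) $ i)"
      unfolding B by (simp add: prod.reindex inner_axis)
    thus ?thesis unfolding UNIV_3 by simp
  qed
  have "lborel = distr (lborel :: (real \<times> real \<times> real) measure) borel ?V"
  proof (rule lborel_eqI)
    fix l u :: "real^3"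
    assume lu: "\<And>b. b \<in> Basis \<Longrightarrow> l \<bullet> b \<le> u \<bullet> b"
    have le: "l $ i \<le> u $ i" for i
      using lu[of "axis i 1"] by (auto simp: inner_axis Basis_vec_def)
    have pre: "?V -` box l u = {l$1<..<u$1} \<times> ({l$2<..<u$2} \<times> {l$3<..<u$3})"
      by (auto simp: mem_box_cart forall_3)
    have "emeasure (distr (lborel :: (real \<times> real \<times> real) measure) borel ?V) (box l u)
        = emeasure (lborel \<Otimes>\<^sub>M (lborel \<Otimes>\<^sub>M lborel)) ({l$1<..<u$1} \<times> ({l$2<..<u$2} \<times> {l$3<..<u$3}))"
      by (simp add: emeasure_distr pre lborel_prod)
    also have "\<dots> = emeasure lborel {l$1<..<u$1} * emeasure (lborel \<Otimes>\<^sub>M lborel) ({l$2<..<u$2} \<times> {l$3<..<u$3})"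
      by (subst sigma_finite_measure.emeasure_pair_measure_Times)
         (auto simp: lborel_prod sigma_finite_lborel intro: borel_open open_Times)
    also have "\<dots> = ennreal (\<Prod>b\<in>Basis. (u - l) \<bullet> b)"
      unfolding bij3 using le
      by (subst sigma_finite_measure.emeasure_pair_measure_Times)
         (auto simp: sigma_finite_lborel ennreal_mult[symmetric])
    finally show "emeasure (distr lborel borel ?V) (box l u) = (\<Prod>b\<in>Basis. (u - l) \<bullet> b)" .
  qed simp
  hence "(\<integral>\<^sup>+x. h x \<partial>lborel) = (\<integral>\<^sup>+x. h x \<partial>(distr (lborel :: (real \<times> real \<times> real) measure) borel ?V))"
    by simp
  also have "\<dots> = (\<integral>\<^sup>+q. h (?V q) \<partial>(lborel \<Otimes>\<^sub>M lborel))"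
    by (subst nn_integral_distr) (auto simp: lborel_prod)
  also have "\<dots> = (\<integral>\<^sup>+a. (\<integral>\<^sup>+p. h (?V (a, p)) \<partial>lborel) \<partial>lborel)"
    by (subst sigma_finite_measure.nn_integral_fst[symmetric])
       (auto simp: lborel_prod sigma_finite_lborel)
  finally show ?thesis by simp
qed

text \<open>For a fixed first coordinate a, |y|^2 = a^2 + |p|^2, and in the plane area is pi times
  Lebesgue measure in |p|^2. So the pair (|y|^2, \<open>y $ 1\<close>) has the constant density pi
  on h^2 \<le> v: Archimedes' theorem that height on a sphere is uniformly distributed.\<close>

lemma nn_integral_axial:
  fixes G :: "real \<Rightarrow> real \<Rightarrow> ennreal"
  assumes [measurable]: "case_prod G \<in> borel_measurable (borel \<Otimes>\<^sub>M borel)"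
  shows "(\<integral>\<^sup>+y. G ((norm y)\<^sup>2) (y $ 1) \<partial>(lborel :: (real^3) measure))
         = (\<integral>\<^sup>+v. (\<integral>\<^sup>+h. ennreal pi * (G v h * indicator {h. h\<^sup>2 \<le> v} h) \<partial>lborel) \<partial>lborel)"
proof -
  have [measurable]: "(\<lambda>y::real^3. y $ 1) \<in> borel_measurable borel"
    by (intro borel_measurable_continuous_onI continuous_intros)
  have nrm: "(norm (vector [a, fst p, snd p] :: real^3))\<^sup>2 = a\<^sup>2 + (norm p)\<^sup>2" for a :: real and p :: "real \<times> real"
    by (simp add: power2_norm_eq_inner inner_vec_def sum_3 inner_prod_def)
       (simp add: power2_eq_square)
  have "(\<integral>\<^sup>+y. G ((norm y)\<^sup>2) (y $ 1) \<partial>(lborel :: (real^3) measure))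
      = (\<integral>\<^sup>+a. (\<integral>\<^sup>+p. G (a\<^sup>2 + (norm (p :: real \<times> real))\<^sup>2) a \<partial>lborel) \<partial>lborel)"
    by (subst nn_integral_coordinates3) (auto simp: nrm)
  also have "\<dots> = (\<integral>\<^sup>+a. (\<integral>\<^sup>+v. ennreal pi * (G v a * indicator {h. h\<^sup>2 \<le> v} a) \<partial>lborel) \<partial>lborel)"
  proof (rule nn_integral_cong)
    fix a :: real
    have "(\<integral>\<^sup>+p. G (a\<^sup>2 + (norm (p :: real \<times> real))\<^sup>2) a \<partial>lborel)
        = (\<integral>\<^sup>+p. (\<lambda>u. G (a\<^sup>2 + u) a) (norm (p :: real \<times> real) ^ DIM(real \<times> real)) \<partial>lborel)"
      by (simp add: power2_eq_square)
    also have "\<dots> = ennreal pi * (\<integral>\<^sup>+u. G (a\<^sup>2 + u) a * indicator {0..} u \<partial>lborel)"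
      by (subst nn_integral_norm_power) (auto simp: unit_ball_vol_2)
    also have "(\<integral>\<^sup>+u. G (a\<^sup>2 + u) a * indicator {0..} u \<partial>lborel)
        = (\<integral>\<^sup>+v. G v a * indicator {h. h\<^sup>2 \<le> v} a \<partial>lborel)"
      by (subst (2) nn_integral_real_affine[of _ 1 "a\<^sup>2"])
         (auto intro!: nn_integral_cong simp: indicator_def)
    finally show "(\<integral>\<^sup>+p. G (a\<^sup>2 + (norm (p :: real \<times> real))\<^sup>2) a \<partial>lborel)
        = (\<integral>\<^sup>+v. ennreal pi * (G v a * indicator {h. h\<^sup>2 \<le> v} a) \<partial>lborel)"
      by (subst nn_integral_cmult) auto
  qed
  also have "\<dots> = (\<integral>\<^sup>+v. (\<integral>\<^sup>+h. ennreal pi * (G v h * indicator {h. h\<^sup>2 \<le> v} h) \<partial>lborel) \<partial>lborel)"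
    by (rule lborel_pair.Fubini') measurable
  finally show ?thesis .
qed

text \<open>On a sphere the coordinate along an axis is uniformly distributed, so averaging the Coulomb kernel
  over the sphere becomes this one-dimensional integral.\<close>

lemma nn_integral_inverse_distance_chord:
  assumes "0 < a" "v \<noteq> a\<^sup>2"
  shows "(\<integral>\<^sup>+h. ennreal (1 / sqrt (a\<^sup>2 + v - 2 * a * h)) * indicator {h. h\<^sup>2 \<le> v} h \<partial>lborel)
       = (\<integral>\<^sup>+h. ennreal (1 / max a (sqrt v)) * indicator {h. h\<^sup>2 \<le> v} h \<partial>lborel)"
proof (cases "0 \<le> v")
  case False
  hence "{h::real. h\<^sup>2 \<le> v} = {}" using zero_le_power2 order_trans by blast
  thus ?thesis by simp
next
  case True
  define r where "r = sqrt v"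
  have r: "0 \<le> r" "r\<^sup>2 = v" "r \<noteq> a" using True assms by (auto simp: r_def)
  have S: "{h. h\<^sup>2 \<le> v} = {-r..r}"
  proof -
    have "h\<^sup>2 \<le> v \<longleftrightarrow> h \<in> {-r..r}" for h
      using abs_le_square_iff[of h r] r(1,2) by (simp add: abs_le_iff minus_le_iff conj_commute)
    thus ?thesis by blast
  qed
  have pos: "0 < a\<^sup>2 + v - 2 * a * h" if "h \<in> {-r..r}" for h
  proof -
    have "2 * a * h \<le> 2 * a * r" using that assms by simp
    moreover have "0 < (a - r)\<^sup>2" using r by simp
    ultimately show ?thesis using r by (simp add: power2_diff)
  qed
  have "(\<integral>\<^sup>+h. ennreal (1 / sqrt (a\<^sup>2 + v - 2 * a * h)) * indicator {-r..r} h \<partial>lborel)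
      = ennreal (- sqrt (a\<^sup>2 + v - 2 * a * r) / a - (- sqrt (a\<^sup>2 + v - 2 * a * (- r)) / a))"
  proof (rule nn_integral_FTC_Icc)
    fix h assume h: "h \<in> {-r..r}"
    show "((\<lambda>h. - sqrt (a\<^sup>2 + v - 2 * a * h) / a) has_real_derivative 1 / sqrt (a\<^sup>2 + v - 2 * a * h)) (at h)"
      using pos[OF h] assms by (auto intro!: derivative_eq_intros simp: field_simps)
  next
    fix h assume h: "h \<in> {-r..r}"
    show "0 \<le> 1 / sqrt (a\<^sup>2 + v - 2 * a * h)" using pos[OF h] by simp
  qed (use r in auto)
  also have "sqrt (a\<^sup>2 + v - 2 * a * r) = \<bar>a - r\<bar>"
  proof -
    have "a\<^sup>2 + v - 2 * a * r = (a - r)\<^sup>2" using r by (simp add: power2_diff)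
    thus ?thesis by simp
  qed
  also have "sqrt (a\<^sup>2 + v - 2 * a * (- r)) = a + r"
  proof -
    have "a\<^sup>2 + v - 2 * a * (- r) = (a + r)\<^sup>2" using r by (simp add: power2_sum)
    thus ?thesis using r assms by simp
  qed
  \<comment> \<open>The absolute value depends on which of a and r is larger; here the distinction
    between inside and outside of the shell turns into \<open>max\<close>.\<close>
  also have "- \<bar>a - r\<bar> / a - (- (a + r) / a) = 2 * r / max a r"
    using r assms by (auto simp: max_def field_simps abs_if)
  also have "ennreal (2 * r / max a r) = (\<integral>\<^sup>+h. ennreal (1 / max a r) * indicator {-r..r} h \<partial>lborel)"
    using r assms by (subst nn_integral_cmult) (auto simp: ennreal_mult'[symmetric])
  finally show ?thesis unfolding S r_def[symmetric] .
qed

text \<open>After a rotation x lies on the first axis, so |x - y|^2 depends on y only through |y|^2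
  and \<open>y $ 1\<close>. Then \<open>nn_integral_axial\<close> applies to both sides, and they
  agree already in the inner integral over the chord.\<close>

theorem newton:
  fixes s :: "real \<Rightarrow> real" and x :: "real^3"
  assumes [measurable]: "s \<in> borel_measurable borel" and "x \<noteq> 0"
  shows "(\<integral>\<^sup>+y. ennreal (s (norm y)) * ennreal (1 / norm (x - y)) \<partial>lborel)
       = (\<integral>\<^sup>+y. ennreal (s (norm y)) * ennreal (1 / max (norm x) (norm y)) \<partial>(lborel :: (real^3) measure))"
proof -
  define a where "a = norm x"
  have a: "0 < a" using assms by (simp add: a_def)
  have na: "norm (a *\<^sub>R axis 1 1 :: real^3) = norm x" by (simp add: a_def)
  obtain f :: "real^3 \<Rightarrow> real^3" where f: "orthogonal_transformation f" "f (a *\<^sub>R axis 1 1) = x"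
    by (rule orthogonal_transformation_exists[OF na])
  have nf: "norm (f y) = norm y" for y
    using f(1) by (rule orthogonal_transformation_norm)
  have nxy: "norm (x - f y) = sqrt (a\<^sup>2 + (norm y)\<^sup>2 - 2 * a * (y $ 1))" for y
  proof -
    have "x - f y = f (a *\<^sub>R axis 1 1 - y)"
      using f(2) linear_diff[OF orthogonal_transformation_linear[OF f(1)], of "a *\<^sub>R axis 1 1" y] by simp
    hence "norm (x - f y) = norm (a *\<^sub>R axis 1 1 - y)" by (simp add: nf)
    also have "(norm (a *\<^sub>R axis 1 1 - y))\<^sup>2 = a\<^sup>2 + (norm y)\<^sup>2 - 2 * a * (y $ 1)"
      unfolding power2_norm_eq_inner
      by (simp add: inner_diff_left inner_diff_right inner_axis' inner_axis power2_eq_square algebra_simps)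
    hence "norm (a *\<^sub>R axis 1 1 - y) = sqrt (a\<^sup>2 + (norm y)\<^sup>2 - 2 * a * (y $ 1))"
      by (metis norm_ge_zero real_sqrt_unique)
    finally show ?thesis .
  qed
  have "(\<integral>\<^sup>+y. ennreal (s (norm y)) * ennreal (1 / norm (x - y)) \<partial>lborel)
      = (\<integral>\<^sup>+y. ennreal (s (norm (f y))) * ennreal (1 / norm (x - f y)) \<partial>lborel)"
    by (rule nn_integral_orthogonal[OF f(1), symmetric]) auto
  also have "\<dots> = (\<integral>\<^sup>+y. ennreal (s (sqrt ((norm y)\<^sup>2))) *
        ennreal (1 / sqrt (a\<^sup>2 + (norm y)\<^sup>2 - 2 * a * (y $ 1))) \<partial>(lborel :: (real^3) measure))"
    by (simp add: nf nxy)
  also have "\<dots> = (\<integral>\<^sup>+v. (\<integral>\<^sup>+h. ennreal pi * (ennreal (s (sqrt v)) *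
       ennreal (1 / sqrt (a\<^sup>2 + v - 2 * a * h)) * indicator {h. h\<^sup>2 \<le> v} h) \<partial>lborel) \<partial>lborel)"
    by (subst nn_integral_axial) auto
  also have "\<dots> = (\<integral>\<^sup>+v. (\<integral>\<^sup>+h. ennreal pi * (ennreal (s (sqrt v)) *
       ennreal (1 / max a (sqrt v)) * indicator {h. h\<^sup>2 \<le> v} h) \<partial>lborel) \<partial>lborel)"
  \<comment> \<open>The value v = a^2 is the sphere through x, where the integrand is singular at an
    end of the chord.\<close>
  proof (rule nn_integral_cong_AE, rule AE_mp[OF AE_lborel_singleton[of "a\<^sup>2"]], rule AE_I2, rule impI)
    fix v :: real assume "v \<noteq> a\<^sup>2"
    have "(\<integral>\<^sup>+h. (ennreal pi * ennreal (s (sqrt v))) *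
       (ennreal (1 / sqrt (a\<^sup>2 + v - 2 * a * h)) * indicator {h. h\<^sup>2 \<le> v} h) \<partial>lborel)
     = (\<integral>\<^sup>+h. (ennreal pi * ennreal (s (sqrt v))) *
       (ennreal (1 / max a (sqrt v)) * indicator {h. h\<^sup>2 \<le> v} h) \<partial>lborel)"
      by (subst (1 2) nn_integral_cmult)
         (use nn_integral_inverse_distance_chord[OF a \<open>v \<noteq> a\<^sup>2\<close>] in auto)
    thus "(\<integral>\<^sup>+h. ennreal pi * (ennreal (s (sqrt v)) *
       ennreal (1 / sqrt (a\<^sup>2 + v - 2 * a * h)) * indicator {h. h\<^sup>2 \<le> v} h) \<partial>lborel)
     = (\<integral>\<^sup>+h. ennreal pi * (ennreal (s (sqrt v)) *
       ennreal (1 / max a (sqrt v)) * indicator {h. h\<^sup>2 \<le> v} h) \<partial>lborel)"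
      by (simp only: mult.assoc)
  qed
  also have "\<dots> = (\<integral>\<^sup>+y. ennreal (s (sqrt ((norm y)\<^sup>2))) *
        ennreal (1 / max a (sqrt ((norm y)\<^sup>2))) \<partial>(lborel :: (real^3) measure))"
    by (subst nn_integral_axial) auto
  finally show ?thesis by (simp add: a_def)
qed

lemma nn_integral_norm_powr_tail:
  assumes "p < - 3" "0 < R"
  shows "(\<integral>\<^sup>+x. ennreal (norm x powr p) * indicator {x. R \<le> norm x} x \<partial>(lborel :: (real^3) measure)) < \<infinity>"
proof -
  have [simp]: "R ^ 3 \<le> t ^ 3 \<longleftrightarrow> R \<le> t" if "0 \<le> t" for t
    using that assms by (intro power_mono_iff) auto
  have "(\<integral>\<^sup>+x. ennreal (norm x powr p) * indicator {x. R \<le> norm x} x \<partial>(lborel :: (real^3) measure))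
     = (\<integral>\<^sup>+x. (\<lambda>t. ennreal (t powr (p/3)) * indicator {R^3..} t) (norm x ^ DIM(real^3)) \<partial>(lborel :: (real^3) measure))"
    by (rule nn_integral_cong) (simp add: indicator_def cube_powr_third)
  also have "\<dots> = ennreal (4 / 3 * pi) *
      (\<integral>\<^sup>+t. ennreal (t powr (p/3)) * indicator {R^3..} t * indicator {0..} t \<partial>lborel)"
    by (subst nn_integral_norm_power) (auto simp: unit_ball_vol_3)
  also have "\<dots> < \<infinity>"
  proof -
    have "(\<integral>\<^sup>+t. ennreal (t powr (p/3)) * indicator {R^3..} t * indicator {0..} t \<partial>lborel)
        \<le> (\<integral>\<^sup>+t. ennreal (t powr (p/3)) * indicator {R^3..} t \<partial>lborel)"
      by (intro nn_integral_mono) (auto simp: indicator_def)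
    also have "\<dots> = ennreal (- ((R^3) powr (p / 3 + 1)) / (p / 3 + 1))"
      using assms by (intro nn_integral_has_integral_lebesgue' has_integral_powr_to_inf) auto
    also have "\<dots> < \<infinity>" by simp
    finally show ?thesis by (simp add: ennreal_mult_less_top)
  qed
  finally show ?thesis .
qed

section \<open>Gram representations of the kernels\<close>

text \<open>Translation, rotation and scaling reduce the integral to the case of a unit vector and the origin.\<close>

lemma coulomb_self_similar:
  obtains c :: real where "0 < c"
    "\<And>x y :: real^3. x \<noteq> y \<Longrightarrow>
      (\<integral>\<^sup>+z. ennreal (norm (x - z) powr (-2)) * ennreal (norm (y - z) powr (-2)) \<partial>lborel)
      = ennreal (c / norm (x - y))"
proof -
  define e :: "real^3" where "e = axis 1 1"
  have ne: "norm e = 1" by (simp add: e_def)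
  define I where "I = (\<integral>\<^sup>+w. ennreal (norm (e - w) powr (-2)) * ennreal (norm w powr (-2)) \<partial>lborel)"
  have scale: "(\<integral>\<^sup>+z. ennreal (norm (x - z) powr (-2)) * ennreal (norm (y - z) powr (-2)) \<partial>lborel)
      = ennreal (1 / norm (x - y)) * I" if "x \<noteq> y" for x y :: "real^3"
  proof -
    define r where "r = norm (x - y)"
    have r: "0 < r" using that by (simp add: r_def)
    have nr: "norm (r *\<^sub>R e) = norm (x - y)" by (simp add: r_def ne)
    obtain f :: "real^3 \<Rightarrow> real^3" where f: "orthogonal_transformation f" "f (r *\<^sub>R e) = x - y"
      by (rule orthogonal_transformation_exists[OF nr])
    note lin = orthogonal_transformation_linear[OF f(1)]
    have nf: "norm (f v) = norm v" for v
      using f(1) by (rule orthogonal_transformation_norm)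
    have xz: "norm (x - (y + r *\<^sub>R f w)) = r * norm (e - w)" for w
    proof -
      have "x - (y + r *\<^sub>R f w) = f (r *\<^sub>R (e - w))"
        using f(2) by (simp add: linear_diff[OF lin] linear_scale[OF lin] scaleR_diff_right)
      thus ?thesis using r by (simp add: nf)
    qed
    have yz: "norm (y - (y + r *\<^sub>R f w)) = r * norm w" for w
      using r by (simp add: nf)
    have "(\<integral>\<^sup>+z. ennreal (norm (x - z) powr (-2)) * ennreal (norm (y - z) powr (-2)) \<partial>lborel)
        = ennreal (r ^ 3) * (\<integral>\<^sup>+w. ennreal (norm (x - (y + r *\<^sub>R w)) powr (-2)) *
                ennreal (norm (y - (y + r *\<^sub>R w)) powr (-2)) \<partial>lborel)"
      using r by (intro nn_integral_affine3) auto
    also have "(\<integral>\<^sup>+w. ennreal (norm (x - (y + r *\<^sub>R w)) powr (-2)) *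
                ennreal (norm (y - (y + r *\<^sub>R w)) powr (-2)) \<partial>lborel)
        = (\<integral>\<^sup>+w. ennreal (norm (x - (y + r *\<^sub>R f w)) powr (-2)) *
                ennreal (norm (y - (y + r *\<^sub>R f w)) powr (-2)) \<partial>lborel)"
      by (rule nn_integral_orthogonal[OF f(1), symmetric]) auto
    also have "\<dots> = (\<integral>\<^sup>+w. ennreal (r powr (-4)) * (ennreal (norm (e - w) powr (-2)) * ennreal (norm w powr (-2))) \<partial>lborel)"
    proof (rule nn_integral_cong)
      fix w
      have "(r * norm (e - w)) powr (-2) * (r * norm w) powr (-2)
          = r powr (-4) * (norm (e - w) powr (-2) * norm w powr (-2))"
        using r by (simp add: powr_mult) (simp add: powr_add[symmetric])
      thus "ennreal (norm (x - (y + r *\<^sub>R f w)) powr (-2)) * ennreal (norm (y - (y + r *\<^sub>R f w)) powr (-2))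
        = ennreal (r powr (-4)) * (ennreal (norm (e - w) powr (-2)) * ennreal (norm w powr (-2)))"
        unfolding xz yz by (simp only: ennreal_mult[symmetric] powr_ge_zero mult_nonneg_nonneg)
    qed
    also have "\<dots> = ennreal (r powr (-4)) * I"
      unfolding I_def by (rule nn_integral_cmult) auto
    also have "ennreal (r ^ 3) * (ennreal (r powr (-4)) * I) = ennreal (r ^ 3 * r powr (-4)) * I"
      using r by (simp add: ennreal_mult mult.assoc)
    \<comment> \<open>The Jacobian r^3 against homogeneity -4 of the integrand leaves the Coulomb
      power.\<close>
    also have "r ^ 3 * r powr (-4) = 1 / r"
      using r by (simp add: powr_minus powr_numeral field_simps power_numeral_reduce)
    finally show ?thesis unfolding r_def .
  qed
  \<comment> \<open>Only finiteness of I is at stake. Balls of radius 1/2 isolate the two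
    singularities; in each of them the other factor is at most (1/2)^(-2) = 4. Elsewhere |w| \<le>
    |w - e| + 1 \<le> 3 |w - e|, so the integrand is at most 9 |w|^(-4), which is integrable at
    infinity.\<close>
  have "I \<le> (\<integral>\<^sup>+w. ennreal 4 * (ennreal (norm w powr (-2)) * indicator {x. norm x < 1/2} w)
            + (ennreal 4 * (ennreal (norm (w - e) powr (-2)) * indicator {x. norm x < 1/2} (w - e))
            + ennreal 9 * (ennreal (norm w powr (-4)) * indicator {x. 1/2 \<le> norm x} w)) \<partial>lborel)"
    unfolding I_def
  proof (rule nn_integral_mono)
    fix w :: "real^3"
    have en: "norm (e - w) = norm (w - e)" by (rule norm_minus_commute)
    have half: "t powr (-2) \<le> 4" if "1/2 \<le> t" for t :: real
    proof -
      have "t powr (-2) \<le> (1/2) powr (-2)" using that by (intro powr_mono2') auto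
      also have "(1/2::real) powr (-2) = 4" by (simp add: powr_minus powr_numeral power2_eq_square)
      finally show ?thesis .
    qed
    consider "norm w < 1/2" | "norm (w - e) < 1/2" | "1/2 \<le> norm w" "1/2 \<le> norm (w - e)" by linarith
    thus "ennreal (norm (e - w) powr (-2)) * ennreal (norm w powr (-2))
       \<le> ennreal 4 * (ennreal (norm w powr (-2)) * indicator {x. norm x < 1/2} w)
            + (ennreal 4 * (ennreal (norm (w - e) powr (-2)) * indicator {x. norm x < 1/2} (w - e))
            + ennreal 9 * (ennreal (norm w powr (-4)) * indicator {x. 1/2 \<le> norm x} w))"
    proof cases
      case 1
      have "1/2 \<le> norm (e - w)" using norm_triangle_ineq2[of e w] 1 ne by linarith
      hence "ennreal (norm (e - w) powr (-2)) * ennreal (norm w powr (-2)) \<le> ennreal 4 * ennreal (norm w powr (-2))"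
        by (intro mult_right_mono ennreal_leI half) auto
      hence *: "ennreal (norm (e - w) powr (-2)) * ennreal (norm w powr (-2))
          \<le> ennreal 4 * (ennreal (norm w powr (-2)) * indicator {x. norm x < 1/2} w)"
        using 1 by simp
      show ?thesis by (rule add_increasing2[OF _ *]) simp
    next
      case 2
      have "1/2 \<le> norm w" using norm_triangle_ineq2[of e "e - w"] 2 ne en by simp
      hence "ennreal (norm w powr (-2)) * ennreal (norm (e - w) powr (-2)) \<le> ennreal 4 * ennreal (norm (e - w) powr (-2))"
        by (intro mult_right_mono ennreal_leI half) auto
      hence *: "ennreal (norm (e - w) powr (-2)) * ennreal (norm w powr (-2))
          \<le> ennreal 4 * (ennreal (norm (w - e) powr (-2)) * indicator {x. norm x < 1/2} (w - e))"
        using 2 by (simp add: mult.commute en)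
      show ?thesis by (rule add_increasing[OF _ add_increasing2[OF _ *]]) simp_all
    next
      case 3
      have "norm w \<le> 3 * norm (e - w)"
        using norm_triangle_ineq2[of w e] 3 ne en by linarith
      moreover have pos: "0 < norm w" "0 < norm (e - w)" using 3 en by (metis half_gt_zero_iff less_le_trans zero_less_one)+
      ultimately have "(3 * norm (e - w)) powr (-2) \<le> norm w powr (-2)"
        by (intro powr_mono2') auto
      moreover have "(3 * norm (e - w)) powr (-2) = norm (e - w) powr (-2) / 9"
        by (simp add: powr_mult powr_minus powr_numeral power2_eq_square)
      ultimately have "norm (e - w) powr (-2) \<le> 9 * norm w powr (-2)" by simp
      hence "norm (e - w) powr (-2) * norm w powr (-2) \<le> 9 * norm w powr (-2) * norm w powr (-2)"
        by (intro mult_right_mono) auto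
      also have "\<dots> = 9 * norm w powr (-4)" by (simp add: powr_add[symmetric])
      finally have "ennreal (norm (e - w) powr (-2)) * ennreal (norm w powr (-2)) \<le> ennreal 9 * ennreal (norm w powr (-4))"
        by (simp add: ennreal_mult'[symmetric] del: ennreal_numeral)
      hence *: "ennreal (norm (e - w) powr (-2)) * ennreal (norm w powr (-2))
          \<le> ennreal 9 * (ennreal (norm w powr (-4)) * indicator {x. 1/2 \<le> norm x} w)"
        using 3 by simp
      show ?thesis by (rule add_increasing[OF _ add_increasing[OF _ *]]) simp_all
    qed
  qed
  also have "\<dots> = ennreal 4 * (\<integral>\<^sup>+w. ennreal (norm w powr (-2)) * indicator {x. norm x < 1/2} w \<partial>(lborel :: (real^3) measure))
       + (ennreal 4 * (\<integral>\<^sup>+w. ennreal (norm (w - e) powr (-2)) * indicator {x. norm x < 1/2} (w - e) \<partial>lborel)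
       + ennreal 9 * (\<integral>\<^sup>+w. ennreal (norm w powr (-4)) * indicator {x. 1/2 \<le> norm x} w \<partial>(lborel :: (real^3) measure)))"
    by (subst nn_integral_add, measurable, subst nn_integral_add, measurable,
        subst (1 2 3) nn_integral_cmult, measurable)
  also have "(\<integral>\<^sup>+w. ennreal (norm (w - e) powr (-2)) * indicator {x. norm x < 1/2} (w - e) \<partial>lborel)
       = (\<integral>\<^sup>+w. ennreal (norm w powr (-2)) * indicator {x. norm x < 1/2} w \<partial>(lborel :: (real^3) measure))"
    by (rule nn_integral_translate3) measurable
  also have "(\<integral>\<^sup>+w. ennreal (norm w powr (-2)) * indicator {x. norm x < 1/2} w \<partial>(lborel :: (real^3) measure))
      = ennreal (4 * pi / (-2 + 3) * (1/2) powr (-2 + 3))"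
    by (rule nn_integral_norm_powr_ball) auto
  finally have fin: "I < \<infinity>"
    using nn_integral_norm_powr_tail[of "-4" "1/2"]
    by (auto simp: ennreal_mult_less_top ennreal_mult_eq_top_iff top_unique less_top[symmetric])
  have "I \<noteq> 0"
  proof
    assume "I = 0"
    hence "AE w in lborel. ennreal (norm (e - w) powr (-2)) * ennreal (norm w powr (-2)) = 0"
      unfolding I_def by (subst (asm) nn_integral_0_iff_AE) auto
    hence "AE w in (lborel :: (real^3) measure). False"
      using AE_lborel_singleton[of "0::real^3"] AE_lborel_singleton[of e]
      by eventually_elim auto
    thus False unfolding eventually_False ae_filter_eq_bot_iff by simp
  qed
  then obtain c where c: "I = ennreal c" "0 < c"
    using fin by (cases I) (auto simp: top_unique)
  show ?thesis
  proof (rule that[OF c(2)])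
    fix x y :: "real^3" assume "x \<noteq> y"
    thus "(\<integral>\<^sup>+z. ennreal (norm (x - z) powr (-2)) * ennreal (norm (y - z) powr (-2)) \<partial>lborel)
      = ennreal (c / norm (x - y))"
      using c by (subst scale) (auto simp: ennreal_mult'[symmetric] mult.commute divide_inverse)
  qed
qed

text \<open>A Gram representation of the max kernel: the product of two layer functions is 1/w^2
  beyond the larger radius, and that tail integrates to the reciprocal. Positivity of the maximum
  keeps w away from 0.\<close>

lemma inverse_max_layers:
  assumes "0 < max a b"
  shows "(\<integral>\<^sup>+w. ennreal (indicator {a..} w / w) * ennreal (indicator {b..} w / w) \<partial>lborel) = ennreal (1 / max a b)"
proof -
  have "(\<integral>\<^sup>+w. ennreal (indicator {a..} w / w) * ennreal (indicator {b..} w / w) \<partial>lborel)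
      = (\<integral>\<^sup>+w. ennreal (1 / w\<^sup>2) * indicator {max a b..} w \<partial>lborel)"
    using assms
    by (intro nn_integral_cong) (auto simp: indicator_def ennreal_mult'[symmetric] power2_eq_square)
  also have "\<dots> = ennreal (0 - (- 1 / max a b))"
  proof (rule nn_integral_FTC_atLeast)
    show "((\<lambda>w. - 1 / w) \<longlongrightarrow> (0::real)) at_top"
      by (intro tendsto_divide_0[OF tendsto_const] filterlim_at_top_imp_at_infinity filterlim_ident)
  next
    fix w assume "max a b \<le> w"
    hence "0 < w" using assms by linarith
    thus "((\<lambda>w. - 1 / w) has_real_derivative 1 / w\<^sup>2) (at w)"
      by (auto intro!: derivative_eq_intros simp: power2_eq_square)
  qed auto
  finally show ?thesis by simp
qed

section \<open>Densities\<close>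

lemma powr_third_powers:
  fixes a :: real
  assumes "0 \<le> a"
  shows "a powr (5/3) = (a powr (1/3)) ^ 5" "a powr (2/3) = (a powr (1/3)) ^ 2" "a = (a powr (1/3)) ^ 3"
proof -
  have *: "(a powr (1/3)) ^ n = a powr (real n / 3)" if "0 < n" for n
  proof (cases "a = 0")
    case False
    thus ?thesis using assms by (simp add: powr_realpow[symmetric] powr_powr)
  qed (use that in simp)
  show "a powr (5/3) = (a powr (1/3)) ^ 5" "a powr (2/3) = (a powr (1/3)) ^ 2" "a = (a powr (1/3)) ^ 3"
    using assms *[of 5] *[of 2] *[of 3] by simp_all
qed

text \<open>In the cube roots x, y the Bregman distance is a polynomial with a double zero at x = y,
  and its cofactor has only nonnegative coefficients; 2/3 is the smaller of the coefficients of x^3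
  and y^3. The modulus, a fifth power of the difference of cube roots, is the quantitative convexity
  behind existence and uniqueness.\<close>

lemma bregman_five_thirds:
  fixes a b :: real
  assumes a: "0 \<le> a" and b: "0 \<le> b"
  shows "2/3 * \<bar>b powr (1/3) - a powr (1/3)\<bar> ^ 5
         \<le> b powr (5/3) - a powr (5/3) - 5/3 * a powr (2/3) * (b - a)"
proof -
  define x y where "x = b powr (1/3)" and "y = a powr (1/3)"
  have xy: "0 \<le> x" "0 \<le> y" by (auto simp: x_def y_def)
  have "b powr (5/3) - a powr (5/3) - 5/3 * a powr (2/3) * (b - a) = x ^ 5 - y ^ 5 - 5/3 * y ^ 2 * (x ^ 3 - y ^ 3)"
    using powr_third_powers[OF a] powr_third_powers[OF b] by (simp add: x_def y_def)
  also have "\<dots> = (x - y) ^ 2 * (x ^ 3 + 2 * x ^ 2 * y + 4/3 * x * y ^ 2 + 2/3 * y ^ 3)"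
    by (simp add: power2_eq_square power3_eq_cube eval_nat_numeral field_simps)
  also have "\<dots> \<ge> (x - y) ^ 2 * (2/3 * \<bar>x - y\<bar> ^ 3)"
  proof (rule mult_left_mono)
    have "\<bar>x - y\<bar> ^ 3 \<le> (max x y) ^ 3" using xy by (intro power_mono) (auto simp: max_def)
    also have "\<dots> \<le> x ^ 3 + y ^ 3" using xy by (cases "x \<le> y") (simp_all add: max_def)
    finally have "2/3 * \<bar>x - y\<bar> ^ 3 \<le> x ^ 3 + 2/3 * y ^ 3"
      using zero_le_power[OF xy(1), of 3] by linarith
    moreover have "0 \<le> 2 * x ^ 2 * y" "0 \<le> 4/3 * x * y ^ 2" using xy by auto
    ultimately show "2/3 * \<bar>x - y\<bar> ^ 3 \<le> x ^ 3 + 2 * x ^ 2 * y + 4/3 * x * y ^ 2 + 2/3 * y ^ 3" by linarith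
  qed simp
  also have "(x - y) ^ 2 * (2/3 * \<bar>x - y\<bar> ^ 3) = 2/3 * \<bar>x - y\<bar> ^ 5"
  proof -
    have "(x - y) ^ 2 = \<bar>x - y\<bar> ^ 2" by simp
    hence "(x - y) ^ 2 * (2/3 * \<bar>x - y\<bar> ^ 3) = 2/3 * (\<bar>x - y\<bar> ^ 2 * \<bar>x - y\<bar> ^ 3)" by (simp only: ac_simps)
    moreover have "\<bar>x - y\<bar> ^ 5 = \<bar>x - y\<bar> ^ 2 * \<bar>x - y\<bar> ^ 3"
      using power_add[of "\<bar>x - y\<bar>" 2 3] by (simp del: power2_abs)
    ultimately show ?thesis by simp
  qed
  finally show ?thesis unfolding x_def y_def .
qed

lemma five_thirds_tangent:
  fixes a b :: real
  assumes "0 \<le> a" "0 \<le> b"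
  shows "a powr (5/3) + 5/3 * a powr (2/3) * (b - a) \<le> b powr (5/3)"
proof -
  have "0 \<le> 2/3 * \<bar>b powr (1/3) - a powr (1/3)\<bar> ^ 5" by simp
  thus ?thesis using bregman_five_thirds[OF assms] by linarith
qed

definition mid_defect :: "real \<Rightarrow> real \<Rightarrow> real" where
  "mid_defect a b = (a powr (5/3) + b powr (5/3)) / 2 - (a / 2 + b / 2) powr (5/3)"

text \<open>Expanding at the midpoint c makes the linear terms of the two Bregman inequalities
  cancel. One of the cube roots x, y is at distance at least |x - y| / 2 from that of c, so one of
  the two fifth powers suffices.\<close>

lemma mid_defect_ge:
  assumes a: "0 \<le> a" and b: "0 \<le> b"
  shows "(\<bar>a powr (1/3) - b powr (1/3)\<bar> / 2) ^ 5 / 3 \<le> mid_defect a b"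
proof -
  define c where "c = a / 2 + b / 2"
  have c: "0 \<le> c" using a b by (simp add: c_def)
  define x y z where "x = a powr (1/3)" and "y = b powr (1/3)" and "z = c powr (1/3)"
  have 1: "2/3 * \<bar>x - z\<bar> ^ 5 \<le> a powr (5/3) - c powr (5/3) - 5/3 * c powr (2/3) * (a - c)"
    using bregman_five_thirds[OF c a] by (simp add: x_def z_def)
  have 2: "2/3 * \<bar>y - z\<bar> ^ 5 \<le> b powr (5/3) - c powr (5/3) - 5/3 * c powr (2/3) * (b - c)"
    using bregman_five_thirds[OF c b] by (simp add: y_def z_def)
  have lin: "5/3 * c powr (2/3) * (a - c) + 5/3 * c powr (2/3) * (b - c) = 0"
  proof -
    have "5/3 * c powr (2/3) * (a - c) + 5/3 * c powr (2/3) * (b - c) = 5/3 * c powr (2/3) * (a - c + (b - c))"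
      by (simp only: distrib_left)
    also have "a - c + (b - c) = 0" by (simp add: c_def)
    finally show ?thesis by simp
  qed
  have "(\<bar>x - y\<bar> / 2) ^ 5 \<le> \<bar>x - z\<bar> ^ 5 + \<bar>y - z\<bar> ^ 5"
  proof (cases "\<bar>x - y\<bar> / 2 \<le> \<bar>x - z\<bar>")
    case True
    hence "(\<bar>x - y\<bar> / 2) ^ 5 \<le> \<bar>x - z\<bar> ^ 5" by (intro power_mono) auto
    thus ?thesis using zero_le_power[of "\<bar>y - z\<bar>" 5] by linarith
  next
    case False
    hence "\<bar>x - y\<bar> / 2 \<le> \<bar>y - z\<bar>"
      using abs_triangle_ineq4[of "x - z" "y - z"] by simp
    hence "(\<bar>x - y\<bar> / 2) ^ 5 \<le> \<bar>y - z\<bar> ^ 5" by (intro power_mono) auto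
    thus ?thesis using zero_le_power[of "\<bar>x - z\<bar>" 5] by linarith
  qed
  moreover have "p / 3 \<le> (A + B) / 2 - C"
    if "p \<le> u + v" "2/3 * u \<le> A - C - s" "2/3 * v \<le> B - C - t" "s + t = 0" for p u v s t A B C :: real
    using that by argo
  ultimately have "(\<bar>x - y\<bar> / 2) ^ 5 / 3 \<le> (a powr (5/3) + b powr (5/3)) / 2 - c powr (5/3)"
    using 1 2 lin by blast
  thus ?thesis by (simp add: mid_defect_def x_def y_def c_def)
qed

lemma mid_defect_nonneg: "0 \<le> a \<Longrightarrow> 0 \<le> b \<Longrightarrow> 0 \<le> mid_defect a b"
  by (rule order_trans[OF _ mid_defect_ge]) auto

lemma mid_defect_eq_0D:
  assumes "0 \<le> a" "0 \<le> b" "mid_defect a b = 0"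
  shows "a = b"
proof -
  have "(\<bar>a powr (1/3) - b powr (1/3)\<bar> / 2) ^ 5 \<le> 0"
    using mid_defect_ge[OF assms(1,2)] assms(3) by linarith
  moreover have "0 \<le> (\<bar>a powr (1/3) - b powr (1/3)\<bar> / 2) ^ 5" by simp
  ultimately have "a powr (1/3) = b powr (1/3)" by simp
  thus ?thesis using powr_third_powers(3) assms(1,2) by metis
qed

lemma five_thirds_add_le:
  fixes a b :: real
  assumes "0 \<le> a" "0 \<le> b"
  shows "(a + b) powr (5/3) \<le> 4 * (a powr (5/3) + b powr (5/3))"
proof -
  have "(a + b) powr (5/3) \<le> (2 * max a b) powr (5/3)"
    using assms by (intro powr_mono2) (auto simp: max_def)
  also have "\<dots> = 2 powr (5/3) * (max a b) powr (5/3)" using assms by (simp add: powr_mult)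
  also have "\<dots> \<le> 4 * (a powr (5/3) + b powr (5/3))"
  proof (rule mult_mono)
    have "2 powr (5/3) \<le> (2::real) powr 2" by (intro powr_mono) auto
    thus "2 powr (5/3) \<le> (4::real)" by simp
    show "(max a b) powr (5/3) \<le> a powr (5/3) + b powr (5/3)" by (cases "a \<le> b") (auto simp: max_def)
  qed auto
  finally show ?thesis .
qed

text \<open>Young's inequality for the conjugate exponents 5/2 and 5/3, without sharp constants:
  comparing a with b^(2/3) tells which of the two terms dominates the product.\<close>

lemma young_five_halves:
  fixes a b :: real
  assumes "0 \<le> a" "0 \<le> b"
  shows "a * b \<le> a powr (5/2) + b powr (5/3)"
proof (cases "a \<le> b powr (2/3)")
  case True
  have "a * b \<le> b powr (2/3) * b" using True assms by (intro mult_right_mono) auto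
  also have "\<dots> = b powr (5/3)"
    using assms powr_mult_base[of b "2/3"] by (simp add: mult.commute)
  finally show ?thesis by (simp add: add_increasing)
next
  case False
  hence apos: "0 < a" using powr_ge_zero[of b "2/3"] by linarith
  have "b = (b powr (2/3)) powr (3/2)" using assms by (simp add: powr_powr)
  also have "\<dots> \<le> a powr (3/2)" using False by (intro powr_mono2) auto
  finally have "a * b \<le> a * a powr (3/2)" using assms by (intro mult_left_mono) auto
  also have "\<dots> = a powr (5/2)" using apos powr_mult_base[of a "3/2"] by simp
  finally show ?thesis by (simp add: add_increasing2)
qed

lemma scaled_young_five_halves:
  fixes a b e :: real
  assumes "0 \<le> a" "0 \<le> b" "0 < e"
  shows "a * b \<le> e * (a / e) powr (5/2) + e * b powr (5/3)"
proof -
  have "a / e * b \<le> (a / e) powr (5/2) + b powr (5/3)"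
    using assms by (intro young_five_halves) auto
  hence "e * (a / e * b) \<le> e * ((a / e) powr (5/2) + b powr (5/3))"
    using assms by (intro mult_left_mono) auto
  thus ?thesis using assms by (simp add: distrib_left)
qed

lemma two_thirds_mult_le:
  fixes a b :: real
  assumes "0 \<le> a" "0 \<le> b"
  shows "a powr (2/3) * b \<le> (a + b) powr (5/3)"
proof -
  have "a powr (2/3) * b \<le> (a + b) powr (2/3) * (a + b)"
    using assms by (intro mult_mono powr_mono2) auto
  also have "\<dots> = (a + b) powr (5/3)"
    using assms powr_mult_base[of "a + b" "2/3"] by (simp add: mult.commute)
  finally show ?thesis .
qed

text \<open>Borel representatives that are nonnegative everywhere, so that \<open>powr\<close> and
  the passage to \<open>ennreal\<close> need no almost-everywhere side conditions. Elements of
  \<open>I_set\<close> are brought here by the absolute value.\<close>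

definition densities :: "(real^3 \<Rightarrow> real) set" where
  "densities = {\<rho>. \<rho> \<in> borel_measurable borel \<and> (\<forall>x. 0 \<le> \<rho> x) \<and> integrable lborel \<rho>
     \<and> integrable lborel (\<lambda>x. \<rho> x powr (5/3))}"

text \<open>The relaxed constraint is convex and stable under pointwise limits, where mass can only
  be lost; an equality would not survive Fatou.\<close>

definition densities_le :: "real \<Rightarrow> (real^3 \<Rightarrow> real) set" where
  "densities_le N = {\<rho> \<in> densities. integral\<^sup>L lborel \<rho> \<le> N}"

lemma densitiesD:
  assumes "\<rho> \<in> densities"
  shows "\<rho> \<in> borel_measurable borel" "\<And>x. 0 \<le> \<rho> x" "integrable lborel \<rho>"
    "integrable lborel (\<lambda>x. \<rho> x powr (5/3))" "0 \<le> integral\<^sup>L lborel \<rho>"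
  using assms by (auto simp: densities_def)

lemma densities_comb:
  assumes \<rho>: "\<rho> \<in> densities" and \<sigma>: "\<sigma> \<in> densities" and ab: "0 \<le> a" "0 \<le> b"
  shows "(\<lambda>x. a * \<rho> x + b * \<sigma> x) \<in> densities"
proof -
  note [measurable] = densitiesD(1)[OF \<rho>] densitiesD(1)[OF \<sigma>]
  note nn = densitiesD(2)[OF \<rho>] densitiesD(2)[OF \<sigma>]
  have "integrable lborel (\<lambda>x. (a * \<rho> x + b * \<sigma> x) powr (5/3))"
  proof (rule Bochner_Integration.integrable_bound)
    show "integrable lborel (\<lambda>x. 4 * (a powr (5/3) * \<rho> x powr (5/3) + b powr (5/3) * \<sigma> x powr (5/3)))"
      using densitiesD(4)[OF \<rho>] densitiesD(4)[OF \<sigma>] by simp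
    show "AE x in lborel. norm ((a * \<rho> x + b * \<sigma> x) powr (5/3))
        \<le> norm (4 * (a powr (5/3) * \<rho> x powr (5/3) + b powr (5/3) * \<sigma> x powr (5/3)))"
      using five_thirds_add_le[of "a * \<rho> x" "b * \<sigma> x" for x] nn ab
      by (intro AE_I2) (simp add: powr_mult)
  qed measurable
  thus ?thesis
    using nn ab densitiesD(3)[OF \<rho>] densitiesD(3)[OF \<sigma>] by (auto simp: densities_def)
qed

lemma densities_indicator:
  assumes "A \<in> sets borel" "emeasure lborel A < \<infinity>" "0 \<le> c"
  shows "(\<lambda>x. c * indicator A x) \<in> densities"
proof -
  have "integrable lborel (\<lambda>x. (c * indicator A x) powr (5/3))"
  proof -
    have "(\<lambda>x. (c * indicator A x) powr (5/3)) = (\<lambda>x. c powr (5/3) * indicator A x)"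
      by (auto simp: indicator_def)
    thus ?thesis using assms by (simp add: less_top[symmetric])
  qed
  thus ?thesis using assms by (auto simp: densities_def less_top[symmetric])
qed

lemma densities_zero: "(\<lambda>x. 0) \<in> densities"
  by (auto simp: densities_def)

text \<open>The power 5/2 of 1/|x|, conjugate to the kinetic power 5/3. It is integrable near the
  origin because 5/2 < 3, and the cutoff at R removes the divergence at infinity.\<close>

definition core :: "real \<Rightarrow> real^3 \<Rightarrow> real" where
  "core R x = norm x powr (-5/2) * indicator {x. norm x < R} x"

lemma core_measurable[measurable]: "core R \<in> borel_measurable borel"
  unfolding core_def by measurable

lemma core_nonneg: "0 \<le> core R x"
  by (simp add: core_def)

lemma integrable_core:
  assumes "0 \<le> R"
  shows "integrable lborel (core R)"
proof (rule integrableI_nonneg)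
  have "(\<integral>\<^sup>+x. ennreal (core R x) \<partial>lborel)
      = (\<integral>\<^sup>+x. ennreal (norm x powr (-5/2)) * indicator {x. norm x < R} x \<partial>(lborel :: (real^3) measure))"
    by (intro nn_integral_cong) (simp add: core_def indicator_def)
  also have "\<dots> = ennreal (4 * pi / (-5/2 + 3) * R powr (-5/2 + 3))"
    using assms by (intro nn_integral_norm_powr_ball) simp_all
  finally show "(\<integral>\<^sup>+x. ennreal (core R x) \<partial>lborel) < \<infinity>" by simp
qed (auto simp: core_nonneg)

text \<open>Within radius Z/d Young's inequality trades the attraction for kinetic energy of
  arbitrarily small weight e; beyond it Z/|z| is at most d, so the mass pays. What is left over does
  not depend on t.\<close>

lemma coulomb_mult_le:
  fixes z :: "real^3"
  assumes "0 \<le> t" "0 < Z" "0 < e" "0 < d"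
  shows "Z / norm z * t \<le> e * t powr (5/3) + d * t + e * (Z / e) powr (5/2) * core (Z / d) z"
proof (cases "norm z < Z / d")
  case True
  have "(Z / norm z / e) powr (5/2) = (Z / e) powr (5/2) * norm z powr (-5/2)"
  \<comment> \<open>At the origin division by zero gives 0, so both sides vanish.\<close>
  proof (cases "z = 0")
    case False
    have "Z / norm z / e = (Z / e) / norm z" by simp
    also have "\<dots> powr (5/2) = (Z / e) powr (5/2) / norm z powr (5/2)"
      by (rule powr_divide)
    also have "\<dots> = (Z / e) powr (5/2) * norm z powr (-5/2)"
      using powr_minus[of "norm z" "5/2"] by (simp add: field_simps)
    finally show ?thesis .
  qed simp
  hence "Z / norm z * t \<le> e * ((Z / e) powr (5/2) * norm z powr (-5/2)) + e * t powr (5/3)"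
    using scaled_young_five_halves[of "Z / norm z" t e] assms by simp
  moreover have "0 \<le> d * t" using assms by simp
  ultimately show ?thesis using True by (simp add: core_def)
next
  case False
  hence "Z / norm z \<le> d"
    using assms by (cases "z = 0") (auto simp: field_simps)
  hence "Z / norm z * t \<le> d * t" using assms by (intro mult_right_mono) auto
  moreover have "0 \<le> e * t powr (5/3)" "0 \<le> e * (Z / e) powr (5/2) * core (Z / d) z"
    using assms by (auto simp: core_nonneg)
  ultimately show ?thesis by linarith
qed

lemma integrable_coulomb:
  assumes \<rho>: "\<rho> \<in> densities" and "0 < Z"
  shows "integrable lborel (\<lambda>x. Z / norm x * \<rho> x)"
proof (rule Bochner_Integration.integrable_bound)
  note [measurable] = densitiesD(1)[OF \<rho>]
  show "integrable lborel (\<lambda>x. 1 * \<rho> x powr (5/3) + 1 * \<rho> x + 1 * (Z / 1) powr (5/2) * core (Z / 1) x)"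
    using densitiesD(3,4)[OF \<rho>] integrable_core[of Z] assms(2) by simp
  show "(\<lambda>x. Z / norm x * \<rho> x) \<in> borel_measurable lborel" by measurable
  show "AE x in lborel. norm (Z / norm x * \<rho> x)
      \<le> norm (1 * \<rho> x powr (5/3) + 1 * \<rho> x + 1 * (Z / 1) powr (5/2) * core (Z / 1) x)"
  proof (rule AE_I2)
    fix x
    have "0 \<le> Z / norm x * \<rho> x" using densitiesD(2)[OF \<rho>] assms(2) by simp
    thus "norm (Z / norm x * \<rho> x) \<le> norm (1 * \<rho> x powr (5/3) + 1 * \<rho> x + 1 * (Z / 1) powr (5/2) * core (Z / 1) x)"
      using coulomb_mult_le[of "\<rho> x" Z 1 1 x] densitiesD(2)[OF \<rho>] assms(2) by simp
  qed
qed

text \<open>The singularity at y = x is absorbed by a translate of \<open>core 1\<close>, whose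
  integral does not depend on x; hence one constant works for all x.\<close>

lemma coulomb_potential_bounded:
  assumes \<rho>: "\<rho> \<in> densities"
  shows "\<exists>C. \<forall>x. (\<integral>\<^sup>+y. ennreal (1 / norm (x - y) * \<rho> y) \<partial>lborel) \<le> ennreal C"
proof (intro exI allI)
  note [measurable] = densitiesD(1)[OF \<rho>]
  fix x :: "real^3"
  have "(\<integral>\<^sup>+y. ennreal (1 / norm (x - y) * \<rho> y) \<partial>lborel)
      \<le> (\<integral>\<^sup>+y. ennreal (\<rho> y powr (5/3) + \<rho> y) + ennreal (core 1 (y - x)) \<partial>lborel)"
  proof (rule nn_integral_mono)
    fix y
    have "1 / norm (y - x) * \<rho> y \<le> \<rho> y powr (5/3) + \<rho> y + core 1 (y - x)"
      using coulomb_mult_le[of "\<rho> y" 1 1 1 "y - x"] densitiesD(2)[OF \<rho>] by simp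
    hence "ennreal (1 / norm (x - y) * \<rho> y) \<le> ennreal (\<rho> y powr (5/3) + \<rho> y + core 1 (y - x))"
      by (intro ennreal_leI) (simp add: norm_minus_commute)
    also have "\<dots> = ennreal (\<rho> y powr (5/3) + \<rho> y) + ennreal (core 1 (y - x))"
      using densitiesD(2)[OF \<rho>] core_nonneg by (intro ennreal_plus) auto
    finally show "ennreal (1 / norm (x - y) * \<rho> y) \<le> ennreal (\<rho> y powr (5/3) + \<rho> y) + ennreal (core 1 (y - x))" .
  qed
  also have "\<dots> = (\<integral>\<^sup>+y. ennreal (\<rho> y powr (5/3) + \<rho> y) \<partial>lborel) + (\<integral>\<^sup>+y. ennreal (core 1 (y - x)) \<partial>lborel)"
    by (rule nn_integral_add) auto
  also have "(\<integral>\<^sup>+y. ennreal (core 1 (y - x)) \<partial>lborel) = (\<integral>\<^sup>+y. ennreal (core 1 y) \<partial>lborel)"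
    by (rule nn_integral_translate3) auto
  also have "\<dots> = ennreal (\<integral>y. core 1 y \<partial>lborel)"
    by (rule nn_integral_eq_integral) (auto simp: integrable_core core_nonneg)
  also have "(\<integral>\<^sup>+y. ennreal (\<rho> y powr (5/3) + \<rho> y) \<partial>lborel) = ennreal (\<integral>y. \<rho> y powr (5/3) + \<rho> y \<partial>lborel)"
    using densitiesD[OF \<rho>] by (intro nn_integral_eq_integral) auto
  also have "\<dots> + ennreal (\<integral>y. core 1 y \<partial>lborel) = ennreal ((\<integral>y. \<rho> y powr (5/3) + \<rho> y \<partial>lborel) + (\<integral>y. core 1 y \<partial>lborel))"
    using densitiesD[OF \<rho>] core_nonneg by (intro ennreal_plus[symmetric] integral_nonneg_AE AE_I2) auto
  finally show "(\<integral>\<^sup>+y. ennreal (1 / norm (x - y) * \<rho> y) \<partial>lborel)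
     \<le> ennreal ((\<integral>y. \<rho> y powr (5/3) + \<rho> y \<partial>lborel) + (\<integral>y. core 1 y \<partial>lborel))" .
qed

section \<open>Thomas-Fermi functionals with a positive definite kernel\<close>

lemma AE_lborel_fst:
  assumes "AE x in (lborel :: (real^3) measure). P x"
  shows "AE p in lborel \<Otimes>\<^sub>M (lborel :: (real^3) measure). P (fst p)"
proof -
  obtain S where S: "S \<in> null_sets lborel" "{x. \<not> P x} \<subseteq> S"
    using assms by (auto simp: eventually_ae_filter)
  have "S \<times> UNIV \<in> null_sets (lborel \<Otimes>\<^sub>M (lborel :: (real^3) measure))"
    using lborel.times_in_null_sets1[OF S(1), of UNIV] by simp
  thus ?thesis by (rule AE_I') (use S(2) in \<open>auto simp: space_pair_measure\<close>)
qed

lemma AE_lborel_snd: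
  assumes "AE x in (lborel :: (real^3) measure). P x"
  shows "AE p in (lborel :: (real^3) measure) \<Otimes>\<^sub>M lborel. P (snd p)"
proof -
  obtain S where S: "S \<in> null_sets lborel" "{x. \<not> P x} \<subseteq> S"
    using assms by (auto simp: eventually_ae_filter)
  have "UNIV \<times> S \<in> null_sets ((lborel :: (real^3) measure) \<Otimes>\<^sub>M lborel)"
    using lborel.times_in_null_sets2[OF _ S(1), of UNIV "lborel :: (real^3) measure"] by simp
  thus ?thesis by (rule AE_I') (use S(2) in \<open>auto simp: space_pair_measure\<close>)
qed

lemma ennreal_two_mult_le: "2 * (a * b) \<le> a * a + b * (b::ennreal)"
proof (cases a; cases b)
  fix x y assume xy: "a = ennreal x" "0 \<le> x" "b = ennreal y" "0 \<le> y"
  have "2 * (x * y) \<le> x * x + y * y" using sum_squares_bound[of x y] by (simp add: power2_eq_square)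
  hence "ennreal (2 * (x * y)) \<le> ennreal (x * x + y * y)" by (rule ennreal_leI)
  moreover have "2 * (a * b) = ennreal (2 * (x * y))" using xy by (simp add: ennreal_mult)
  moreover have "a * a + b * b = ennreal (x * x + y * y)" using xy by (simp add: ennreal_mult)
  ultimately show ?thesis by simp
qed (simp_all add: ennreal_top_mult ennreal_mult_top)

text \<open>With T w the transform of w by g, Tonelli gives B u v = c times the integral of T u T v,
  and the claim is 2 T u T v \<le> (T u)^2 + (T v)^2 pointwise. Nonnegative extended functions avoid
  any question of integrability. The representation of k is assumed off the diagonal only: on that
  null set the Coulomb kernel is 0 by division by zero, while its Gram integral diverges.\<close>

lemma gram_kernel_positive:
  fixes g :: "'z::euclidean_space \<Rightarrow> real^3 \<Rightarrow> ennreal" and k :: "real^3 \<Rightarrow> real^3 \<Rightarrow> ennreal"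
  defines "B \<equiv> \<lambda>(u::real^3 \<Rightarrow> ennreal) v. (\<integral>\<^sup>+x. (\<integral>\<^sup>+y. u x * (k x y * v y) \<partial>lborel) \<partial>lborel)"
  assumes [measurable]: "case_prod g \<in> borel_measurable (borel \<Otimes>\<^sub>M borel)"
    and k: "\<And>x y. x \<noteq> y \<Longrightarrow> k x y = c * (\<integral>\<^sup>+z. g z x * g z y \<partial>lborel)"
    and [measurable]: "u \<in> borel_measurable borel" "v \<in> borel_measurable borel"
  shows "2 * B u v \<le> B u u + B v v"
proof -
  define T where "T = (\<lambda>(w::real^3 \<Rightarrow> ennreal) z. \<integral>\<^sup>+x. g z x * w x \<partial>lborel)"
  have Tm[measurable]: "T w \<in> borel_measurable borel" if [measurable]: "w \<in> borel_measurable borel" for w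
    unfolding T_def by measurable
  have B: "B u v = c * (\<integral>\<^sup>+z. T u z * T v z \<partial>lborel)"
    if [measurable]: "u \<in> borel_measurable borel" "v \<in> borel_measurable borel" for u v
  proof -
    have "B u v = (\<integral>\<^sup>+x. (\<integral>\<^sup>+y. c * (\<integral>\<^sup>+z. (g z x * u x) * (g z y * v y) \<partial>lborel) \<partial>lborel) \<partial>lborel)"
      unfolding B_def
    proof (rule nn_integral_cong, rule nn_integral_cong_AE, rule AE_mp[OF AE_lborel_singleton], rule AE_I2, rule impI)
      fix x y :: "real^3" assume "y \<noteq> x"
      hence "u x * (k x y * v y) = c * ((u x * v y) * (\<integral>\<^sup>+z. g z x * g z y \<partial>lborel))"
        by (simp add: k mult_ac)
      also have "(u x * v y) * (\<integral>\<^sup>+z. g z x * g z y \<partial>lborel) = (\<integral>\<^sup>+z. (u x * v y) * (g z x * g z y) \<partial>lborel)"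
        by (rule nn_integral_cmult[symmetric]) measurable
      finally show "u x * (k x y * v y) = c * (\<integral>\<^sup>+z. (g z x * u x) * (g z y * v y) \<partial>lborel)"
        by (simp add: mult_ac)
    qed
    also have "\<dots> = (\<integral>\<^sup>+x. c * (\<integral>\<^sup>+y. (\<integral>\<^sup>+z. (g z x * u x) * (g z y * v y) \<partial>lborel) \<partial>lborel) \<partial>lborel)"
      by (intro nn_integral_cong nn_integral_cmult) measurable
    also have "\<dots> = (\<integral>\<^sup>+x. c * (\<integral>\<^sup>+z. (g z x * u x) * T v z \<partial>lborel) \<partial>lborel)"
    proof (intro nn_integral_cong arg_cong2[where f = "(*)"] refl)
      fix x
      have "(\<integral>\<^sup>+y. (\<integral>\<^sup>+z. (g z x * u x) * (g z y * v y) \<partial>lborel) \<partial>lborel)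
          = (\<integral>\<^sup>+z. (\<integral>\<^sup>+y. (g z x * u x) * (g z y * v y) \<partial>lborel) \<partial>lborel)"
        by (rule lborel_pair.Fubini') measurable
      also have "\<dots> = (\<integral>\<^sup>+z. (g z x * u x) * T v z \<partial>lborel)"
        unfolding T_def by (intro nn_integral_cong nn_integral_cmult) measurable
      finally show "(\<integral>\<^sup>+y. (\<integral>\<^sup>+z. (g z x * u x) * (g z y * v y) \<partial>lborel) \<partial>lborel) = (\<integral>\<^sup>+z. (g z x * u x) * T v z \<partial>lborel)" .
    qed
    also have "\<dots> = c * (\<integral>\<^sup>+x. (\<integral>\<^sup>+z. (g z x * u x) * T v z \<partial>lborel) \<partial>lborel)"
      by (intro nn_integral_cmult) measurable
    also have "(\<integral>\<^sup>+x. (\<integral>\<^sup>+z. (g z x * u x) * T v z \<partial>lborel) \<partial>lborel)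
        = (\<integral>\<^sup>+z. (\<integral>\<^sup>+x. (g z x * u x) * T v z \<partial>lborel) \<partial>lborel)"
      by (rule lborel_pair.Fubini') measurable
    also have "\<dots> = (\<integral>\<^sup>+z. T u z * T v z \<partial>lborel)"
      unfolding T_def by (intro nn_integral_cong nn_integral_multc) measurable
    finally show ?thesis .
  qed
  have "2 * B u v = c * (\<integral>\<^sup>+z. 2 * (T u z * T v z) \<partial>lborel)"
    by (subst nn_integral_cmult) (simp_all add: B mult.left_commute)
  also have "\<dots> \<le> c * (\<integral>\<^sup>+z. T u z * T u z + T v z * T v z \<partial>lborel)"
    by (intro mult_left_mono nn_integral_mono ennreal_two_mult_le) simp
  also have "\<dots> = B u u + B v v"
    by (subst nn_integral_add) (simp_all add: B distrib_left)
  finally show ?thesis .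
qed

text \<open>The variational theory is shared by the Coulomb and the max kernel and rests on bounded
  potentials and positivity. \<open>k_positive\<close> is nonnegativity of the quadratic form at u -
  v, rearranged so that every term is a nonnegative integral.\<close>

locale tf_kernel =
  fixes \<gamma> Z :: real and k :: "real^3 \<Rightarrow> real^3 \<Rightarrow> real"
  assumes gamma_pos: "0 < \<gamma>" and Z_pos: "0 < Z"
    and k_measurable[measurable]: "case_prod k \<in> borel_measurable (borel \<Otimes>\<^sub>M borel)"
    and k_nonneg: "\<And>x y. 0 \<le> k x y" and k_sym: "\<And>x y. k x y = k y x"
    and k_bounded: "\<And>\<rho>. \<rho> \<in> densities \<Longrightarrow> \<exists>C. \<forall>x. (\<integral>\<^sup>+y. ennreal (k x y * \<rho> y) \<partial>lborel) \<le> ennreal C"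
    and k_positive: "\<And>u v :: real^3 \<Rightarrow> ennreal. u \<in> borel_measurable borel \<Longrightarrow> v \<in> borel_measurable borel \<Longrightarrow>
      2 * (\<integral>\<^sup>+x. (\<integral>\<^sup>+y. u x * (ennreal (k x y) * v y) \<partial>lborel) \<partial>lborel)
      \<le> (\<integral>\<^sup>+x. (\<integral>\<^sup>+y. u x * (ennreal (k x y) * u y) \<partial>lborel) \<partial>lborel)
        + (\<integral>\<^sup>+x. (\<integral>\<^sup>+y. v x * (ennreal (k x y) * v y) \<partial>lborel) \<partial>lborel)"
begin

section \<open>Potential, interaction form and energy of a kernel\<close>

definition pot :: "(real^3 \<Rightarrow> real) \<Rightarrow> real^3 \<Rightarrow> real" where
  "pot \<rho> x = (\<integral>y. k x y * \<rho> y \<partial>lborel)"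

definition Q :: "(real^3 \<Rightarrow> real) \<Rightarrow> (real^3 \<Rightarrow> real) \<Rightarrow> real" where
  "Q \<rho> \<sigma> = (\<integral>x. \<rho> x * pot \<sigma> x \<partial>lborel)"

definition En :: "(real^3 \<Rightarrow> real) \<Rightarrow> real" where
  "En \<rho> = 3/5 * \<gamma> * (\<integral>x. \<rho> x powr (5/3) \<partial>lborel) - (\<integral>x. Z / norm x * \<rho> x \<partial>lborel) + 1/2 * Q \<rho> \<rho>"

lemma pot_integrable:
  assumes \<rho>: "\<rho> \<in> densities"
  shows "integrable lborel (\<lambda>y. k x y * \<rho> y)"
proof (rule integrableI_nonneg)
  note [measurable] = densitiesD(1)[OF \<rho>]
  show "(\<lambda>y. k x y * \<rho> y) \<in> borel_measurable lborel" by measurable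
  show "AE y in lborel. 0 \<le> k x y * \<rho> y" using k_nonneg densitiesD(2)[OF \<rho>] by simp
  obtain C where "(\<integral>\<^sup>+y. ennreal (k x y * \<rho> y) \<partial>lborel) \<le> ennreal C" using k_bounded[OF \<rho>] by blast
  thus "(\<integral>\<^sup>+y. ennreal (k x y * \<rho> y) \<partial>lborel) < \<infinity>"
    by (metis ennreal_less_top infinity_ennreal_def le_less_trans)
qed

lemma pot_nonneg: "\<rho> \<in> densities \<Longrightarrow> 0 \<le> pot \<rho> x"
  unfolding pot_def using k_nonneg densitiesD(2) by (intro integral_nonneg_AE AE_I2) simp

lemma nn_pot: "\<rho> \<in> densities \<Longrightarrow> (\<integral>\<^sup>+y. ennreal (k x y * \<rho> y) \<partial>lborel) = ennreal (pot \<rho> x)"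
  unfolding pot_def using k_nonneg densitiesD(2)
  by (intro nn_integral_eq_integral pot_integrable AE_I2) auto

lemma pot_bounded:
  assumes \<rho>: "\<rho> \<in> densities"
  obtains C where "0 \<le> C" "\<And>x. pot \<rho> x \<le> C"
proof -
  obtain C where C: "\<And>x. (\<integral>\<^sup>+y. ennreal (k x y * \<rho> y) \<partial>lborel) \<le> ennreal C" using k_bounded[OF \<rho>] by blast
  have "pot \<rho> x \<le> max 0 C" for x
  proof -
    have "ennreal (pot \<rho> x) \<le> ennreal (max 0 C)"
      using C[of x] unfolding nn_pot[OF \<rho>] by (rule order_trans) (rule ennreal_leI, simp)
    thus ?thesis by (subst (asm) ennreal_le_iff) simp_all
  qed
  thus ?thesis using that[of "max 0 C"] by simp
qed

lemma pot_measurable[measurable]: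
  assumes \<rho>: "\<rho> \<in> densities"
  shows "pot \<rho> \<in> borel_measurable borel"
proof -
  note [measurable] = densitiesD(1)[OF \<rho>]
  show ?thesis unfolding pot_def by measurable
qed

lemma integrable_mult_pot:
  assumes f: "integrable lborel f" and \<sigma>: "\<sigma> \<in> densities"
  shows "integrable lborel (\<lambda>x. f x * pot \<sigma> x)"
proof -
  obtain C where C: "0 \<le> C" "\<And>x. pot \<sigma> x \<le> C" by (rule pot_bounded[OF \<sigma>]) blast
  have [measurable]: "f \<in> borel_measurable borel" using f by auto
  note [measurable] = pot_measurable[OF \<sigma>]
  show ?thesis
  proof (rule Bochner_Integration.integrable_bound)
    show "integrable lborel (\<lambda>x. C * f x)" using f by simp
    show "AE x in lborel. norm (f x * pot \<sigma> x) \<le> norm (C * f x)"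
    proof (rule AE_I2)
      fix x
      have "\<bar>f x\<bar> * pot \<sigma> x \<le> \<bar>f x\<bar> * C" using C by (intro mult_left_mono) auto
      thus "norm (f x * pot \<sigma> x) \<le> norm (C * f x)"
        using C pot_nonneg[OF \<sigma>] by (simp add: abs_mult mult.commute)
    qed
  qed measurable
qed

lemma nn_Q:
  assumes \<rho>: "\<rho> \<in> densities" and \<sigma>: "\<sigma> \<in> densities"
  shows "(\<integral>\<^sup>+x. (\<integral>\<^sup>+y. ennreal (\<rho> x) * (ennreal (k x y) * ennreal (\<sigma> y)) \<partial>lborel) \<partial>lborel) = ennreal (Q \<rho> \<sigma>)"
proof -
  note [measurable] = densitiesD(1)[OF \<rho>] densitiesD(1)[OF \<sigma>]
  have "(\<integral>\<^sup>+x. (\<integral>\<^sup>+y. ennreal (\<rho> x) * (ennreal (k x y) * ennreal (\<sigma> y)) \<partial>lborel) \<partial>lborel)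
      = (\<integral>\<^sup>+x. ennreal (\<rho> x * pot \<sigma> x) \<partial>lborel)"
  proof (rule nn_integral_cong)
    fix x
    have "(\<integral>\<^sup>+y. ennreal (\<rho> x) * (ennreal (k x y) * ennreal (\<sigma> y)) \<partial>lborel)
        = (\<integral>\<^sup>+y. ennreal (\<rho> x) * ennreal (k x y * \<sigma> y) \<partial>lborel)"
      using k_nonneg by (simp add: ennreal_mult')
    also have "\<dots> = ennreal (\<rho> x) * ennreal (pot \<sigma> x)"
      by (subst nn_integral_cmult) (simp_all add: nn_pot[OF \<sigma>])
    finally show "(\<integral>\<^sup>+y. ennreal (\<rho> x) * (ennreal (k x y) * ennreal (\<sigma> y)) \<partial>lborel) = ennreal (\<rho> x * pot \<sigma> x)"
      using densitiesD(2)[OF \<rho>] by (simp add: ennreal_mult')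
  qed
  also have "\<dots> = ennreal (Q \<rho> \<sigma>)"
    unfolding Q_def using densitiesD(2,3)[OF \<rho>] pot_nonneg[OF \<sigma>]
    by (intro nn_integral_eq_integral integrable_mult_pot \<sigma>) auto
  finally show ?thesis .
qed

lemma Q_nonneg: "\<rho> \<in> densities \<Longrightarrow> \<sigma> \<in> densities \<Longrightarrow> 0 \<le> Q \<rho> \<sigma>"
  unfolding Q_def using densitiesD(2) pot_nonneg by (intro integral_nonneg_AE AE_I2) simp

lemma Q_sym:
  assumes \<rho>: "\<rho> \<in> densities" and \<sigma>: "\<sigma> \<in> densities"
  shows "Q \<rho> \<sigma> = Q \<sigma> \<rho>"
proof -
  note [measurable] = densitiesD(1)[OF \<rho>] densitiesD(1)[OF \<sigma>]
  have "ennreal (Q \<rho> \<sigma>) = (\<integral>\<^sup>+y. (\<integral>\<^sup>+x. ennreal (\<rho> x) * (ennreal (k x y) * ennreal (\<sigma> y)) \<partial>lborel) \<partial>lborel)"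
    unfolding nn_Q[OF \<rho> \<sigma>, symmetric] by (rule lborel_pair.Fubini') measurable
  also have "\<dots> = ennreal (Q \<sigma> \<rho>)"
    unfolding nn_Q[OF \<sigma> \<rho>, symmetric]
  proof (intro nn_integral_cong)
    fix x y
    show "ennreal (\<rho> x) * (ennreal (k x y) * ennreal (\<sigma> y)) = ennreal (\<sigma> y) * (ennreal (k y x) * ennreal (\<rho> x))"
      by (subst k_sym) (simp add: mult_ac)
  qed
  finally show ?thesis using Q_nonneg[OF \<rho> \<sigma>] Q_nonneg[OF \<sigma> \<rho>] by simp
qed

lemma Q_positive:
  assumes \<rho>: "\<rho> \<in> densities" and \<sigma>: "\<sigma> \<in> densities"
  shows "2 * Q \<rho> \<sigma> \<le> Q \<rho> \<rho> + Q \<sigma> \<sigma>"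
proof -
  note [measurable] = densitiesD(1)[OF \<rho>] densitiesD(1)[OF \<sigma>]
  have "2 * ennreal (Q \<rho> \<sigma>) \<le> ennreal (Q \<rho> \<rho>) + ennreal (Q \<sigma> \<sigma>)"
    using k_positive[of "\<lambda>x. ennreal (\<rho> x)" "\<lambda>x. ennreal (\<sigma> x)"]
    by (simp add: nn_Q \<rho> \<sigma>)
  moreover have "2 * ennreal (Q \<rho> \<sigma>) = ennreal (2 * Q \<rho> \<sigma>)" by (simp add: ennreal_mult')
  moreover have "ennreal (Q \<rho> \<rho>) + ennreal (Q \<sigma> \<sigma>) = ennreal (Q \<rho> \<rho> + Q \<sigma> \<sigma>)"
    using Q_nonneg[OF \<rho> \<rho>] Q_nonneg[OF \<sigma> \<sigma>] by simp
  ultimately have "ennreal (2 * Q \<rho> \<sigma>) \<le> ennreal (Q \<rho> \<rho> + Q \<sigma> \<sigma>)" by simp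
  thus ?thesis
    using Q_nonneg[OF \<rho> \<rho>] Q_nonneg[OF \<sigma> \<sigma>] by (subst (asm) ennreal_le_iff) simp_all
qed

lemma pot_comb:
  assumes \<rho>: "\<rho> \<in> densities" and \<sigma>: "\<sigma> \<in> densities"
  shows "pot (\<lambda>x. a * \<rho> x + b * \<sigma> x) x = a * pot \<rho> x + b * pot \<sigma> x"
proof -
  have "pot (\<lambda>x. a * \<rho> x + b * \<sigma> x) x = (\<integral>y. a * (k x y * \<rho> y) + b * (k x y * \<sigma> y) \<partial>lborel)"
    unfolding pot_def by (intro Bochner_Integration.integral_cong) (auto simp: algebra_simps)
  also have "\<dots> = a * pot \<rho> x + b * pot \<sigma> x"
    using pot_integrable[OF \<rho>] pot_integrable[OF \<sigma>] by (simp add: pot_def)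
  finally show ?thesis .
qed

lemma Q_comb:
  assumes \<rho>: "\<rho> \<in> densities" and \<sigma>: "\<sigma> \<in> densities"
  shows "Q (\<lambda>x. a * \<rho> x + b * \<sigma> x) (\<lambda>x. a * \<rho> x + b * \<sigma> x)
       = a\<^sup>2 * Q \<rho> \<rho> + 2 * a * b * Q \<rho> \<sigma> + b\<^sup>2 * Q \<sigma> \<sigma>"
proof -
  have i: "integrable lborel (\<lambda>x. f x * pot g x)" if "f \<in> {\<rho>, \<sigma>}" "g \<in> {\<rho>, \<sigma>}" for f g
    using that \<rho> \<sigma> densitiesD(3) by (intro integrable_mult_pot) auto
  have "Q (\<lambda>x. a * \<rho> x + b * \<sigma> x) (\<lambda>x. a * \<rho> x + b * \<sigma> x)
     = (\<integral>x. a\<^sup>2 * (\<rho> x * pot \<rho> x) + (a * b * (\<rho> x * pot \<sigma> x) + (a * b * (\<sigma> x * pot \<rho> x) + b\<^sup>2 * (\<sigma> x * pot \<sigma> x))) \<partial>lborel)"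
    unfolding Q_def pot_comb[OF \<rho> \<sigma>]
    by (intro Bochner_Integration.integral_cong) (auto simp: algebra_simps power2_eq_square)
  also have "\<dots> = a\<^sup>2 * Q \<rho> \<rho> + (a * b * Q \<rho> \<sigma> + (a * b * Q \<sigma> \<rho> + b\<^sup>2 * Q \<sigma> \<sigma>))"
    by (simp add: i Q_def)
  finally show ?thesis by (simp add: Q_sym[OF \<sigma> \<rho>])
qed

lemma attraction_comb:
  assumes \<rho>: "\<rho> \<in> densities" and \<sigma>: "\<sigma> \<in> densities"
  shows "(\<integral>x. Z / norm x * (a * \<rho> x + b * \<sigma> x) \<partial>lborel)
       = a * (\<integral>x. Z / norm x * \<rho> x \<partial>lborel) + b * (\<integral>x. Z / norm x * \<sigma> x \<partial>lborel)"
proof -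
  have "(\<integral>x. Z / norm x * (a * \<rho> x + b * \<sigma> x) \<partial>lborel)
      = (\<integral>x. a * (Z / norm x * \<rho> x) + b * (Z / norm x * \<sigma> x) \<partial>lborel)"
    by (intro Bochner_Integration.integral_cong refl) (simp add: distrib_left mult.left_commute del: times_divide_eq_left)
  also have "\<dots> = a * (\<integral>x. Z / norm x * \<rho> x \<partial>lborel) + b * (\<integral>x. Z / norm x * \<sigma> x \<partial>lborel)"
    using integrable_coulomb[OF \<rho> Z_pos] integrable_coulomb[OF \<sigma> Z_pos] by (simp del: times_divide_eq_left)
  finally show ?thesis .
qed

lemma integrable_mid_defect:
  assumes \<rho>: "\<rho> \<in> densities" and \<sigma>: "\<sigma> \<in> densities"
  shows "integrable lborel (\<lambda>x. mid_defect (\<rho> x) (\<sigma> x))"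
  using densitiesD(4)[OF \<rho>] densitiesD(4)[OF \<sigma>]
    densitiesD(4)[OF densities_comb[OF \<rho> \<sigma>, of "1/2" "1/2"]]
  unfolding mid_defect_def by simp

text \<open>The attraction is linear and drops out, and the interaction contributes one eighth of
  the form at \<rho> - \<sigma>, which is nonnegative; only the kinetic Jensen gap remains as a
  lower bound.\<close>

lemma En_midpoint:
  assumes \<rho>: "\<rho> \<in> densities" and \<sigma>: "\<sigma> \<in> densities"
  shows "3/5 * \<gamma> * (\<integral>x. mid_defect (\<rho> x) (\<sigma> x) \<partial>lborel)
         \<le> (En \<rho> + En \<sigma>) / 2 - En (\<lambda>x. 1/2 * \<rho> x + 1/2 * \<sigma> x)"
proof -
  have "(\<integral>x. mid_defect (\<rho> x) (\<sigma> x) \<partial>lborel)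
     = ((\<integral>x. \<rho> x powr (5/3) \<partial>lborel) + (\<integral>x. \<sigma> x powr (5/3) \<partial>lborel)) / 2
       - (\<integral>x. (1/2 * \<rho> x + 1/2 * \<sigma> x) powr (5/3) \<partial>lborel)"
    using densitiesD(4)[OF \<rho>] densitiesD(4)[OF \<sigma>]
      densitiesD(4)[OF densities_comb[OF \<rho> \<sigma>, of "1/2" "1/2"]]
    unfolding mid_defect_def by simp
  hence "(En \<rho> + En \<sigma>) / 2 - En (\<lambda>x. 1/2 * \<rho> x + 1/2 * \<sigma> x)
      = 3/5 * \<gamma> * (\<integral>x. mid_defect (\<rho> x) (\<sigma> x) \<partial>lborel) + 1/8 * (Q \<rho> \<rho> + Q \<sigma> \<sigma> - 2 * Q \<rho> \<sigma>)"
    unfolding En_def attraction_comb[OF \<rho> \<sigma>] Q_comb[OF \<rho> \<sigma>]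
    by (simp only:) (simp add: field_simps power2_eq_square)
  thus ?thesis using Q_positive[OF \<rho> \<sigma>] by argo
qed

lemma densities_le_mid:
  assumes "\<rho> \<in> densities_le N" "\<sigma> \<in> densities_le N"
  shows "(\<lambda>x. 1/2 * \<rho> x + 1/2 * \<sigma> x) \<in> densities_le N"
proof -
  have \<rho>: "\<rho> \<in> densities" and \<sigma>: "\<sigma> \<in> densities"
    and m: "integral\<^sup>L lborel \<rho> \<le> N" "integral\<^sup>L lborel \<sigma> \<le> N"
    using assms by (auto simp: densities_le_def)
  have "(\<integral>x. 1/2 * \<rho> x + 1/2 * \<sigma> x \<partial>lborel) = 1/2 * integral\<^sup>L lborel \<rho> + 1/2 * integral\<^sup>L lborel \<sigma>"
    using densitiesD(3)[OF \<rho>] densitiesD(3)[OF \<sigma>] by simp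
  hence "(\<integral>x. 1/2 * \<rho> x + 1/2 * \<sigma> x \<partial>lborel) \<le> N" using m by linarith
  thus ?thesis using densities_comb[OF \<rho> \<sigma>, of "1/2" "1/2"] by (simp add: densities_le_def)
qed

lemma minimizer_unique:
  assumes \<rho>: "\<rho> \<in> densities_le N" and min: "\<And>\<sigma>. \<sigma> \<in> densities_le N \<Longrightarrow> En \<rho> \<le> En \<sigma>"
    and \<sigma>: "\<sigma> \<in> densities_le N" "En \<sigma> \<le> En \<rho>"
  shows "AE x in lborel. \<sigma> x = \<rho> x"
proof -
  have d: "\<rho> \<in> densities" "\<sigma> \<in> densities" using \<rho> \<sigma> by (auto simp: densities_le_def)
  let ?D = "\<lambda>x. mid_defect (\<rho> x) (\<sigma> x)"
  have "3/5 * \<gamma> * integral\<^sup>L lborel ?D \<le> 0"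
    using En_midpoint[OF d] min[OF densities_le_mid[OF \<rho> \<sigma>(1)]] \<sigma>(2) by argo
  hence "integral\<^sup>L lborel ?D \<le> 0" using gamma_pos by (simp add: mult_le_0_iff)
  moreover have nn: "0 \<le> ?D x" for x using densitiesD(2) d by (intro mid_defect_nonneg) auto
  ultimately have "integral\<^sup>L lborel ?D = 0"
    by (intro antisym integral_nonneg_AE) auto
  hence "AE x in lborel. ?D x = 0"
    using integral_nonneg_eq_0_iff_AE[OF integrable_mid_defect[OF d]] nn by auto
  thus ?thesis
    by eventually_elim (use densitiesD(2) d mid_defect_eq_0D in metis)
qed

text \<open>Coercivity: half of the kinetic coefficient 3/5 is spent on absorbing the attraction,
  the other half is kept to bound the integral of the power 5/3 along minimizing sequences.\<close>

lemma En_ge: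
  assumes \<rho>: "\<rho> \<in> densities" and d: "0 < d"
  shows "3/10 * \<gamma> * (\<integral>x. \<rho> x powr (5/3) \<partial>lborel) - d * integral\<^sup>L lborel \<rho>
     - 3/10 * \<gamma> * (Z / (3/10 * \<gamma>)) powr (5/2) * integral\<^sup>L lborel (core (Z / d)) \<le> En \<rho>"
proof -
  let ?e = "3/10 * \<gamma>"
  have e: "0 < ?e" using gamma_pos by simp
  have "(\<integral>x. Z / norm x * \<rho> x \<partial>lborel)
     \<le> (\<integral>x. ?e * \<rho> x powr (5/3) + d * \<rho> x + ?e * (Z / ?e) powr (5/2) * core (Z / d) x \<partial>lborel)"
    using densitiesD[OF \<rho>] Z_pos e d
    by (intro integral_mono integrable_coulomb \<rho> coulomb_mult_le Bochner_Integration.integrable_add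
        integrable_mult_right integrable_core) auto
  also have "\<dots> = ?e * (\<integral>x. \<rho> x powr (5/3) \<partial>lborel) + d * integral\<^sup>L lborel \<rho>
      + ?e * (Z / ?e) powr (5/2) * integral\<^sup>L lborel (core (Z / d))"
    using densitiesD[OF \<rho>] integrable_core[of "Z / d"] Z_pos d by simp
  finally show ?thesis
    unfolding En_def using Q_nonneg[OF \<rho> \<rho>] by argo
qed

end

section \<open>Existence of minimizers\<close>

lemma fatou_nn:
  fixes f :: "nat \<Rightarrow> 'a \<Rightarrow> real"
  assumes f: "\<And>n. integrable M (f n)" "\<And>n x. 0 \<le> f n x"
    and lim: "AE x in M. (\<lambda>n. f n x) \<longlonglongrightarrow> g x"
  shows "(\<integral>\<^sup>+x. ennreal (g x) \<partial>M) \<le> liminf (\<lambda>n. ennreal (integral\<^sup>L M (f n)))"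
proof -
  have [measurable]: "f n \<in> borel_measurable M" for n using f(1) by auto
  have "(\<integral>\<^sup>+x. ennreal (g x) \<partial>M) = (\<integral>\<^sup>+x. liminf (\<lambda>n. ennreal (f n x)) \<partial>M)"
  proof (rule nn_integral_cong_AE)
    show "AE x in M. ennreal (g x) = liminf (\<lambda>n. ennreal (f n x))"
      using lim
    proof eventually_elim
      fix x assume "(\<lambda>n. f n x) \<longlonglongrightarrow> g x"
      hence "(\<lambda>n. ennreal (f n x)) \<longlonglongrightarrow> ennreal (g x)" by (rule tendsto_ennrealI)
      thus "ennreal (g x) = liminf (\<lambda>n. ennreal (f n x))"
        by (intro lim_imp_Liminf[symmetric]) auto
    qed
  qed
  also have "\<dots> \<le> liminf (\<lambda>n. \<integral>\<^sup>+x. ennreal (f n x) \<partial>M)"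
    by (rule nn_integral_liminf) measurable
  also have "(\<lambda>n. \<integral>\<^sup>+x. ennreal (f n x) \<partial>M) = (\<lambda>n. ennreal (integral\<^sup>L M (f n)))"
    using f by (intro ext nn_integral_eq_integral) auto
  finally show ?thesis .
qed

lemma fatou_integrable:
  fixes f :: "nat \<Rightarrow> 'a \<Rightarrow> real"
  assumes f: "\<And>n. integrable M (f n)" "\<And>n x. 0 \<le> f n x"
    and lim: "AE x in M. (\<lambda>n. f n x) \<longlonglongrightarrow> g x"
    and g: "g \<in> borel_measurable M" "\<And>x. 0 \<le> g x"
    and B: "\<And>n. integral\<^sup>L M (f n) \<le> B"
  shows "integrable M g" "integral\<^sup>L M g \<le> B"
proof -
  have "0 \<le> integral\<^sup>L M (f 0)" using f by (intro integral_nonneg_AE) auto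
  hence B0: "0 \<le> B" using B[of 0] by linarith
  have "(\<integral>\<^sup>+x. ennreal (g x) \<partial>M) \<le> liminf (\<lambda>n. ennreal (integral\<^sup>L M (f n)))"
    by (rule fatou_nn[OF f lim])
  also have "\<dots> \<le> limsup (\<lambda>n. ennreal (integral\<^sup>L M (f n)))"
    by (rule Liminf_le_Limsup) simp
  also have "\<dots> \<le> ennreal B"
    by (rule Limsup_bounded) (intro always_eventually allI ennreal_leI B)
  finally have le: "(\<integral>\<^sup>+x. ennreal (g x) \<partial>M) \<le> ennreal B" .
  show int: "integrable M g"
    using g le by (intro integrableI_nonneg AE_I2) (auto intro: le_less_trans)
  have "ennreal (integral\<^sup>L M g) \<le> ennreal B"
    using le nn_integral_eq_integral[OF int] g(2) by simp
  thus "integral\<^sup>L M g \<le> B" using B0 by (subst (asm) ennreal_le_iff) simp_all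
qed

text \<open>Lower semicontinuity phrased with \<open>eventually\<close>, so that the one-body part
  and the interaction can be evaluated at one common index.\<close>

lemma fatou_eventually:
  fixes f :: "nat \<Rightarrow> 'a \<Rightarrow> real"
  assumes f: "\<And>n. integrable M (f n)" "\<And>n x. 0 \<le> f n x"
    and lim: "AE x in M. (\<lambda>n. f n x) \<longlonglongrightarrow> g x"
    and g: "integrable M g" "\<And>x. 0 \<le> g x" and e: "0 < e"
  shows "eventually (\<lambda>n. integral\<^sup>L M g - e < integral\<^sup>L M (f n)) sequentially"
proof -
  have nn: "0 \<le> integral\<^sup>L M (f n)" for n using f by (intro integral_nonneg_AE) auto
  show ?thesis
  proof (cases "integral\<^sup>L M g - e < 0")
    case True
    thus ?thesis using nn by (intro always_eventually allI) (meson less_le_trans)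
  next
    case False
    have "ennreal (integral\<^sup>L M g - e) < ennreal (integral\<^sup>L M g)"
      using False e by (intro ennreal_lessI) auto
    also have "\<dots> = (\<integral>\<^sup>+x. ennreal (g x) \<partial>M)"
      using g by (intro nn_integral_eq_integral[symmetric]) auto
    also have "\<dots> \<le> liminf (\<lambda>n. ennreal (integral\<^sup>L M (f n)))"
      by (rule fatou_nn[OF f lim])
    finally have "eventually (\<lambda>n. ennreal (integral\<^sup>L M g - e) < ennreal (integral\<^sup>L M (f n))) sequentially"
      by (rule less_LiminfD)
    thus ?thesis
      by eventually_elim (use False in \<open>simp add: ennreal_less_iff\<close>)
  qed
qed

lemma convergent_of_geometric_increments:
  fixes y :: "nat \<Rightarrow> real"
  assumes "\<And>n. \<bar>y (Suc n) - y n\<bar> \<le> K * (1/2) ^ n"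
  shows "convergent y"
proof -
  have "summable (\<lambda>n. K * (1/2::real) ^ n)" by (intro summable_mult summable_geometric) simp
  hence "summable (\<lambda>n. y (Suc n) - y n)"
    by (rule summable_comparison_test[rotated]) (use assms in auto)
  hence "(\<lambda>n. \<Sum>i<n. y (Suc i) - y i) \<longlonglongrightarrow> (\<Sum>n. y (Suc n) - y n)" by (rule summable_LIMSEQ)
  hence "(\<lambda>n. (y n - y 0) + y 0) \<longlonglongrightarrow> (\<Sum>n. y (Suc n) - y n) + y 0"
    unfolding sum_lessThan_telescope by (intro tendsto_add tendsto_const)
  thus ?thesis by (auto simp: convergent_def)
qed

text \<open>The gap bounds the fifth power of the increments of cube roots, so the weight 32^n =
  (2^n)^5 makes these increments O(2^(-n)) and hence summable.\<close>

lemma convergent_of_mid_defects: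
  fixes t :: "nat \<Rightarrow> real"
  assumes t: "\<And>n. 0 \<le> t n" and K: "\<And>n. 32 ^ n * mid_defect (t n) (t (Suc n)) \<le> K"
  shows "convergent t"
proof -
  define y where "y n = t n powr (1/3)" for n
  \<comment> \<open>The factor 96 = 3 * 2^5 undoes the constants of \<open>mid_defect_ge\<close>.
    With L \<ge> 1, u^5 \<le> L already implies u \<le> L, so no fifth root is taken.\<close>
  define L where "L = max 1 (96 * K)"
  have "\<bar>y (Suc n) - y n\<bar> \<le> L * (1/2) ^ n" for n
  proof -
    define u where "u = 2 ^ n * \<bar>y (Suc n) - y n\<bar>"
    have u0: "0 \<le> u" by (simp add: u_def)
    have "u ^ 5 = 96 * (32 ^ n * ((\<bar>y n - y (Suc n)\<bar> / 2) ^ 5 / 3))"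
    proof -
      have "(2 ^ n) ^ 5 = (32::real) ^ n"
        by (simp add: power_mult[symmetric] mult.commute[of n]) (simp add: power_mult)
      thus ?thesis by (simp add: u_def power_mult_distrib power_divide abs_minus_commute)
    qed
    also have "\<dots> \<le> 96 * (32 ^ n * mid_defect (t n) (t (Suc n)))"
      unfolding y_def by (intro mult_left_mono mid_defect_ge t) auto
    also have "\<dots> \<le> L" using K[of n] unfolding L_def by linarith
    finally have u5: "u ^ 5 \<le> L" .
    have "u \<le> L"
    proof (rule ccontr)
      assume "\<not> u \<le> L"
      hence uL: "L < u" "1 \<le> u" by (auto simp: L_def)
      have "u ^ 1 \<le> u ^ 5" using uL by (intro power_increasing) auto
      thus False using u5 uL by simp
    qed
    thus ?thesis by (simp add: u_def power_divide field_simps)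
  qed
  hence "convergent y" by (rule convergent_of_geometric_increments)
  then obtain l where "y \<longlonglongrightarrow> l" by (auto simp: convergent_def)
  hence "(\<lambda>n. y n ^ 3) \<longlonglongrightarrow> l ^ 3" by (rule tendsto_power)
  moreover have "y n ^ 3 = t n" for n using powr_third_powers(3)[OF t] by (simp add: y_def)
  ultimately show ?thesis by (auto simp: convergent_def)
qed

context tf_kernel
begin

text \<open>The iterated form of \<open>Q\<close> is convenient for algebra; the form on the product
  space is the one to which Fatou applies and in which \<open>E_TF\<close> is written.\<close>

lemma Q_pair:
  assumes \<rho>: "\<rho> \<in> densities" and \<sigma>: "\<sigma> \<in> densities"
  shows "integrable (lborel \<Otimes>\<^sub>M lborel) (\<lambda>p. \<rho> (fst p) * (k (fst p) (snd p) * \<sigma> (snd p)))"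
    and "(\<integral>p. \<rho> (fst p) * (k (fst p) (snd p) * \<sigma> (snd p)) \<partial>(lborel \<Otimes>\<^sub>M lborel)) = Q \<rho> \<sigma>"
proof -
  note [measurable] = densitiesD(1)[OF \<rho>] densitiesD(1)[OF \<sigma>]
  note nn = densitiesD(2)[OF \<rho>] densitiesD(2)[OF \<sigma>] k_nonneg
  let ?F = "\<lambda>p. \<rho> (fst p) * (k (fst p) (snd p) * \<sigma> (snd p))"
  have Fnn: "0 \<le> ?F p" for p using nn by simp
  have [measurable]: "?F \<in> borel_measurable (lborel \<Otimes>\<^sub>M lborel)"
    by measurable
  have "(\<integral>\<^sup>+p. ennreal (?F p) \<partial>(lborel \<Otimes>\<^sub>M lborel)) = (\<integral>\<^sup>+x. \<integral>\<^sup>+y. ennreal (?F (x, y)) \<partial>lborel \<partial>lborel)"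
    by (rule lborel.nn_integral_fst[symmetric]) measurable
  also have "\<dots> = ennreal (Q \<rho> \<sigma>)"
    unfolding nn_Q[OF \<rho> \<sigma>, symmetric] using nn by (simp add: ennreal_mult')
  finally have eq: "(\<integral>\<^sup>+p. ennreal (?F p) \<partial>(lborel \<Otimes>\<^sub>M lborel)) = ennreal (Q \<rho> \<sigma>)" .
  show int: "integrable (lborel \<Otimes>\<^sub>M lborel) ?F"
    using Fnn eq by (intro integrableI_nonneg AE_I2) simp_all
  show "integral\<^sup>L (lborel \<Otimes>\<^sub>M lborel) ?F = Q \<rho> \<sigma>"
    using eq nn_integral_eq_integral[OF int] Fnn Q_nonneg[OF \<rho> \<sigma>]
    by (simp add: integral_nonneg_AE)
qed

lemma En_bdd_below:
  assumes "0 \<le> N"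
  shows "bdd_below (En ` densities_le N)"
proof (rule bdd_belowI2)
  fix \<rho> assume "\<rho> \<in> densities_le N"
  hence \<rho>: "\<rho> \<in> densities" "integral\<^sup>L lborel \<rho> \<le> N" by (auto simp: densities_le_def)
  have "0 \<le> 3/10 * \<gamma> * (\<integral>x. \<rho> x powr (5/3) \<partial>lborel)"
    using gamma_pos by (intro mult_nonneg_nonneg integral_nonneg_AE) auto
  thus "- N - 3/10 * \<gamma> * (Z / (3/10 * \<gamma>)) powr (5/2) * integral\<^sup>L lborel (core (Z / 1)) \<le> En \<rho>"
    using En_ge[OF \<rho>(1), of 1] \<rho>(2) by argo
qed

text \<open>Midpoints of consecutive terms are admissible, so their Jensen gaps integrate to
  O(64^(-n)). Of the rate 1/64 a factor 1/32 pays for the weight required by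
  \<open>convergent_of_mid_defects\<close>; the remaining 1/2 makes the weighted gaps summable,
  hence their sum finite at almost every point.\<close>

lemma minimizing_sequence_converges:
  fixes m :: "nat \<Rightarrow> real^3 \<Rightarrow> real"
  assumes N: "0 \<le> N" and m: "\<And>n. m n \<in> densities_le N"
    and Em: "\<And>n. En (m n) \<le> Inf (En ` densities_le N) + (1/64) ^ n"
  shows "AE x in lborel. convergent (\<lambda>n. m n x)"
proof -
  define e where "e = Inf (En ` densities_le N)"
  have e: "e \<le> En \<sigma>" if "\<sigma> \<in> densities_le N" for \<sigma>
    unfolding e_def by (rule cInf_lower[OF imageI[OF that] En_bdd_below[OF N]])
  have md: "m n \<in> densities" for n using m by (auto simp: densities_le_def)
  define D where "D = (\<lambda>n x. mid_defect (m n x) (m (Suc n) x))"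
  have Dint: "integrable lborel (D n)" for n unfolding D_def by (rule integrable_mid_defect[OF md md])
  have [measurable]: "D n \<in> borel_measurable borel" for n using Dint[of n] by auto
  have Dnn: "0 \<le> D n x" for n x unfolding D_def using densitiesD(2)[OF md] by (intro mid_defect_nonneg) auto
  define C where "C = 5 / (3 * \<gamma>)"
  have DI: "integral\<^sup>L lborel (D n) \<le> C * (1/64) ^ n" for n
  proof -
    have "3/5 * \<gamma> * integral\<^sup>L lborel (D n)
        \<le> (En (m n) + En (m (Suc n))) / 2 - En (\<lambda>x. 1/2 * m n x + 1/2 * m (Suc n) x)"
      unfolding D_def by (rule En_midpoint[OF md md])
    moreover have "En (m n) \<le> e + (1/64) ^ n" using Em[of n] by (simp add: e_def)
    moreover have "En (m (Suc n)) \<le> e + (1/64) ^ n"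
    proof -
      have "(1/64::real) ^ Suc n \<le> (1/64) ^ n" by (rule power_decreasing) auto
      thus ?thesis using Em[of "Suc n"] unfolding e_def by argo
    qed
    moreover have "e \<le> En (\<lambda>x. 1/2 * m n x + 1/2 * m (Suc n) x)" by (rule e[OF densities_le_mid[OF m m]])
    ultimately have "3/5 * \<gamma> * integral\<^sup>L lborel (D n) \<le> (1/64) ^ n" by argo
    thus ?thesis using gamma_pos by (simp add: C_def field_simps)
  qed
  have "(\<integral>\<^sup>+x. (\<Sum>n. ennreal (32 ^ n * D n x)) \<partial>lborel) = (\<Sum>n. \<integral>\<^sup>+x. ennreal (32 ^ n * D n x) \<partial>lborel)"
    by (rule nn_integral_suminf) measurable
  also have "\<dots> \<le> (\<Sum>n. ennreal (C * (1/2) ^ n))"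
  proof (rule suminf_le)
    fix n
    have "(\<integral>\<^sup>+x. ennreal (32 ^ n * D n x) \<partial>lborel) = ennreal (\<integral>x. 32 ^ n * D n x \<partial>lborel)"
      using Dint Dnn by (intro nn_integral_eq_integral) auto
    also have "\<dots> \<le> ennreal (C * (1/2) ^ n)"
    proof (rule ennreal_leI)
      have "(\<integral>x. 32 ^ n * D n x \<partial>lborel) = 32 ^ n * integral\<^sup>L lborel (D n)" by simp
      also have "\<dots> \<le> 32 ^ n * (C * (1/64) ^ n)" by (intro mult_left_mono DI) auto
      also have "\<dots> = C * (1/2) ^ n"
      proof -
        have "(32::real) ^ n * (1/64) ^ n = (1/2) ^ n" by (simp add: power_mult_distrib[symmetric])
        thus ?thesis by (metis mult.left_commute)
      qed
      finally show "(\<integral>x. 32 ^ n * D n x \<partial>lborel) \<le> C * (1/2) ^ n" .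
    qed
    finally show "(\<integral>\<^sup>+x. ennreal (32 ^ n * D n x) \<partial>lborel) \<le> ennreal (C * (1/2) ^ n)" .
  qed auto
  also have "\<dots> < \<infinity>"
  proof -
    have "summable (\<lambda>n. C * (1/2::real) ^ n)" by (intro summable_mult summable_geometric) simp
    moreover have "0 \<le> C" using gamma_pos by (simp add: C_def)
    ultimately show ?thesis by (subst suminf_ennreal2) simp_all
  qed
  finally have "(\<integral>\<^sup>+x. (\<Sum>n. ennreal (32 ^ n * D n x)) \<partial>lborel) \<noteq> \<infinity>" by simp
  hence "AE x in lborel. (\<Sum>n. ennreal (32 ^ n * D n x)) \<noteq> \<infinity>"
    by (intro nn_integral_PInf_AE) measurable
  thus ?thesis
  proof eventually_elim
    fix x assume fin: "(\<Sum>n. ennreal (32 ^ n * D n x)) \<noteq> \<infinity>"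
    then obtain K where K: "0 \<le> K" "(\<Sum>n. ennreal (32 ^ n * D n x)) = ennreal K"
      by (cases "(\<Sum>n. ennreal (32 ^ n * D n x))") auto
    have "32 ^ n * D n x \<le> K" for n
    proof -
      have "(\<Sum>i\<in>{n}. ennreal (32 ^ i * D i x)) \<le> (\<Sum>n. ennreal (32 ^ n * D n x))"
        by (rule sum_le_suminf) auto
      hence "ennreal (32 ^ n * D n x) \<le> ennreal K" using K by simp
      thus ?thesis using K by (subst (asm) ennreal_le_iff) simp_all
    qed
    thus "convergent (\<lambda>n. m n x)"
      using densitiesD(2)[OF md] unfolding D_def by (intro convergent_of_mid_defects) auto
  qed
qed

text \<open>Given pointwise convergence, Fatou suffices for each part: for the mass and the power
  5/3 of the limit by uniform bounds, for the energy by applying it to a nonnegative rearrangement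
  of the one-body terms and to the interaction.\<close>

theorem minimizer_exists:
  assumes N: "0 \<le> N"
  obtains \<rho> where "\<rho> \<in> densities_le N" "\<And>\<sigma>. \<sigma> \<in> densities_le N \<Longrightarrow> En \<rho> \<le> En \<sigma>"
proof -
  define e where "e = Inf (En ` densities_le N)"
  have e: "e \<le> En \<sigma>" if "\<sigma> \<in> densities_le N" for \<sigma>
    unfolding e_def by (rule cInf_lower[OF imageI[OF that] En_bdd_below[OF N]])
  have ne: "densities_le N \<noteq> {}"
    using densities_zero N by (auto simp: densities_le_def)
  have "\<exists>\<sigma>\<in>densities_le N. En \<sigma> \<le> e + (1/64) ^ n" for n :: nat
  proof -
    have "Inf (En ` densities_le N) < e + (1/64) ^ n" by (simp add: e_def)
    then obtain v where "v \<in> En ` densities_le N" "v < e + (1/64) ^ n"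
      using cInf_lessD[of "En ` densities_le N"] ne by blast
    thus ?thesis by force
  qed
  then obtain m where m: "\<And>n. m n \<in> densities_le N" "\<And>n. En (m n) \<le> e + (1/64) ^ n" by metis
  have md: "m n \<in> densities" for n using m(1) by (auto simp: densities_le_def)
  have mN: "integral\<^sup>L lborel (m n) \<le> N" for n using m(1) by (auto simp: densities_le_def)
  note [measurable] = densitiesD(1)[OF md]
  have conv: "AE x in lborel. convergent (\<lambda>n. m n x)"
    by (rule minimizing_sequence_converges[OF N m(1)]) (use m(2) in \<open>simp add: e_def\<close>)
  \<comment> \<open>Clipping at 0 keeps the limit nonnegative also at the exceptional points, where
    \<open>lim\<close> is an arbitrary value.\<close>
  define \<rho> where "\<rho> = (\<lambda>x. max 0 (lim (\<lambda>n. m n x)))"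
  have [measurable]: "\<rho> \<in> borel_measurable borel" unfolding \<rho>_def by measurable
  have \<rho>nn: "0 \<le> \<rho> x" for x by (simp add: \<rho>_def)
  have lim: "AE x in lborel. (\<lambda>n. m n x) \<longlonglongrightarrow> \<rho> x"
    using conv
  proof eventually_elim
    fix x assume "convergent (\<lambda>n. m n x)"
    hence l: "(\<lambda>n. m n x) \<longlonglongrightarrow> lim (\<lambda>n. m n x)" by (simp add: convergent_LIMSEQ_iff)
    hence "0 \<le> lim (\<lambda>n. m n x)" by (rule LIMSEQ_le_const) (use densitiesD(2)[OF md] in auto)
    thus "(\<lambda>n. m n x) \<longlonglongrightarrow> \<rho> x" using l by (simp add: \<rho>_def)
  qed
  have int1: "integrable lborel \<rho>" and mass: "integral\<^sup>L lborel \<rho> \<le> N"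
    using fatou_integrable[OF densitiesD(3)[OF md] densitiesD(2)[OF md] lim _ \<rho>nn mN] by auto
  have lim53: "AE x in lborel. (\<lambda>n. m n x powr (5/3)) \<longlonglongrightarrow> \<rho> x powr (5/3)"
    using lim by eventually_elim
      (rule tendsto_powr'[OF _ tendsto_const], use densitiesD(2)[OF md] in auto)
  obtain B where B: "\<And>n. (\<integral>x. m n x powr (5/3) \<partial>lborel) \<le> B"
  proof -
    define w where "w = 3/10 * \<gamma> * (Z / (3/10 * \<gamma>)) powr (5/2) * integral\<^sup>L lborel (core (Z / 1))"
    have "(\<integral>x. m n x powr (5/3) \<partial>lborel) \<le> (e + 1 + N + w) / (3/10 * \<gamma>)" for n
    proof -
      have "(1/64::real) ^ n \<le> 1" by (rule power_le_one) auto
      hence "3/10 * \<gamma> * (\<integral>x. m n x powr (5/3) \<partial>lborel) \<le> e + 1 + N + w"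
        using En_ge[OF md[of n], of 1] mN[of n] m(2)[of n] unfolding w_def[symmetric] by argo
      thus ?thesis using gamma_pos by (simp add: field_simps)
    qed
    thus ?thesis using that by blast
  qed
  have int53: "integrable lborel (\<lambda>x. \<rho> x powr (5/3))"
    by (rule fatou_integrable(1)[OF densitiesD(4)[OF md] _ lim53 _ _ B]) auto
  have \<rho>d: "\<rho> \<in> densities" using \<rho>nn int1 int53 by (auto simp: densities_def)
  have \<rho>le: "\<rho> \<in> densities_le N" using \<rho>d mass by (simp add: densities_le_def)
  have "En \<rho> \<le> e + \<eta>" if \<eta>: "0 < \<eta>" for \<eta>
  proof -
    \<comment> \<open>Error budget: the mass term, the loss in \<open>G\<close> and the rate
      (1/64)^n cost at most a quarter of \<eta> each, the interaction an eighth.\<close>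
    define d where "d = \<eta> / (4 * (N + 1))"
    have d: "0 < d" using \<eta> N by (simp add: d_def)
    have dN: "d * N \<le> \<eta> / 4" using \<eta> N by (simp add: d_def field_simps)
    define \<epsilon> where "\<epsilon> = \<eta> / 4"
    have \<epsilon>: "0 < \<epsilon>" using \<eta> by (simp add: \<epsilon>_def)
    \<comment> \<open>Here the whole kinetic coefficient may be spent: the power 5/3 is already
      under control, and \<open>G\<close> only has to be nonnegative.\<close>
    let ?a = "3/5 * \<gamma>"
    define W where "W = (\<lambda>x. ?a * (Z / ?a) powr (5/2) * core (Z / d) x)"
    have W: "integrable lborel W" unfolding W_def using integrable_core[of "Z / d"] Z_pos d by simp
    \<comment> \<open>The extra term \<open>d * t\<close> dominates the attraction far out, where \<open>Z / norm x\<close> has no integrable bound;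
      its total cost \<open>d * N\<close> is negligible.\<close>
    define G where "G = (\<lambda>t x. ?a * t powr (5/3) - Z / norm x * t + d * t + W x)"
    have Gnn: "0 \<le> G t x" if "0 \<le> t" for t x
      using coulomb_mult_le[OF that Z_pos, of ?a d x] gamma_pos d unfolding G_def W_def by argo
    have Gint: "integrable lborel (\<lambda>x. G (\<sigma> x) x)"
      and GI: "(\<integral>x. G (\<sigma> x) x \<partial>lborel) = ?a * (\<integral>x. \<sigma> x powr (5/3) \<partial>lborel)
          - (\<integral>x. Z / norm x * \<sigma> x \<partial>lborel) + d * integral\<^sup>L lborel \<sigma> + integral\<^sup>L lborel W"
      if \<sigma>: "\<sigma> \<in> densities" for \<sigma>
      using densitiesD[OF \<sigma>] integrable_coulomb[OF \<sigma> Z_pos] W unfolding G_def by (simp_all del: times_divide_eq_left)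
    have limG: "AE x in lborel. (\<lambda>n. G (m n x) x) \<longlonglongrightarrow> G (\<rho> x) x"
      using lim lim53 by eventually_elim
        (unfold G_def, intro tendsto_add tendsto_diff tendsto_mult tendsto_const)
    have ev1: "eventually (\<lambda>n. (\<integral>x. G (\<rho> x) x \<partial>lborel) - \<epsilon> < (\<integral>x. G (m n x) x \<partial>lborel)) sequentially"
      by (rule fatou_eventually[OF Gint[OF md] _ limG Gint[OF \<rho>d] _ \<epsilon>])
         (use Gnn densitiesD(2)[OF md] \<rho>nn in auto)
    have limQ: "AE p in lborel \<Otimes>\<^sub>M lborel. (\<lambda>n. m n (fst p) * (k (fst p) (snd p) * m n (snd p)))
        \<longlonglongrightarrow> \<rho> (fst p) * (k (fst p) (snd p) * \<rho> (snd p))"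
      using AE_lborel_fst[OF lim] AE_lborel_snd[OF lim] by eventually_elim (intro tendsto_intros)
    have ev2: "eventually (\<lambda>n. Q \<rho> \<rho> - \<epsilon> < Q (m n) (m n)) sequentially"
      using fatou_eventually[OF Q_pair(1)[OF md md] _ limQ Q_pair(1)[OF \<rho>d \<rho>d] _ \<epsilon>]
        densitiesD(2)[OF md] \<rho>nn k_nonneg
      by (simp add: Q_pair(2)[OF md md] Q_pair(2)[OF \<rho>d \<rho>d])
    have "(\<lambda>n. (1/64::real) ^ n) \<longlonglongrightarrow> 0" by (rule LIMSEQ_power_zero) simp
    hence ev3: "eventually (\<lambda>n. (1/64::real) ^ n < \<epsilon>) sequentially" using \<epsilon> by (rule order_tendstoD(2))
    obtain n where n: "(\<integral>x. G (\<rho> x) x \<partial>lborel) - \<epsilon> < (\<integral>x. G (m n x) x \<partial>lborel)"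
      "Q \<rho> \<rho> - \<epsilon> < Q (m n) (m n)" "(1/64::real) ^ n < \<epsilon>"
      using eventually_happens[OF eventually_conj[OF ev1 eventually_conj[OF ev2 ev3]]] by auto
    have "d * integral\<^sup>L lborel (m n) \<le> d * N" using mN d by (intro mult_left_mono) auto
    moreover have "0 \<le> d * integral\<^sup>L lborel \<rho>" using d densitiesD(5)[OF \<rho>d] by simp
    ultimately show ?thesis
      using n m(2)[of n] dN \<epsilon> unfolding GI[OF \<rho>d] GI[OF md] En_def \<epsilon>_def by argo
  qed
  hence "En \<rho> \<le> e" by (rule field_le_epsilon)
  thus ?thesis using that[OF \<rho>le] e by (meson order_trans)
qed

end

section \<open>The Euler-Lagrange condition\<close>

context tf_kernel
begin

definition phi :: "(real^3 \<Rightarrow> real) \<Rightarrow> real^3 \<Rightarrow> real" where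
  "phi \<rho> x = \<gamma> * \<rho> x powr (2/3) - Z / norm x + pot \<rho> x"

lemma phi_measurable[measurable]:
  assumes "\<rho> \<in> densities"
  shows "phi \<rho> \<in> borel_measurable borel"
proof -
  note [measurable] = densitiesD(1)[OF assms] pot_measurable[OF assms]
  show ?thesis unfolding phi_def by measurable
qed

lemma integrable_two_thirds_mult:
  assumes \<rho>: "\<rho> \<in> densities" and \<sigma>: "\<sigma> \<in> densities"
  shows "integrable lborel (\<lambda>x. \<rho> x powr (2/3) * \<sigma> x)"
proof (rule Bochner_Integration.integrable_bound)
  note [measurable] = densitiesD(1)[OF \<rho>] densitiesD(1)[OF \<sigma>]
  show "integrable lborel (\<lambda>x. (1 * \<rho> x + 1 * \<sigma> x) powr (5/3))"
    by (rule densitiesD(4)[OF densities_comb[OF \<rho> \<sigma>]]) auto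
  show "(\<lambda>x. \<rho> x powr (2/3) * \<sigma> x) \<in> borel_measurable lborel" by measurable
  show "AE x in lborel. norm (\<rho> x powr (2/3) * \<sigma> x) \<le> norm ((1 * \<rho> x + 1 * \<sigma> x) powr (5/3))"
    using two_thirds_mult_le densitiesD(2)[OF \<rho>] densitiesD(2)[OF \<sigma>] by (intro AE_I2) simp
qed

lemma phi_mult:
  assumes \<rho>: "\<rho> \<in> densities" and \<sigma>: "\<sigma> \<in> densities"
  shows "integrable lborel (\<lambda>x. phi \<rho> x * \<sigma> x)"
    and "(\<integral>x. phi \<rho> x * \<sigma> x \<partial>lborel) = \<gamma> * (\<integral>x. \<rho> x powr (2/3) * \<sigma> x \<partial>lborel)
       - (\<integral>x. Z / norm x * \<sigma> x \<partial>lborel) + Q \<sigma> \<rho>"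
proof -
  have eq: "(\<lambda>x. phi \<rho> x * \<sigma> x) = (\<lambda>x. \<gamma> * (\<rho> x powr (2/3) * \<sigma> x) - Z / norm x * \<sigma> x + \<sigma> x * pot \<rho> x)"
    unfolding phi_def by (intro ext) (simp only: distrib_right left_diff_distrib mult.assoc mult.commute[of _ "pot \<rho> _"])
  note i = integrable_two_thirds_mult[OF \<rho> \<sigma>] integrable_coulomb[OF \<sigma> Z_pos] integrable_mult_pot[OF densitiesD(3)[OF \<sigma>] \<rho>]
  show "integrable lborel (\<lambda>x. phi \<rho> x * \<sigma> x)"
    unfolding eq using i by (simp del: times_divide_eq_left)
  show "(\<integral>x. phi \<rho> x * \<sigma> x \<partial>lborel) = \<gamma> * (\<integral>x. \<rho> x powr (2/3) * \<sigma> x \<partial>lborel)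
       - (\<integral>x. Z / norm x * \<sigma> x \<partial>lborel) + Q \<sigma> \<rho>"
    unfolding eq Q_def using i by (simp del: times_divide_eq_left)
qed

text \<open>A convex functional lies above its tangent: \<open>five_thirds_tangent\<close> for the
  kinetic part, positivity of the form at \<rho> - \<sigma> for the interaction, equality for the
  attraction.\<close>

lemma En_tangent:
  assumes \<rho>: "\<rho> \<in> densities" and \<sigma>: "\<sigma> \<in> densities"
  shows "(\<integral>x. phi \<rho> x * \<sigma> x \<partial>lborel) - (\<integral>x. phi \<rho> x * \<rho> x \<partial>lborel) \<le> En \<sigma> - En \<rho>"
proof -
  have "(\<integral>x. 5/3 * (\<rho> x powr (2/3) * \<sigma> x) - 5/3 * (\<rho> x powr (2/3) * \<rho> x) \<partial>lborel)
     \<le> (\<integral>x. \<sigma> x powr (5/3) - \<rho> x powr (5/3) \<partial>lborel)"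
  proof (rule integral_mono)
    fix x
    show "5/3 * (\<rho> x powr (2/3) * \<sigma> x) - 5/3 * (\<rho> x powr (2/3) * \<rho> x) \<le> \<sigma> x powr (5/3) - \<rho> x powr (5/3)"
    proof -
      have "5/3 * \<rho> x powr (2/3) * (\<sigma> x - \<rho> x) = 5/3 * (\<rho> x powr (2/3) * \<sigma> x) - 5/3 * (\<rho> x powr (2/3) * \<rho> x)"
        by (simp only: right_diff_distrib mult.assoc)
      thus ?thesis
        using five_thirds_tangent[OF densitiesD(2)[OF \<rho>] densitiesD(2)[OF \<sigma>], of x x] by argo
    qed
  qed (use integrable_two_thirds_mult[OF \<rho> \<sigma>] integrable_two_thirds_mult[OF \<rho> \<rho>]
       densitiesD(4)[OF \<rho>] densitiesD(4)[OF \<sigma>] in auto)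
  hence "5/3 * (\<integral>x. \<rho> x powr (2/3) * \<sigma> x \<partial>lborel) - 5/3 * (\<integral>x. \<rho> x powr (2/3) * \<rho> x \<partial>lborel)
     \<le> (\<integral>x. \<sigma> x powr (5/3) \<partial>lborel) - (\<integral>x. \<rho> x powr (5/3) \<partial>lborel)"
    using integrable_two_thirds_mult[OF \<rho> \<sigma>] integrable_two_thirds_mult[OF \<rho> \<rho>]
       densitiesD(4)[OF \<rho>] densitiesD(4)[OF \<sigma>] by simp
  hence "3/5 * \<gamma> * (5/3 * (\<integral>x. \<rho> x powr (2/3) * \<sigma> x \<partial>lborel) - 5/3 * (\<integral>x. \<rho> x powr (2/3) * \<rho> x \<partial>lborel))
     \<le> 3/5 * \<gamma> * ((\<integral>x. \<sigma> x powr (5/3) \<partial>lborel) - (\<integral>x. \<rho> x powr (5/3) \<partial>lborel))"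
    using gamma_pos by (intro mult_left_mono) auto
  thus ?thesis
    using Q_positive[OF \<rho> \<sigma>] unfolding phi_mult(2)[OF \<rho> \<sigma>] phi_mult(2)[OF \<rho> \<rho>] En_def Q_sym[OF \<sigma> \<rho>]
    by (simp add: algebra_simps)
qed

text \<open>The last conjunct is complementary slackness: the multiplier vanishes unless the mass constraint is active.\<close>

definition euler :: "real \<Rightarrow> (real^3 \<Rightarrow> real) \<Rightarrow> real \<Rightarrow> bool" where
  "euler N \<rho> \<mu> \<longleftrightarrow> 0 \<le> \<mu> \<and> (AE x in lborel. - \<mu> \<le> phi \<rho> x) \<and>
     (AE x in lborel. 0 < \<rho> x \<longrightarrow> phi \<rho> x = - \<mu>) \<and> \<mu> * (N - integral\<^sup>L lborel \<rho>) = 0"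

text \<open>Adding \<mu> to \<open>phi\<close> gives a function whose integral is nonnegative
  against \<sigma> and 0 against \<rho>; slackness and the sign of \<mu> settle the masses. Thus a
  solution found for one kernel can be certified for the other once the potentials agree.\<close>

theorem euler_sufficient:
  assumes \<rho>: "\<rho> \<in> densities_le N" and eu: "euler N \<rho> \<mu>" and \<sigma>: "\<sigma> \<in> densities_le N"
  shows "En \<rho> \<le> En \<sigma>"
proof -
  have d: "\<rho> \<in> densities" "\<sigma> \<in> densities" and \<sigma>N: "integral\<^sup>L lborel \<sigma> \<le> N"
    using \<rho> \<sigma> by (auto simp: densities_le_def)
  have \<mu>: "0 \<le> \<mu>" and ge: "AE x in lborel. - \<mu> \<le> phi \<rho> x"
    and eq: "AE x in lborel. 0 < \<rho> x \<longrightarrow> phi \<rho> x = - \<mu>" and cs: "\<mu> * (N - integral\<^sup>L lborel \<rho>) = 0"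
    using eu by (auto simp: euler_def)
  have I: "(\<integral>x. (phi \<rho> x + \<mu>) * s x \<partial>lborel) = (\<integral>x. phi \<rho> x * s x \<partial>lborel) + \<mu> * integral\<^sup>L lborel s"
    if "s \<in> densities" for s
    using phi_mult(1)[OF d(1) that] densitiesD(3)[OF that] by (simp add: distrib_right)
  have "0 \<le> (\<integral>x. (phi \<rho> x + \<mu>) * \<sigma> x \<partial>lborel)"
    using ge by (intro integral_nonneg_AE, eventually_elim) (use densitiesD(2)[OF d(2)] in simp)
  moreover have "(\<integral>x. (phi \<rho> x + \<mu>) * \<rho> x \<partial>lborel) = 0"
  proof (rule integral_eq_zero_AE)
    show "AE x in lborel. (phi \<rho> x + \<mu>) * \<rho> x = 0"
      using eq by eventually_elim (use densitiesD(2)[OF d(1)] in \<open>force simp: less_le\<close>)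
  qed
  moreover have "0 \<le> \<mu> * (N - integral\<^sup>L lborel \<sigma>)" using \<mu> \<sigma>N by simp
  ultimately show ?thesis
    using En_tangent[OF d] cs unfolding I[OF d(1)] I[OF d(2)] right_diff_distrib by argo
qed

text \<open>One moves from \<rho> towards \<sigma> along a segment inside the convex constraint set.
  The kinetic difference is bounded from above by the tangent at the moved point, so no derivative
  is taken under the integral; after division by s, the limit s to 0 is dominated
  convergence.\<close>

lemma first_variation:
  assumes \<rho>: "\<rho> \<in> densities_le N" and min: "\<And>\<sigma>. \<sigma> \<in> densities_le N \<Longrightarrow> En \<rho> \<le> En \<sigma>"
    and \<sigma>: "\<sigma> \<in> densities_le N"
  shows "(\<integral>x. phi \<rho> x * \<rho> x \<partial>lborel) \<le> (\<integral>x. phi \<rho> x * \<sigma> x \<partial>lborel)"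
proof -
  have d: "\<rho> \<in> densities" "\<sigma> \<in> densities" and mass: "integral\<^sup>L lborel \<rho> \<le> N" "integral\<^sup>L lborel \<sigma> \<le> N"
    using \<rho> \<sigma> by (auto simp: densities_le_def)
  note [measurable] = densitiesD(1)[OF d(1)] densitiesD(1)[OF d(2)]
  note nn = densitiesD(2)[OF d(1)] densitiesD(2)[OF d(2)]
  define r where "r = (\<lambda>s x. (1 - s) * \<rho> x + s * \<sigma> x)"
  have rd: "r s \<in> densities" if "0 \<le> s" "s \<le> 1" for s
    unfolding r_def by (rule densities_comb[OF d]) (use that in auto)
  let ?T = "\<lambda>s. (\<integral>x. r s x powr (2/3) * \<sigma> x \<partial>lborel) - (\<integral>x. r s x powr (2/3) * \<rho> x \<partial>lborel)"
  let ?V = "\<lambda>\<sigma>. (\<integral>x. Z / norm x * \<sigma> x \<partial>lborel)"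
  have ineq: "0 \<le> \<gamma> * ?T s - (?V \<sigma> - ?V \<rho>) + 1/2 * ((s - 2) * Q \<rho> \<rho> + 2 * (1 - s) * Q \<rho> \<sigma> + s * Q \<sigma> \<sigma>)"
    if s: "0 < s" "s \<le> 1" for s
  proof -
    have rs: "r s \<in> densities" using rd s by simp
    have "integral\<^sup>L lborel (r s) = (1 - s) * integral\<^sup>L lborel \<rho> + s * integral\<^sup>L lborel \<sigma>"
      unfolding r_def using densitiesD(3)[OF d(1)] densitiesD(3)[OF d(2)] by simp
    also have "\<dots> \<le> (1 - s) * N + s * N" using s mass by (intro add_mono mult_left_mono) auto
    finally have "r s \<in> densities_le N" using rs by (simp add: densities_le_def algebra_simps)
    hence "En \<rho> \<le> En (r s)" by (rule min)
    moreover have "(\<integral>x. r s x powr (5/3) \<partial>lborel) - (\<integral>x. \<rho> x powr (5/3) \<partial>lborel) \<le> 5/3 * (s * ?T s)"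
    proof -
      have "(\<integral>x. r s x powr (5/3) \<partial>lborel) - (\<integral>x. \<rho> x powr (5/3) \<partial>lborel)
          = (\<integral>x. r s x powr (5/3) - \<rho> x powr (5/3) \<partial>lborel)"
        using densitiesD(4)[OF rs] densitiesD(4)[OF d(1)] by simp
      also have "\<dots> \<le> (\<integral>x. 5/3 * s * (r s x powr (2/3) * \<sigma> x) - 5/3 * s * (r s x powr (2/3) * \<rho> x) \<partial>lborel)"
      proof (rule integral_mono)
        fix x
        have "r s x - \<rho> x = s * (\<sigma> x - \<rho> x)" by (simp add: r_def algebra_simps)
        hence "5/3 * r s x powr (2/3) * (\<rho> x - r s x)
            = 5/3 * s * (r s x powr (2/3) * \<rho> x) - 5/3 * s * (r s x powr (2/3) * \<sigma> x)"
          by (simp add: r_def field_simps)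
        with five_thirds_tangent[OF densitiesD(2)[OF rs] nn(1), of x x]
        show "r s x powr (5/3) - \<rho> x powr (5/3)
           \<le> 5/3 * s * (r s x powr (2/3) * \<sigma> x) - 5/3 * s * (r s x powr (2/3) * \<rho> x)"
          by argo
      qed (use integrable_two_thirds_mult[OF rs d(1)] integrable_two_thirds_mult[OF rs d(2)]
          densitiesD(4)[OF rs] densitiesD(4)[OF d(1)] in auto)
      also have "\<dots> = 5/3 * s * (\<integral>x. r s x powr (2/3) * \<sigma> x \<partial>lborel) - 5/3 * s * (\<integral>x. r s x powr (2/3) * \<rho> x \<partial>lborel)"
        using integrable_two_thirds_mult[OF rs d(1)] integrable_two_thirds_mult[OF rs d(2)] by simp
      also have "\<dots> = 5/3 * (s * ?T s)" by (simp only: right_diff_distrib mult.assoc)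
      finally show ?thesis .
    qed
    hence "3/5 * \<gamma> * ((\<integral>x. r s x powr (5/3) \<partial>lborel) - (\<integral>x. \<rho> x powr (5/3) \<partial>lborel)) \<le> 3/5 * \<gamma> * (5/3 * (s * ?T s))"
      using gamma_pos by (intro mult_left_mono) auto
    moreover have "?V (r s) = (1 - s) * ?V \<rho> + s * ?V \<sigma>"
      unfolding r_def by (rule attraction_comb[OF d])
    moreover have "Q (r s) (r s) = (1 - s)\<^sup>2 * Q \<rho> \<rho> + 2 * (1 - s) * s * Q \<rho> \<sigma> + s\<^sup>2 * Q \<sigma> \<sigma>"
      unfolding r_def by (rule Q_comb[OF d])
    ultimately have "0 \<le> 3/5 * \<gamma> * (5/3 * (s * ?T s)) - ((1 - s) * ?V \<rho> + s * ?V \<sigma> - ?V \<rho>)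
        + 1/2 * ((1 - s)\<^sup>2 * Q \<rho> \<rho> + 2 * (1 - s) * s * Q \<rho> \<sigma> + s\<^sup>2 * Q \<sigma> \<sigma> - Q \<rho> \<rho>)"
      unfolding En_def by argo
    also have "\<dots> = s * (\<gamma> * ?T s - (?V \<sigma> - ?V \<rho>)
        + 1/2 * ((s - 2) * Q \<rho> \<rho> + 2 * (1 - s) * Q \<rho> \<sigma> + s * Q \<sigma> \<sigma>))"
    proof -
      have "3/5 * \<gamma> * (5/3 * (s * T)) - ((1 - s) * a + s * b - a) + 1/2 * ((1 - s)\<^sup>2 * x + 2 * (1 - s) * s * y + s\<^sup>2 * z - x)
         = s * (\<gamma> * T - (b - a) + 1/2 * ((s - 2) * x + 2 * (1 - s) * y + s * z))" for T a b x y z :: real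
        by (simp add: field_simps power2_eq_square)
      thus ?thesis by blast
    qed
    finally show ?thesis using s by (simp add: zero_le_mult_iff)
  qed
  define s where "s = (\<lambda>n::nat. 1 / real (Suc n))"
  have s: "0 < s n" "s n \<le> 1" for n by (auto simp: s_def)
  have s0: "s \<longlonglongrightarrow> 0" unfolding s_def by (rule LIMSEQ_Suc[OF lim_1_over_n])
  have lim: "(\<lambda>n. \<integral>x. r (s n) x powr (2/3) * w x \<partial>lborel) \<longlonglongrightarrow> (\<integral>x. \<rho> x powr (2/3) * w x \<partial>lborel)"
    if w: "w = \<rho> \<or> w = \<sigma>" for w
  proof (rule integral_dominated_convergence)
    have [measurable]: "w \<in> borel_measurable borel" using w densitiesD(1) d by blast
    have wnn: "0 \<le> w x" for x using w nn by blast
    have [measurable]: "r u \<in> borel_measurable borel" for u unfolding r_def by measurable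
    show "(\<lambda>x. \<rho> x powr (2/3) * w x) \<in> borel_measurable lborel" by measurable
    show "\<And>n. (\<lambda>x. r (s n) x powr (2/3) * w x) \<in> borel_measurable lborel" by measurable
    show "integrable lborel (\<lambda>x. (2 * \<rho> x + 2 * \<sigma> x) powr (5/3))"
      by (rule densitiesD(4)[OF densities_comb[OF d]]) auto
    show "AE x in lborel. (\<lambda>n. r (s n) x powr (2/3) * w x) \<longlonglongrightarrow> \<rho> x powr (2/3) * w x"
    proof (intro AE_I2 tendsto_mult tendsto_const)
      fix x
      have "(\<lambda>n. r (s n) x) \<longlonglongrightarrow> (1 - 0) * \<rho> x + 0 * \<sigma> x"
        unfolding r_def by (intro tendsto_intros s0)
      thus "(\<lambda>n. r (s n) x powr (2/3)) \<longlonglongrightarrow> \<rho> x powr (2/3)"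
        by (intro tendsto_powr'[OF _ tendsto_const])
           (use densitiesD(2)[OF rd] s in \<open>auto intro!: always_eventually simp: less_imp_le\<close>)
    qed
    show "\<And>n. AE x in lborel. norm (r (s n) x powr (2/3) * w x) \<le> (2 * \<rho> x + 2 * \<sigma> x) powr (5/3)"
    proof (rule AE_I2)
      fix n x
      have r0: "0 \<le> r (s n) x" using densitiesD(2)[OF rd] s by (simp add: less_imp_le)
      have rle: "r (s n) x \<le> \<rho> x + \<sigma> x"
        unfolding r_def using s[of n] nn by (intro add_mono) (auto simp: mult_left_le_one_le)
      have wle: "w x \<le> \<rho> x + \<sigma> x" using w nn[of x] by auto
      have "r (s n) x powr (2/3) * w x \<le> (r (s n) x + w x) powr (5/3)"
        by (rule two_thirds_mult_le[OF r0 wnn])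
      also have "\<dots> \<le> (2 * \<rho> x + 2 * \<sigma> x) powr (5/3)"
        using r0 wnn[of x] rle wle by (intro powr_mono2) auto
      finally show "norm (r (s n) x powr (2/3) * w x) \<le> (2 * \<rho> x + 2 * \<sigma> x) powr (5/3)"
        using wnn by simp
    qed
  qed
  have "(\<lambda>n. \<gamma> * ?T (s n) - (?V \<sigma> - ?V \<rho>) + 1/2 * ((s n - 2) * Q \<rho> \<rho> + 2 * (1 - s n) * Q \<rho> \<sigma> + s n * Q \<sigma> \<sigma>))
     \<longlonglongrightarrow> \<gamma> * ((\<integral>x. \<rho> x powr (2/3) * \<sigma> x \<partial>lborel) - (\<integral>x. \<rho> x powr (2/3) * \<rho> x \<partial>lborel))
        - (?V \<sigma> - ?V \<rho>) + 1/2 * ((0 - 2) * Q \<rho> \<rho> + 2 * (1 - 0) * Q \<rho> \<sigma> + 0 * Q \<sigma> \<sigma>)"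
    by (intro tendsto_add tendsto_diff tendsto_mult tendsto_const s0 lim) auto
  hence "0 \<le> \<gamma> * ((\<integral>x. \<rho> x powr (2/3) * \<sigma> x \<partial>lborel) - (\<integral>x. \<rho> x powr (2/3) * \<rho> x \<partial>lborel))
        - (?V \<sigma> - ?V \<rho>) + 1/2 * ((0 - 2) * Q \<rho> \<rho> + 2 * (1 - 0) * Q \<rho> \<sigma> + 0 * Q \<sigma> \<sigma>)"
    by (rule LIMSEQ_le_const) (use ineq s in blast)
  thus ?thesis
    unfolding phi_mult(2)[OF d] phi_mult(2)[OF d(1) d(1)] Q_sym[OF d(2) d(1)]
    by (simp add: algebra_simps)
qed

text \<open>The multiplier is read off by testing against a mass \<open>N\<close> spread over a set on which
  \<open>phi\<close> would be too small.\<close>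

theorem euler_necessary:
  assumes N: "0 < N" and \<rho>: "\<rho> \<in> densities_le N" and min: "\<And>\<sigma>. \<sigma> \<in> densities_le N \<Longrightarrow> En \<rho> \<le> En \<sigma>"
  obtains \<mu> where "euler N \<rho> \<mu>"
proof -
  have d: "\<rho> \<in> densities" and mass: "integral\<^sup>L lborel \<rho> \<le> N" using \<rho> by (auto simp: densities_le_def)
  have fv: "(\<integral>x. phi \<rho> x * \<rho> x \<partial>lborel) \<le> (\<integral>x. phi \<rho> x * \<sigma> x \<partial>lborel)" if "\<sigma> \<in> densities_le N" for \<sigma>
    by (rule first_variation[OF \<rho> _ that]) (rule min)
  note [measurable] = phi_measurable[OF d] densitiesD(1)[OF d]
  define J where "J = (\<integral>x. phi \<rho> x * \<rho> x \<partial>lborel)"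
  \<comment> \<open>For mass N spread uniformly over a set A the test integral is N times the mean
    of \<open>phi\<close> on A, so minimality forces this mean to be at least J / N.\<close>
  define \<mu> where "\<mu> = - J / N"
  have "(\<lambda>x. 0) \<in> densities_le N" using densities_zero N by (simp add: densities_le_def)
  from fv[OF this] have "J \<le> 0" by (simp add: J_def)
  hence \<mu>: "0 \<le> \<mu>" using N by (simp add: \<mu>_def divide_le_0_iff)
  \<comment> \<open>Intersecting with balls keeps the volume finite, so that mass N can be spread
    uniformly over the set.\<close>
  have ball_part: "AE x in lborel. x \<in> {x. phi \<rho> x < - \<mu>} \<inter> ball 0 (real n) \<longrightarrow> False" for n
  proof -
    define A where "A = {x. phi \<rho> x < - \<mu>} \<inter> ball 0 (real n)"
    have A[measurable]: "A \<in> sets borel" unfolding A_def by measurable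
    have "emeasure lborel A \<le> emeasure lborel (ball (0::real^3) (real n))"
      unfolding A_def by (intro emeasure_mono) auto
    also have "\<dots> < \<infinity>" by (simp add: emeasure_ball)
    finally have Afin: "emeasure lborel A < \<infinity>" .
    define a where "a = measure lborel A"
    have a0: "0 \<le> a" by (simp add: a_def)
    have Ad: "(\<lambda>x. c * indicator A x) \<in> densities" if "0 \<le> c" for c
      by (rule densities_indicator[OF A Afin that])
    have Aint: "integrable lborel (indicator A :: _ \<Rightarrow> real)" using Afin by (simp add: less_top[symmetric])
    have pint: "integrable lborel (\<lambda>x. phi \<rho> x * indicator A x)"
      using phi_mult(1)[OF d Ad[of 1]] by simp
    have "0 \<le> (\<integral>x. (phi \<rho> x + \<mu>) * indicator A x \<partial>lborel)"
    proof (cases "a = 0")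
      case True
      hence "emeasure lborel A = 0" using Afin by (simp add: a_def emeasure_eq_ennreal_measure less_top[symmetric])
      hence "AE x in lborel. x \<notin> A" by (intro AE_not_in) (simp add: null_sets_def)
      hence "(\<integral>x. (phi \<rho> x + \<mu>) * indicator A x \<partial>lborel) = 0"
        by (intro integral_eq_zero_AE, eventually_elim) auto
      thus ?thesis by simp
    next
      case False
      hence a: "0 < a" using a0 by simp
      have "(\<integral>x. N / a * indicator A x \<partial>lborel) = N" using a by (simp add: a_def)
      hence "(\<lambda>x. N / a * indicator A x) \<in> densities_le N"
        using Ad[of "N / a"] N a by (simp add: densities_le_def)
      from fv[OF this] have "J \<le> (\<integral>x. N / a * (phi \<rho> x * indicator A x) \<partial>lborel)"
        by (simp add: J_def mult_ac)
      also have "\<dots> = N / a * (\<integral>x. phi \<rho> x * indicator A x \<partial>lborel)" by simp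
      finally have "a * J / N \<le> (\<integral>x. phi \<rho> x * indicator A x \<partial>lborel)" using a N by (simp add: field_simps)
      moreover have "(\<integral>x. (phi \<rho> x + \<mu>) * indicator A x \<partial>lborel) = (\<integral>x. phi \<rho> x * indicator A x \<partial>lborel) + \<mu> * a"
        using pint Aint by (simp add: distrib_right a_def)
      moreover have "\<mu> * a = - (a * J / N)" by (simp add: \<mu>_def)
      ultimately show ?thesis by linarith
    qed
    hence "(\<integral>x. - ((phi \<rho> x + \<mu>) * indicator A x) \<partial>lborel) \<le> 0" by simp
    moreover have nn: "0 \<le> - ((phi \<rho> x + \<mu>) * indicator A x)" for x
      by (auto simp: indicator_def A_def)
    moreover have int: "integrable lborel (\<lambda>x. - ((phi \<rho> x + \<mu>) * indicator A x))"
      using pint Aint by (simp add: distrib_right)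
    ultimately have "(\<integral>x. - ((phi \<rho> x + \<mu>) * indicator A x) \<partial>lborel) = 0"
      by (intro antisym integral_nonneg_AE) auto
    hence "AE x in lborel. - ((phi \<rho> x + \<mu>) * indicator A x) = 0"
      using integral_nonneg_eq_0_iff_AE[OF int] nn by auto
    thus ?thesis unfolding A_def[symmetric]
      by eventually_elim (auto simp: A_def)
  qed
  have ge: "AE x in lborel. - \<mu> \<le> phi \<rho> x"
  proof -
    have "AE x in lborel. \<forall>n. x \<in> {x. phi \<rho> x < - \<mu>} \<inter> ball 0 (real n) \<longrightarrow> False"
      using ball_part by (subst AE_all_countable) blast
    thus ?thesis
    proof eventually_elim
      fix x assume *: "\<forall>n. x \<in> {x. phi \<rho> x < - \<mu>} \<inter> ball 0 (real n) \<longrightarrow> False"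
      obtain n where "norm x < real n" using reals_Archimedean2 by blast
      thus "- \<mu> \<le> phi \<rho> x" using *[rule_format, of n] by (auto simp: not_less[symmetric])
    qed
  qed
  have I: "(\<integral>x. (phi \<rho> x + \<mu>) * \<rho> x \<partial>lborel) = J + \<mu> * integral\<^sup>L lborel \<rho>"
    using phi_mult(1)[OF d d] densitiesD(3)[OF d] by (simp add: distrib_right J_def)
  have JN: "J = - (\<mu> * N)" using N by (simp add: \<mu>_def)
  have nn: "AE x in lborel. 0 \<le> (phi \<rho> x + \<mu>) * \<rho> x"
    using ge by eventually_elim (use densitiesD(2)[OF d] in simp)
  \<comment> \<open>Since J = - \<mu> N, this integral is the negative of \<mu> (N - mass). Both are
    nonnegative, so both vanish, which yields slackness and the equation on the support at
    once.\<close>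
  have "0 \<le> (\<integral>x. (phi \<rho> x + \<mu>) * \<rho> x \<partial>lborel)" by (rule integral_nonneg_AE[OF nn])
  moreover have "0 \<le> \<mu> * (N - integral\<^sup>L lborel \<rho>)" using \<mu> mass by simp
  ultimately have cs: "\<mu> * (N - integral\<^sup>L lborel \<rho>) = 0" and z: "(\<integral>x. (phi \<rho> x + \<mu>) * \<rho> x \<partial>lborel) = 0"
    unfolding I JN right_diff_distrib by argo+
  have int: "integrable lborel (\<lambda>x. (phi \<rho> x + \<mu>) * \<rho> x)"
    using phi_mult(1)[OF d d] densitiesD(3)[OF d] by (simp add: distrib_right)
  have "AE x in lborel. (phi \<rho> x + \<mu>) * \<rho> x = 0"
    using integral_nonneg_eq_0_iff_AE[OF int nn] z by simp
  hence "AE x in lborel. 0 < \<rho> x \<longrightarrow> phi \<rho> x = - \<mu>"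
    by eventually_elim auto
  thus ?thesis using that[of \<mu>] \<mu> ge cs by (simp add: euler_def)
qed

end

section \<open>The atom\<close>

text \<open>The potentials agree at every point, not merely almost everywhere; this permits choosing
  a representative through the Euler-Lagrange equation.\<close>

lemma (in tf_kernel) pot_cong_AE:
  assumes "AE x in lborel. \<rho> x = \<sigma> x" and [measurable]: "\<rho> \<in> borel_measurable borel" "\<sigma> \<in> borel_measurable borel"
  shows "pot \<rho> = pot \<sigma>"
proof
  fix x
  show "pot \<rho> x = pot \<sigma> x"
    unfolding pot_def using assms(1) by (intro integral_cong_AE) (auto elim: eventually_mono)
qed

lemma (in tf_kernel) En_cong_AE:
  assumes eq: "AE x in lborel. \<rho> x = \<sigma> x" and \<rho>: "\<rho> \<in> densities" and \<sigma>: "\<sigma> \<in> densities"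
  shows "En \<rho> = En \<sigma>"
proof -
  note [measurable] = densitiesD(1)[OF \<rho>] densitiesD(1)[OF \<sigma>] pot_measurable[OF \<sigma>]
  have p: "pot \<rho> = pot \<sigma>" by (rule pot_cong_AE[OF eq]) measurable
  have "(\<integral>x. \<rho> x powr (5/3) \<partial>lborel) = (\<integral>x. \<sigma> x powr (5/3) \<partial>lborel)"
    using eq by (intro integral_cong_AE) (auto elim: eventually_mono)
  moreover have "(\<integral>x. Z / norm x * \<rho> x \<partial>lborel) = (\<integral>x. Z / norm x * \<sigma> x \<partial>lborel)"
    using eq by (intro integral_cong_AE) (auto elim: eventually_mono)
  moreover have "Q \<rho> \<rho> = Q \<sigma> \<sigma>"
    unfolding Q_def p using eq by (intro integral_cong_AE) (auto elim: eventually_mono)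
  ultimately show ?thesis unfolding En_def by simp
qed

text \<open>The spherical average of the Coulomb kernel.\<close>

definition kmax :: "real^3 \<Rightarrow> real^3 \<Rightarrow> real" where
  "kmax x y = 1 / max (norm x) (norm y)"

definition kcoul :: "real^3 \<Rightarrow> real^3 \<Rightarrow> real" where
  "kcoul x y = 1 / norm (x - y)"

text \<open>Potentials are bounded by their value at the origin, the Coulomb integral of the
  density; positivity comes from the layer representation of 1/max.\<close>

lemma tf_kernel_kmax:
  assumes "0 < \<gamma>" "0 < Z"
  shows "tf_kernel \<gamma> Z kmax"
proof
  show "case_prod kmax \<in> borel_measurable (borel \<Otimes>\<^sub>M borel)"
    unfolding kmax_def by measurable
  show "kmax x y = kmax y x" for x y by (simp add: kmax_def max.commute)
  show "\<exists>C. \<forall>x. (\<integral>\<^sup>+y. ennreal (kmax x y * \<rho> y) \<partial>lborel) \<le> ennreal C" if \<rho>: "\<rho> \<in> densities" for \<rho>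
  proof (intro exI allI)
    fix x :: "real^3"
    have "(\<integral>\<^sup>+y. ennreal (kmax x y * \<rho> y) \<partial>lborel) \<le> (\<integral>\<^sup>+y. ennreal (1 / norm y * \<rho> y) \<partial>lborel)"
    proof (rule nn_integral_mono_AE, rule AE_mp[OF AE_lborel_singleton[of 0]], rule AE_I2, rule impI)
      fix y :: "real^3" assume "y \<noteq> 0"
      hence "kmax x y \<le> 1 / norm y" unfolding kmax_def by (intro divide_left_mono) (auto simp: less_max_iff_disj)
      thus "ennreal (kmax x y * \<rho> y) \<le> ennreal (1 / norm y * \<rho> y)"
        using densitiesD(2)[OF \<rho>] by (intro ennreal_leI mult_right_mono)
    qed
    also have "\<dots> = ennreal (\<integral>y. 1 / norm y * \<rho> y \<partial>lborel)"
      using integrable_coulomb[OF \<rho>, of 1] densitiesD(2)[OF \<rho>] by (intro nn_integral_eq_integral) auto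
    finally show "(\<integral>\<^sup>+y. ennreal (kmax x y * \<rho> y) \<partial>lborel) \<le> ennreal (\<integral>y. 1 / norm y * \<rho> y \<partial>lborel)" .
  qed
next
  fix u v :: "real^3 \<Rightarrow> ennreal"
  assume uv: "u \<in> borel_measurable borel" "v \<in> borel_measurable borel"
  define g where "g = (\<lambda>(w::real) (x::real^3). ennreal (indicator {norm x..} w / w))"
  have gm: "case_prod g \<in> borel_measurable (borel \<Otimes>\<^sub>M borel)"
  proof -
    have "case_prod g = (\<lambda>p. ennreal ((if norm (snd p) \<le> fst p then 1 else 0) / fst p))"
      by (auto simp: g_def fun_eq_iff indicator_def)
    also have "\<dots> \<in> borel_measurable (borel \<Otimes>\<^sub>M borel)" by measurable
    finally show ?thesis .
  qed
  have "ennreal (kmax x y) = 1 * (\<integral>\<^sup>+w. g w x * g w y \<partial>lborel)" if "x \<noteq> y" for x y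
  proof -
    have "0 < norm x \<or> 0 < norm y" using that by auto
    hence "0 < max (norm x) (norm y)" by (simp add: less_max_iff_disj)
    from inverse_max_layers[OF this] show ?thesis by (simp add: g_def kmax_def)
  qed
  from gram_kernel_positive[where g = g and c = 1 and k = "\<lambda>x y. ennreal (kmax x y)", OF gm this uv]
  show "2 * (\<integral>\<^sup>+x. (\<integral>\<^sup>+y. u x * (ennreal (kmax x y) * v y) \<partial>lborel) \<partial>lborel)
      \<le> (\<integral>\<^sup>+x. (\<integral>\<^sup>+y. u x * (ennreal (kmax x y) * u y) \<partial>lborel) \<partial>lborel)
        + (\<integral>\<^sup>+x. (\<integral>\<^sup>+y. v x * (ennreal (kmax x y) * v y) \<partial>lborel) \<partial>lborel)" .
qed (use assms in \<open>auto simp: kmax_def intro: order_trans[OF norm_ge_zero max.cobounded1]\<close>)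

lemma tf_kernel_kcoul:
  assumes "0 < \<gamma>" "0 < Z"
  shows "tf_kernel \<gamma> Z kcoul"
proof
  show "case_prod kcoul \<in> borel_measurable (borel \<Otimes>\<^sub>M borel)"
    unfolding kcoul_def by measurable
  show "kcoul x y = kcoul y x" for x y by (simp add: kcoul_def norm_minus_commute)
  show "\<exists>C. \<forall>x. (\<integral>\<^sup>+y. ennreal (kcoul x y * \<rho> y) \<partial>lborel) \<le> ennreal C" if "\<rho> \<in> densities" for \<rho>
    unfolding kcoul_def by (rule coulomb_potential_bounded[OF that])
next
  fix u v :: "real^3 \<Rightarrow> ennreal"
  assume uv: "u \<in> borel_measurable borel" "v \<in> borel_measurable borel"
  obtain c where c: "0 < c" "\<And>x y :: real^3. x \<noteq> y \<Longrightarrow>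
      (\<integral>\<^sup>+z. ennreal (norm (x - z) powr (-2)) * ennreal (norm (y - z) powr (-2)) \<partial>lborel)
      = ennreal (c / norm (x - y))"
    by (rule coulomb_self_similar) blast
  define g where "g = (\<lambda>(z::real^3) (x::real^3). ennreal (norm (x - z) powr (-2)))"
  have gm: "case_prod g \<in> borel_measurable (borel \<Otimes>\<^sub>M borel)"
    unfolding g_def by measurable
  have "ennreal (kcoul x y) = ennreal (1 / c) * (\<integral>\<^sup>+w. g w x * g w y \<partial>lborel)" if "x \<noteq> y" for x y
    using c(1) unfolding g_def c(2)[OF that] by (simp add: kcoul_def ennreal_mult'[symmetric])
  from gram_kernel_positive[where g = g and c = "ennreal (1 / c)" and k = "\<lambda>x y. ennreal (kcoul x y)", OF gm this uv]
  show "2 * (\<integral>\<^sup>+x. (\<integral>\<^sup>+y. u x * (ennreal (kcoul x y) * v y) \<partial>lborel) \<partial>lborel)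
      \<le> (\<integral>\<^sup>+x. (\<integral>\<^sup>+y. u x * (ennreal (kcoul x y) * u y) \<partial>lborel) \<partial>lborel)
        + (\<integral>\<^sup>+x. (\<integral>\<^sup>+y. v x * (ennreal (kcoul x y) * v y) \<partial>lborel) \<partial>lborel)" .
qed (use assms in \<open>auto simp: kcoul_def\<close>)

text \<open>Equal norms give both inequalities, so radial symmetry is included. The origin is exempt
  as inner point because Z / norm 0 = 0 makes the solutions of the Euler-Lagrange equation vanish
  there.\<close>

definition radially_decreasing :: "(real^3 \<Rightarrow> real) \<Rightarrow> bool" where
  "radially_decreasing \<rho> \<longleftrightarrow> (\<forall>x y. x \<noteq> 0 \<longrightarrow> norm x \<le> norm y \<longrightarrow> \<rho> y \<le> \<rho> x)"

locale tf_atom =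
  fixes \<gamma> Z :: real
  assumes gamma_pos: "0 < \<gamma>" and Z_pos: "0 < Z"
begin

sublocale mx: tf_kernel \<gamma> Z kmax
  by (rule tf_kernel_kmax[OF gamma_pos Z_pos])

sublocale cl: tf_kernel \<gamma> Z kcoul
  by (rule tf_kernel_kcoul[OF gamma_pos Z_pos])

lemma newton_pot:
  assumes \<rho>: "\<rho> \<in> densities" and rad: "radially_decreasing \<rho>" and x: "x \<noteq> 0"
  shows "cl.pot \<rho> x = mx.pot \<rho> x"
proof -
  note [measurable] = densitiesD(1)[OF \<rho>]
  define s where "s = (\<lambda>r::real. \<rho> (r *\<^sub>R axis 1 1))"
  have [measurable]: "s \<in> borel_measurable borel" unfolding s_def by measurable
  have s: "\<rho> y = s (norm y)" if "y \<noteq> 0" for y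
  proof (rule antisym)
    show "\<rho> y \<le> s (norm y)" unfolding s_def
      using rad[unfolded radially_decreasing_def, rule_format, of "norm y *\<^sub>R axis 1 1" y] that by simp
    show "s (norm y) \<le> \<rho> y" unfolding s_def
      using rad[unfolded radially_decreasing_def, rule_format, of y "norm y *\<^sub>R axis 1 1"] that by simp
  qed
  have AE: "(\<integral>\<^sup>+y. ennreal (K y * \<rho> y) \<partial>lborel) = (\<integral>\<^sup>+y. ennreal (s (norm y)) * ennreal (K y) \<partial>lborel)"
    if "\<And>y. 0 \<le> K y" for K
    by (rule nn_integral_cong_AE, rule AE_mp[OF AE_lborel_singleton[of 0]], rule AE_I2)
       (simp add: s[symmetric] ennreal_mult' that mult.commute)
  have "ennreal (cl.pot \<rho> x) = ennreal (mx.pot \<rho> x)"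
    unfolding cl.nn_pot[OF \<rho>, symmetric] mx.nn_pot[OF \<rho>, symmetric] AE[OF mx.k_nonneg] AE[OF cl.k_nonneg]
    unfolding kmax_def kcoul_def by (rule newton) (use x in auto)
  thus ?thesis using cl.pot_nonneg[OF \<rho>] mx.pot_nonneg[OF \<rho>] by simp
qed

lemma newton_En:
  assumes \<rho>: "\<rho> \<in> densities" and rad: "radially_decreasing \<rho>"
  shows "cl.En \<rho> = mx.En \<rho>"
proof -
  note [measurable] = densitiesD(1)[OF \<rho>] mx.pot_measurable[OF \<rho>] cl.pot_measurable[OF \<rho>]
  have "AE x in lborel. \<rho> x * cl.pot \<rho> x = \<rho> x * mx.pot \<rho> x"
    using AE_lborel_singleton[of "0::real^3"] by eventually_elim (simp add: newton_pot[OF \<rho> rad])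
  hence "cl.Q \<rho> \<rho> = mx.Q \<rho> \<rho>"
    unfolding cl.Q_def mx.Q_def by (intro integral_cong_AE) auto
  thus ?thesis by (simp add: cl.En_def mx.En_def)
qed

text \<open>The Euler-Lagrange equation at every point rather than almost everywhere: this singles
  out a representative to which pointwise monotonicity arguments apply.\<close>

definition tf_solution :: "real \<Rightarrow> (real^3 \<Rightarrow> real) \<Rightarrow> bool" where
  "tf_solution \<mu> \<rho> \<longleftrightarrow> \<rho> \<in> densities \<and> 0 \<le> \<mu> \<and>
     (\<forall>x. \<rho> x = (max 0 (Z / norm x - mx.pot \<rho> x - \<mu>) / \<gamma>) powr (3/2))"

lemma tf_solution_pos:
  assumes "tf_solution \<mu> \<rho>" "0 < \<rho> x"
  shows "mx.pot \<rho> x + \<mu> < Z / norm x" "x \<noteq> 0"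
proof -
  have r: "\<rho> x = (max 0 (Z / norm x - mx.pot \<rho> x - \<mu>) / \<gamma>) powr (3/2)"
    using assms(1) unfolding tf_solution_def by blast
  show *: "mx.pot \<rho> x + \<mu> < Z / norm x"
  proof (rule ccontr)
    assume "\<not> mx.pot \<rho> x + \<mu> < Z / norm x"
    hence "max 0 (Z / norm x - mx.pot \<rho> x - \<mu>) = 0" by (simp add: max_def)
    thus False using r assms(2) by simp
  qed
  show "x \<noteq> 0"
  proof
    assume "x = 0"
    thus False using * mx.pot_nonneg[of \<rho> x] assms(1) by (simp add: tf_solution_def)
  qed
qed

lemma tf_solution_euler:
  assumes sol: "tf_solution \<mu> \<rho>"
  shows "- \<mu> \<le> mx.phi \<rho> x" "0 < \<rho> x \<Longrightarrow> mx.phi \<rho> x = - \<mu>"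
proof -
  let ?w = "Z / norm x - mx.pot \<rho> x - \<mu>"
  have r: "\<rho> x = (max 0 ?w / \<gamma>) powr (3/2)"
    using sol unfolding tf_solution_def by blast
  have "((max 0 ?w / \<gamma>) powr (3/2)) powr (2/3) = max 0 ?w / \<gamma>"
    using gamma_pos by (simp add: powr_powr)
  hence g: "\<gamma> * \<rho> x powr (2/3) = max 0 ?w" using gamma_pos unfolding r by simp
  show "- \<mu> \<le> mx.phi \<rho> x" unfolding mx.phi_def g by linarith
  assume "0 < \<rho> x"
  from tf_solution_pos(1)[OF sol this] have "max 0 ?w = ?w" by simp
  thus "mx.phi \<rho> x = - \<mu>" unfolding mx.phi_def g by linarith
qed

text \<open>Where the density is positive the equation is solved for it; where it vanishes the
  inequality makes the positive part 0. Replacing the density by the right-hand side changes only a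
  null set and leaves the potential untouched, so the new function solves its own equation.\<close>

lemma minimizer_to_solution:
  assumes \<rho>0: "\<rho>0 \<in> densities" and eu: "mx.euler N \<rho>0 \<mu>"
  obtains \<rho> where "tf_solution \<mu> \<rho>" "AE x in lborel. \<rho>0 x = \<rho> x"
proof -
  define \<rho> where "\<rho> = (\<lambda>x. (max 0 (Z / norm x - mx.pot \<rho>0 x - \<mu>) / \<gamma>) powr (3/2))"
  note [measurable] = densitiesD(1)[OF \<rho>0] mx.pot_measurable[OF \<rho>0]
  have [measurable]: "\<rho> \<in> borel_measurable borel" unfolding \<rho>_def by measurable
  have AEs: "AE x in lborel. - \<mu> \<le> mx.phi \<rho>0 x" "AE x in lborel. 0 < \<rho>0 x \<longrightarrow> mx.phi \<rho>0 x = - \<mu>"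
    using eu by (auto simp: mx.euler_def)
  have eq: "AE x in lborel. \<rho>0 x = \<rho> x"
    using AEs
  proof eventually_elim
    fix x assume *: "- \<mu> \<le> mx.phi \<rho>0 x" "0 < \<rho>0 x \<longrightarrow> mx.phi \<rho>0 x = - \<mu>"
    show "\<rho>0 x = \<rho> x"
    proof (cases "0 < \<rho>0 x")
      case True
      hence e: "Z / norm x - mx.pot \<rho>0 x - \<mu> = \<gamma> * \<rho>0 x powr (2/3)"
        using * unfolding mx.phi_def by linarith
      have "max 0 (Z / norm x - mx.pot \<rho>0 x - \<mu>) / \<gamma> = \<rho>0 x powr (2/3)"
        unfolding e using gamma_pos by simp
      thus ?thesis using True by (simp add: \<rho>_def powr_powr)
    next
      case False
      hence z: "\<rho>0 x = 0" using densitiesD(2)[OF \<rho>0, of x] by linarith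
      hence "Z / norm x - mx.pot \<rho>0 x - \<mu> \<le> 0" using *(1) unfolding mx.phi_def by simp
      thus ?thesis using z by (simp add: \<rho>_def max_def)
    qed
  qed
  have "integrable lborel \<rho>"
    using densitiesD(3)[OF \<rho>0] eq by (subst integrable_cong_AE[where g = \<rho>0]) (auto elim: eventually_mono)
  moreover have "integrable lborel (\<lambda>x. \<rho> x powr (5/3))"
    using densitiesD(4)[OF \<rho>0] eq
    by (subst integrable_cong_AE[where g = "\<lambda>x. \<rho>0 x powr (5/3)"]) (auto elim: eventually_mono)
  moreover have "0 \<le> \<rho> x" for x by (simp add: \<rho>_def)
  ultimately have \<rho>d: "\<rho> \<in> densities" by (simp add: densities_def)
  have "mx.pot \<rho> = mx.pot \<rho>0"
    by (rule mx.pot_cong_AE[symmetric]) (use eq in auto)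
  hence "tf_solution \<mu> \<rho>" using \<rho>d eu by (simp add: tf_solution_def \<rho>_def mx.euler_def)
  thus ?thesis using that eq by blast
qed

text \<open>The kernel gains most between radius |y| and |x| for charge inside |x|, namely 1/|x| -
  1/|y|. So the repulsion falls off no faster than that of the whole mass placed at the origin; with
  mass at most Z the attraction falls off at least as fast.\<close>

lemma pot_diff_le:
  assumes \<rho>: "\<rho> \<in> densities" and x: "x \<noteq> 0" "norm x \<le> norm y"
  shows "mx.pot \<rho> x - mx.pot \<rho> y \<le> (1 / norm x - 1 / norm y) * integral\<^sup>L lborel \<rho>"
proof -
  have a: "0 < norm x" "0 < norm y" using x by auto
  have "mx.pot \<rho> x - mx.pot \<rho> y = (\<integral>z. kmax x z * \<rho> z - kmax y z * \<rho> z \<partial>lborel)"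
    unfolding mx.pot_def using mx.pot_integrable[OF \<rho>] by simp
  also have "\<dots> \<le> (\<integral>z. (1 / norm x - 1 / norm y) * \<rho> z \<partial>lborel)"
  proof (rule integral_mono)
    fix z
    have "kmax x z - kmax y z \<le> 1 / norm x - 1 / norm y"
    proof -
      consider "norm z \<le> norm x" | "norm x < norm z" "norm z \<le> norm y" | "norm y < norm z" by linarith
      thus ?thesis
      proof cases
        case 1
        hence "max (norm x) (norm z) = norm x" "max (norm y) (norm z) = norm y" using x by linarith+
        thus ?thesis by (simp add: kmax_def)
      next
        case 2
        have "1 / norm z \<le> 1 / norm x" using 2 a by (intro frac_le) auto
        thus ?thesis using 2 by (simp add: kmax_def max_def)
      next
        case 3
        have "1 / norm y \<le> 1 / norm x" using x a by (intro frac_le) auto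
        thus ?thesis using 3 x by (simp add: kmax_def max_def)
      qed
    qed
    hence "(kmax x z - kmax y z) * \<rho> z \<le> (1 / norm x - 1 / norm y) * \<rho> z"
      using densitiesD(2)[OF \<rho>] by (intro mult_right_mono)
    thus "kmax x z * \<rho> z - kmax y z * \<rho> z \<le> (1 / norm x - 1 / norm y) * \<rho> z"
      by (simp only: left_diff_distrib)
  qed (use mx.pot_integrable[OF \<rho>] densitiesD(3)[OF \<rho>] in auto)
  finally show ?thesis by simp
qed

lemma tf_solution_radially_decreasing:
  assumes sol: "tf_solution \<mu> \<rho>" and mass: "integral\<^sup>L lborel \<rho> \<le> Z"
  shows "radially_decreasing \<rho>"
  unfolding radially_decreasing_def
proof (intro allI impI)
  fix x y :: "real^3" assume x: "x \<noteq> 0" "norm x \<le> norm y"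
  have \<rho>: "\<rho> \<in> densities" using sol by (simp add: tf_solution_def)
  have f: "\<rho> x = (max 0 (Z / norm x - mx.pot \<rho> x - \<mu>) / \<gamma>) powr (3/2)" for x
    using sol unfolding tf_solution_def by blast
  have "0 \<le> 1 / norm x - 1 / norm y" using x by (simp add: frac_le)
  hence "(1 / norm x - 1 / norm y) * integral\<^sup>L lborel \<rho> \<le> (1 / norm x - 1 / norm y) * Z"
    using mass by (intro mult_left_mono)
  hence "Z / norm y - mx.pot \<rho> y - \<mu> \<le> Z / norm x - mx.pot \<rho> x - \<mu>"
    using pot_diff_le[OF \<rho> x] by (simp add: left_diff_distrib)
  thus "\<rho> y \<le> \<rho> x"
    unfolding f[of x] f[of y] using gamma_pos by (intro powr_mono2 divide_right_mono max.mono) auto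
qed

text \<open>If \<rho> x > 0, the charge inside |x| alone contributes M(|x|) / |x| to a potential
  that is below Z / |x|, so M(|x|) < Z. Hence \<rho> vanishes beyond the radius at which the
  enclosed charge M reaches Z. M counts open balls and is left-continuous, so no more than Z is
  enclosed there.\<close>

lemma tf_solution_mass_le:
  assumes sol: "tf_solution \<mu> \<rho>"
  shows "integral\<^sup>L lborel \<rho> \<le> Z"
proof (rule ccontr)
  assume "\<not> integral\<^sup>L lborel \<rho> \<le> Z"
  hence big: "Z < integral\<^sup>L lborel \<rho>" by simp
  have \<rho>: "\<rho> \<in> densities" using sol by (simp add: tf_solution_def)
  note [measurable] = densitiesD(1)[OF \<rho>]
  define M where "M = (\<lambda>r::real. \<integral>y. \<rho> y * indicator {y. norm y < r} y \<partial>lborel)"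
  have int: "integrable lborel (\<lambda>y. \<rho> y * indicator {y. norm y < r} y)" for r
    by (rule Bochner_Integration.integrable_bound[OF densitiesD(3)[OF \<rho>]])
       (auto simp: indicator_def densitiesD(2)[OF \<rho>])
  have mono: "M r \<le> M r'" if "r \<le> r'" for r r'
    unfolding M_def using that densitiesD(2)[OF \<rho>]
    by (intro integral_mono int) (auto simp: indicator_def)
  have Mlt: "M (norm x) < Z" if "0 < \<rho> x" for x
  proof -
    note p = tf_solution_pos[OF sol that]
    have "M (norm x) / norm x = (\<integral>y. (\<rho> y * indicator {y. norm y < norm x} y) / norm x \<partial>lborel)"
      by (simp add: M_def)
    also have "\<dots> \<le> mx.pot \<rho> x"
      unfolding mx.pot_def using p(2) int densitiesD(2)[OF \<rho>] mx.k_nonneg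
      by (intro integral_mono mx.pot_integrable[OF \<rho>])
         (auto simp: indicator_def kmax_def max_def)
    also have "\<dots> < Z / norm x"
    proof -
      have "0 \<le> \<mu>" using sol by (simp add: tf_solution_def)
      thus ?thesis using p(1) by linarith
    qed
    finally show ?thesis using p(2) by (simp add: divide_less_cancel)
  qed
  have DCT: "(\<lambda>n. M (r n)) \<longlonglongrightarrow> (\<integral>y. \<rho> y * g y \<partial>lborel)"
    if "\<And>y. (\<lambda>n. indicator {y. norm y < r n} y) \<longlonglongrightarrow> g y" and [measurable]: "g \<in> borel_measurable borel" for r :: "nat \<Rightarrow> real" and g
    unfolding M_def
    by (rule integral_dominated_convergence[where w = \<rho>])
       (use that densitiesD(2,3)[OF \<rho>] in \<open>auto intro!: tendsto_mult simp: indicator_def\<close>)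
  have "(\<lambda>n. M (real n)) \<longlonglongrightarrow> (\<integral>y. \<rho> y * 1 \<partial>lborel)"
  proof (rule DCT)
    fix y :: "real^3"
    have "eventually (\<lambda>n. norm y < real n) sequentially"
      using filterlim_real_sequentially by (rule filterlim_at_top_dense[THEN iffD1, rule_format])
    hence "eventually (\<lambda>n. indicator {y. norm y < real n} y = (1::real)) sequentially"
      by eventually_elim simp
    thus "(\<lambda>n. indicator {y. norm y < real n} y) \<longlonglongrightarrow> (1::real)" by (rule tendsto_eventually)
  qed simp
  hence "eventually (\<lambda>n. Z < M (real n)) sequentially" using big by (intro order_tendstoD) auto
  then obtain n :: nat where n: "Z < M (real n)" using eventually_happens[of _ sequentially] by auto
  define A where "A = {r. 0 \<le> r \<and> Z \<le> M r}"
  have nA: "real n \<in> A" using n by (simp add: A_def)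
  define r where "r = Inf A"
  have bdd: "bdd_below A" by (rule bdd_belowI[of _ 0]) (simp add: A_def)
  have out: "\<rho> x = 0" if "r < norm x" for x
  proof -
    have "A \<noteq> {}" using nA by blast
    from cInf_lessD[OF this that[unfolded r_def]] obtain r' where "r' \<in> A" "r' < norm x" by blast
    hence "Z \<le> M (norm x)" using mono[of r' "norm x"] by (simp add: A_def)
    hence "\<not> 0 < \<rho> x" using Mlt[of x] by auto
    thus ?thesis using densitiesD(2)[OF \<rho>, of x] by linarith
  qed
  have "integral\<^sup>L lborel \<rho> = M r"
    unfolding M_def
  proof (rule integral_cong_AE)
    show "AE x in lborel. \<rho> x = \<rho> x * indicator {y. norm y < r} x"
      using AE_norm_neq[of r] by eventually_elim (use out in \<open>auto simp: indicator_def\<close>)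
  qed measurable
  moreover have "M r \<le> Z"
  proof -
    have "(\<lambda>n. M (r - 1 / real (Suc n))) \<longlonglongrightarrow> (\<integral>y. \<rho> y * indicator {y. norm y < r} y \<partial>lborel)"
    proof (rule DCT)
      fix y :: "real^3"
      have l: "(\<lambda>n. r - 1 / real (Suc n)) \<longlonglongrightarrow> r - 0"
        by (intro tendsto_diff tendsto_const LIMSEQ_Suc[OF lim_1_over_n])
      have "eventually (\<lambda>n. indicator {y. norm y < r - 1 / real (Suc n)} y = (indicator {y. norm y < r} y :: real)) sequentially"
      proof (cases "norm y < r")
        case True
        have "eventually (\<lambda>n. norm y < r - 1 / real (Suc n)) sequentially"
          using l True by (intro order_tendstoD(1)[OF l]) simp
        thus ?thesis by eventually_elim (simp add: True)
      next
        case False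
        have "\<not> norm y < r - 1 / real (Suc n)" for n
        proof -
          have "0 < 1 / real (Suc n)" by simp
          thus ?thesis using False by linarith
        qed
        thus ?thesis using False by (intro always_eventually allI) simp
      qed
      thus "(\<lambda>n. indicator {y. norm y < r - 1 / real (Suc n)} y) \<longlonglongrightarrow> (indicator {y. norm y < r} y :: real)"
        by (rule tendsto_eventually)
    qed measurable
    hence "(\<lambda>n. M (r - 1 / real (Suc n))) \<longlonglongrightarrow> M r" by (simp only: M_def)
    moreover have "M (r - 1 / real (Suc n)) \<le> Z" for n
    proof (cases "0 \<le> r - 1 / real (Suc n)")
      case True
      have "0 < 1 / real (Suc n)" by simp
      hence "r - 1 / real (Suc n) < Inf A" unfolding r_def by linarith
      hence "r - 1 / real (Suc n) \<notin> A" using cInf_lower[OF _ bdd] by (meson not_less)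
      thus ?thesis using True by (simp add: A_def)
    next
      case False
      have "{y::real^3. norm y < r - 1 / real (Suc n)} = {}"
      proof -
        have "\<not> norm y < r - 1 / real (Suc n)" for y :: "real^3"
          using False norm_ge_zero[of y] by linarith
        thus ?thesis by blast
      qed
      thus ?thesis using Z_pos by (simp add: M_def)
    qed
    ultimately show ?thesis by (intro LIMSEQ_le_const2) auto
  qed
  ultimately show False using big by simp
qed

text \<open>With \<mu> = 0 and mass m < Z the nucleus is not fully screened: the effective potential
  is at least (Z - m) / |x|, so \<rho> \<ge> c |x|^(-3/2), which is not integrable at
  infinity.\<close>

lemma tf_solution_mass_ge:
  assumes sol: "tf_solution 0 \<rho>"
  shows "Z \<le> integral\<^sup>L lborel \<rho>"
proof (rule ccontr)
  define m where "m = integral\<^sup>L lborel \<rho>"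
  assume "\<not> Z \<le> integral\<^sup>L lborel \<rho>"
  hence mZ: "m < Z" by (simp add: m_def)
  have \<rho>: "\<rho> \<in> densities" using sol by (simp add: tf_solution_def)
  note [measurable] = densitiesD(1)[OF \<rho>]
  have m0: "0 \<le> m" using densitiesD(5)[OF \<rho>] by (simp add: m_def)
  define c where "c = ((Z - m) / \<gamma>) powr (3/2)"
  have c: "0 < c" using mZ gamma_pos by (simp add: c_def)
  have ge: "c * norm x powr (-3/2) \<le> \<rho> x" if "x \<noteq> 0" for x
  proof -
    have "mx.pot \<rho> x \<le> (\<integral>y. 1 / norm x * \<rho> y \<partial>lborel)"
      unfolding mx.pot_def using that densitiesD(2,3)[OF \<rho>]
      by (intro integral_mono mx.pot_integrable[OF \<rho>] mult_right_mono)
         (auto simp: kmax_def intro!: divide_left_mono mult_pos_pos simp: less_max_iff_disj)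
    also have "\<dots> = m / norm x" by (simp add: m_def)
    finally have le: "(Z - m) / norm x \<le> Z / norm x - mx.pot \<rho> x - 0" by (simp add: diff_divide_distrib)
    have f: "\<rho> x = (max 0 (Z / norm x - mx.pot \<rho> x - 0) / \<gamma>) powr (3/2)"
      using sol unfolding tf_solution_def by blast
    have "c * norm x powr (-3/2) = ((Z - m) / \<gamma> / norm x) powr (3/2)"
    proof -
      have "((Z - m) / \<gamma> / norm x) powr (3/2) = c / norm x powr (3/2)" unfolding c_def by (rule powr_divide)
      also have "\<dots> = c * norm x powr (-3/2)"
        using powr_minus[of "norm x" "3/2"] by (simp add: field_simps)
      finally show ?thesis by simp
    qed
    also have "\<dots> \<le> (max 0 (Z / norm x - mx.pot \<rho> x - 0) / \<gamma>) powr (3/2)"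
    proof (rule powr_mono2)
      have "(Z - m) / \<gamma> / norm x = (Z - m) / norm x / \<gamma>" by simp
      also have "\<dots> \<le> max 0 (Z / norm x - mx.pot \<rho> x - 0) / \<gamma>"
        using gamma_pos le by (intro divide_right_mono order_trans[OF le]) auto
      finally show "(Z - m) / \<gamma> / norm x \<le> max 0 (Z / norm x - mx.pot \<rho> x - 0) / \<gamma>" .
    qed (use mZ gamma_pos in auto)
    finally show ?thesis using f by simp
  qed
  \<comment> \<open>Chosen so that the lower bound c R^(-3/2) on the ball of radius R alone accounts
    for mass m + 1.\<close>
  define R where "R = ((m + 1) / (c * (4/3 * pi))) powr (2/3)"
  have R: "0 < R" using m0 c by (simp add: R_def)
  have Bi: "integrable lborel (indicator {x::real^3. norm x < R} :: _ \<Rightarrow> real)"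
    and Bm: "measure lborel {x::real^3. norm x < R} = 4/3 * pi * R ^ 3"
    using emeasure_norm_less[of R] R by (simp_all add: measure_def)
  have "(\<integral>x. c * R powr (-3/2) * indicator {x::real^3. norm x < R} x \<partial>lborel) \<le> m"
    unfolding m_def
  proof (rule integral_mono_AE)
    show "integrable lborel (\<lambda>x. c * R powr (-3/2) * indicator {x::real^3. norm x < R} x)" using Bi by simp
    show "AE x in lborel. c * R powr (-3/2) * indicator {x::real^3. norm x < R} x \<le> \<rho> x"
      using AE_lborel_singleton[of "0::real^3"]
    proof eventually_elim
      fix x :: "real^3" assume x: "x \<noteq> 0"
      show "c * R powr (-3/2) * indicator {x::real^3. norm x < R} x \<le> \<rho> x"
      proof (cases "norm x < R")
        case True
        have "R powr (-3/2) \<le> norm x powr (-3/2)" using True x by (intro powr_mono2') auto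
        hence "c * R powr (-3/2) \<le> c * norm x powr (-3/2)" using c by (intro mult_left_mono) auto
        thus ?thesis using ge[OF x] True by simp
      qed (use densitiesD(2)[OF \<rho>] in simp)
    qed
  qed (rule densitiesD(3)[OF \<rho>])
  hence le: "c * R powr (-3/2) * (4/3 * pi * R ^ 3) \<le> m" using Bm by simp
  have eq: "c * R powr (-3/2) * (4/3 * pi * R ^ 3) = c * (4/3 * pi) * R powr (3/2)"
  proof -
    have "R ^ 3 = R powr 3" using R by simp
    hence "R powr (-3/2) * R ^ 3 = R powr (-3/2 + 3)" by (simp only: powr_add)
    hence "R powr (-3/2) * R ^ 3 = R powr (3/2)" by simp
    moreover have "c * R powr (-3/2) * (4/3 * pi * R ^ 3) = c * (4/3 * pi) * (R powr (-3/2) * R ^ 3)"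
      by (simp only: ac_simps)
    ultimately show ?thesis by (simp only:)
  qed
  have "R powr (3/2) = (m + 1) / (c * (4/3 * pi))"
    using m0 c by (simp add: R_def powr_powr)
  hence "c * (4/3 * pi) * R powr (3/2) = m + 1" using c by simp
  thus False using le unfolding eq by simp
qed

text \<open>For the max kernel every Euler-Lagrange solution is radial, so Newton's theorem turns it into a
  Coulomb solution.\<close>

theorem atom_minimizer:
  assumes N: "0 \<le> N"
  obtains \<rho> where "\<rho> \<in> densities_le N" "radially_decreasing \<rho>" "integral\<^sup>L lborel \<rho> = min N Z"
    "\<And>\<sigma>. \<sigma> \<in> densities_le N \<Longrightarrow> mx.En \<rho> \<le> mx.En \<sigma>"
    "\<And>\<sigma>. \<sigma> \<in> densities_le N \<Longrightarrow> cl.En \<rho> \<le> cl.En \<sigma>"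
proof (cases "N = 0")
  case True
  \<comment> \<open>The multiplier in \<open>euler_necessary\<close> is a quotient by N, so N = 0 is
    treated separately; then every admissible density is null.\<close>
  have z: "AE x in lborel. 0 = \<sigma> x" if "\<sigma> \<in> densities_le N" for \<sigma>
  proof -
    have \<sigma>: "\<sigma> \<in> densities" "integral\<^sup>L lborel \<sigma> \<le> 0" using that True by (auto simp: densities_le_def)
    hence "integral\<^sup>L lborel \<sigma> = 0" using densitiesD(5)[OF \<sigma>(1)] by simp
    hence "AE x in lborel. \<sigma> x = 0"
      using integral_nonneg_eq_0_iff_AE[OF densitiesD(3)[OF \<sigma>(1)]] densitiesD(2)[OF \<sigma>(1)] by auto
    thus ?thesis by (auto elim: eventually_mono)
  qed
  have d: "\<sigma> \<in> densities" if "\<sigma> \<in> densities_le N" for \<sigma> using that by (simp add: densities_le_def)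
  show ?thesis
  proof (rule that[of "\<lambda>x. 0"])
    show "mx.En (\<lambda>x. 0) \<le> mx.En \<sigma>" if "\<sigma> \<in> densities_le N" for \<sigma>
      using mx.En_cong_AE[OF z[OF that] densities_zero d[OF that]] by simp
    show "cl.En (\<lambda>x. 0) \<le> cl.En \<sigma>" if "\<sigma> \<in> densities_le N" for \<sigma>
      using cl.En_cong_AE[OF z[OF that] densities_zero d[OF that]] by simp
  qed (use True densities_zero Z_pos in \<open>auto simp: densities_le_def radially_decreasing_def\<close>)
next
  case False
  hence N: "0 < N" using N by simp
  obtain \<rho>0 where \<rho>0: "\<rho>0 \<in> densities_le N" and min0: "\<And>\<sigma>. \<sigma> \<in> densities_le N \<Longrightarrow> mx.En \<rho>0 \<le> mx.En \<sigma>"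
    by (rule mx.minimizer_exists[of N]) (use N in auto)
  obtain \<mu> where eu: "mx.euler N \<rho>0 \<mu>"
    by (rule mx.euler_necessary[OF N \<rho>0]) (use min0 in auto)
  have \<rho>0d: "\<rho>0 \<in> densities" and mass0: "integral\<^sup>L lborel \<rho>0 \<le> N" using \<rho>0 by (auto simp: densities_le_def)
  obtain \<rho> where sol: "tf_solution \<mu> \<rho>" and eq: "AE x in lborel. \<rho>0 x = \<rho> x"
    by (rule minimizer_to_solution[OF \<rho>0d eu])
  have \<rho>: "\<rho> \<in> densities" using sol by (simp add: tf_solution_def)
  note [measurable] = densitiesD(1)[OF \<rho>] densitiesD(1)[OF \<rho>0d]
  have meq: "integral\<^sup>L lborel \<rho>0 = integral\<^sup>L lborel \<rho>"
    using eq by (intro integral_cong_AE) auto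
  have \<rho>N: "\<rho> \<in> densities_le N" using \<rho> mass0 meq by (simp add: densities_le_def)
  have leZ: "integral\<^sup>L lborel \<rho> \<le> Z" by (rule tf_solution_mass_le[OF sol])
  have rad: "radially_decreasing \<rho>" by (rule tf_solution_radially_decreasing[OF sol leZ])
  have cs: "\<mu> * (N - integral\<^sup>L lborel \<rho>) = 0" "0 \<le> \<mu>" using eu meq by (auto simp: mx.euler_def)
  \<comment> \<open>By slackness either the mass constraint is active or \<mu> = 0, and in the
    latter case the two mass bounds force neutrality.\<close>
  have mass: "integral\<^sup>L lborel \<rho> = min N Z"
  proof (cases "integral\<^sup>L lborel \<rho> = N")
    case False
    hence "\<mu> = 0" using cs by simp
    hence "Z \<le> integral\<^sup>L lborel \<rho>" using tf_solution_mass_ge sol by simp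
    thus ?thesis using leZ mass0 meq by (simp add: min_def)
  qed (use leZ in simp)
  have phi: "cl.phi \<rho> x = mx.phi \<rho> x" if "x \<noteq> 0" for x
    using newton_pot[OF \<rho> rad that] by (simp add: cl.phi_def mx.phi_def)
  have "cl.euler N \<rho> \<mu>"
    unfolding cl.euler_def
  proof (intro conjI cs)
    show "AE x in lborel. - \<mu> \<le> cl.phi \<rho> x"
      using AE_lborel_singleton[of "0::real^3"]
      by eventually_elim (simp add: phi tf_solution_euler(1)[OF sol])
    show "AE x in lborel. 0 < \<rho> x \<longrightarrow> cl.phi \<rho> x = - \<mu>"
      using AE_lborel_singleton[of "0::real^3"]
      by eventually_elim (simp add: phi tf_solution_euler(2)[OF sol])
  qed
  hence cmin: "cl.En \<rho> \<le> cl.En \<sigma>" if "\<sigma> \<in> densities_le N" for \<sigma>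
    using cl.euler_sufficient[OF \<rho>N _ that] by blast
  have mmin: "mx.En \<rho> \<le> mx.En \<sigma>" if "\<sigma> \<in> densities_le N" for \<sigma>
    using min0[OF that] mx.En_cong_AE[OF eq \<rho>0d \<rho>] by simp
  show ?thesis by (rule that[OF \<rho>N rad mass mmin cmin])
qed

end

section \<open>Phase-space volumes\<close>

lemma nn_integral_inverse_norm_ball:
  assumes "0 \<le> R"
  shows "(\<integral>\<^sup>+x. ennreal (1 / norm x) * indicator {x. norm x < R} x \<partial>(lborel :: (real^3) measure)) = ennreal (2 * pi * R\<^sup>2)"
proof -
  have "(\<integral>\<^sup>+x. ennreal (1 / norm x) * indicator {x. norm x < R} x \<partial>(lborel :: (real^3) measure))
      = (\<integral>\<^sup>+x. ennreal (norm x powr (-1)) * indicator {x. norm x < R} x \<partial>(lborel :: (real^3) measure))"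
    by (intro nn_integral_cong) (simp add: powr_minus_divide)
  also have "\<dots> = ennreal (4 * pi / (-1 + 3) * R powr (-1 + 3))"
    using assms by (intro nn_integral_norm_powr_ball) auto
  finally show ?thesis using assms by simp
qed

lemma nn_integral_norm_square_ball:
  assumes "0 \<le> R"
  shows "(\<integral>\<^sup>+x. ennreal ((norm x)\<^sup>2) * indicator {x. norm x < R} x \<partial>(lborel :: (real^3) measure)) = ennreal (4 * pi / 5 * R ^ 5)"
proof -
  have "(\<integral>\<^sup>+x. ennreal ((norm x)\<^sup>2) * indicator {x. norm x < R} x \<partial>(lborel :: (real^3) measure))
      = (\<integral>\<^sup>+x. ennreal (norm x powr 2) * indicator {x. norm x < R} x \<partial>(lborel :: (real^3) measure))"
    by (intro nn_integral_cong) simp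
  also have "\<dots> = ennreal (4 * pi / (2 + 3) * R powr (2 + 3))"
    using assms by (intro nn_integral_norm_powr_ball) auto
  finally show ?thesis using assms by simp
qed

lemma ennreal_add_ennreal_cancel:
  assumes "a + ennreal c = b + ennreal c"
  shows "a = b"
  using assms ennreal_add_left_cancel[of "ennreal c" a b] by (simp add: add.commute)

lemma cube_less_iff:
  fixes a b :: real
  assumes "0 \<le> a" "0 \<le> b"
  shows "a ^ 3 < b ^ 3 \<longleftrightarrow> a < b"
  using assms by (metis power_mono_iff not_le zero_less_numeral)

lemma two_pi_diff_nonneg:
  fixes u v :: real
  assumes "u \<le> v" "0 \<le> v"
  shows "0 \<le> 2 * pi * v - 2 * pi / 3 * u"
proof -
  have "0 \<le> 2 * pi / 3 * (3 * v - u)" using assms by (intro mult_nonneg_nonneg) auto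
  thus ?thesis by (simp add: right_diff_distrib)
qed

text \<open>The integral of 1/|y| over the ball of radius |x| is added to both sides: it completes
  the outer shell to a full ball, and no difference of extended integrals has to be formed.\<close>

lemma nn_integral_kmax_ball:
  assumes "norm x < R" "x \<noteq> 0"
  shows "(\<integral>\<^sup>+y. ennreal (kmax x y) * indicator {y. norm y < R} y \<partial>lborel)
     = ennreal (2 * pi * R\<^sup>2 - 2 * pi / 3 * (norm x)\<^sup>2)"
proof -
  have a: "0 < norm x" and R: "0 \<le> R" using assms by (simp, meson norm_ge_zero order_trans less_imp_le)
  let ?I = "\<integral>\<^sup>+y. ennreal (kmax x y) * indicator {y. norm y < R} y \<partial>lborel"
  have "?I + (\<integral>\<^sup>+y. ennreal (1 / norm y) * indicator {y. norm y < norm x} y \<partial>(lborel :: (real^3) measure))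
     = (\<integral>\<^sup>+y. ennreal (kmax x y) * indicator {y. norm y < R} y
         + ennreal (1 / norm y) * indicator {y. norm y < norm x} y \<partial>lborel)"
    unfolding kmax_def by (rule nn_integral_add[symmetric]) measurable
  also have "\<dots> = (\<integral>\<^sup>+y. ennreal (1 / norm y) * indicator {y. norm y < R} y
         + ennreal (1 / norm x) * indicator {y. norm y < norm x} y \<partial>(lborel :: (real^3) measure))"
    using assms by (intro nn_integral_cong) (auto simp: indicator_def kmax_def max_def add.commute)
  also have "\<dots> = ennreal (2 * pi * R\<^sup>2) + (\<integral>\<^sup>+y. ennreal (1 / norm x) * indicator {y::real^3. norm y < norm x} y \<partial>lborel)"
    using R by (subst nn_integral_add) (simp_all add: nn_integral_inverse_norm_ball)
  also have "(\<integral>\<^sup>+y. ennreal (1 / norm x) * indicator {y::real^3. norm y < norm x} y \<partial>lborel) = ennreal (4 / 3 * pi * (norm x)\<^sup>2)"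
    using a by (subst nn_integral_cmult) (simp_all add: emeasure_norm_less ennreal_mult'[symmetric] power2_eq_square power3_eq_cube)
  also have "(\<integral>\<^sup>+y. ennreal (1 / norm y) * indicator {y. norm y < norm x} y \<partial>(lborel :: (real^3) measure)) = ennreal (2 * pi * (norm x)\<^sup>2)"
    by (simp add: nn_integral_inverse_norm_ball)
  finally have eq: "?I + ennreal (2 * pi * (norm x)\<^sup>2) = ennreal (2 * pi * R\<^sup>2 + 4 / 3 * pi * (norm x)\<^sup>2)"
    by simp
  have "(norm x)\<^sup>2 \<le> R\<^sup>2" using assms by (intro power_mono) auto
  hence nn: "0 \<le> 2 * pi * R\<^sup>2 - 2 * pi / 3 * (norm x)\<^sup>2"
    by (rule two_pi_diff_nonneg) simp
  have "ennreal (2 * pi * R\<^sup>2 + 4 / 3 * pi * (norm x)\<^sup>2)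
     = ennreal (2 * pi * R\<^sup>2 - 2 * pi / 3 * (norm x)\<^sup>2) + ennreal (2 * pi * (norm x)\<^sup>2)"
    using nn by (subst ennreal_plus[symmetric]) simp_all
  from trans[OF eq this] show ?thesis by (rule ennreal_add_ennreal_cancel)
qed

text \<open>The integrand of the momentum interaction; up to a constant it is the max-kernel energy
  of two centred balls with volumes proportional to a and b.\<close>

definition overlap :: "real \<Rightarrow> real \<Rightarrow> real" where
  "overlap a b = min a b * (max a b) powr (2/3) - 1/5 * (min a b) powr (5/3)"

lemma overlap_commute: "overlap a b = overlap b a"
  by (simp add: overlap_def min.commute max.commute)

lemma overlap_nonneg:
  assumes "0 \<le> a" "0 \<le> b"
  shows "0 \<le> overlap a b"
proof -
  have "(min a b) powr (5/3) = min a b * (min a b) powr (2/3)"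
    using assms powr_mult_base[of "min a b" "2/3"] by simp
  also have "\<dots> \<le> min a b * (max a b) powr (2/3)"
    using assms by (intro mult_left_mono powr_mono2) auto
  finally show ?thesis using powr_ge_zero[of "min a b" "5/3"] unfolding overlap_def by linarith
qed

definition momenta :: "(real^3 \<Rightarrow> real) set" where
  "momenta = {\<tau>. \<tau> \<in> borel_measurable borel \<and> (\<forall>\<xi>. 0 \<le> \<tau> \<xi>) \<and> integrable lborel \<tau>
     \<and> integrable lborel (\<lambda>\<xi>. (norm \<xi>)\<^sup>2 * \<tau> \<xi>)}"

context tf_atom
begin

definition w :: real where "w = sqrt \<gamma>"

text \<open>The reciprocal volume of the ball where \<open>lev\<close> is below 1. Then the ball
  where \<open>lev\<close> is below a has volume a / kap, so the transform exchanges centred balls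
  with no further constant.\<close>

definition kap :: real where "kap = 3 / (4 * pi * w ^ 3)"

definition lev :: "real^3 \<Rightarrow> real" where "lev x = (norm x / w) ^ 3"

lemma w_pos: "0 < w" and w_square: "w\<^sup>2 = \<gamma>" using gamma_pos by (auto simp: w_def)

lemma kap_pos: "0 < kap" using w_pos by (simp add: kap_def)

lemma lev_measurable[measurable]: "lev \<in> borel_measurable borel" unfolding lev_def by measurable

lemma lev_pos: "x \<noteq> 0 \<Longrightarrow> 0 < lev x" using w_pos by (simp add: lev_def)

lemma lev_less_iff:
  assumes "0 \<le> a"
  shows "lev x < a \<longleftrightarrow> norm x < w * a powr (1/3)"
proof -
  have "lev x < a \<longleftrightarrow> (norm x / w) ^ 3 < (a powr (1/3)) ^ 3"
    using powr_third_powers(3)[OF assms] by (simp add: lev_def)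
  also have "\<dots> \<longleftrightarrow> norm x / w < a powr (1/3)"
    using w_pos by (intro cube_less_iff) auto
  also have "\<dots> \<longleftrightarrow> norm x < w * a powr (1/3)" using w_pos by (simp add: field_simps)
  finally show ?thesis .
qed

lemma Collect_lev: "0 \<le> a \<Longrightarrow> {x. lev x < a} = {x. norm x < w * a powr (1/3)}"
  by (simp add: lev_less_iff)

lemma radius_nonneg: "0 \<le> w * a powr (1/3)" using w_pos by simp

lemma emeasure_lev_less:
  assumes "0 \<le> a"
  shows "emeasure lborel {x. lev x < a} = ennreal (a / kap)"
proof -
  have "4 / 3 * pi * (w * a powr (1/3)) ^ 3 = a / kap"
    using powr_third_powers(3)[OF assms] by (simp add: kap_def power_mult_distrib)
  thus ?thesis using assms emeasure_norm_less[OF radius_nonneg] by (simp add: Collect_lev)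
qed

lemma nn_integral_inverse_norm_lev:
  assumes "0 \<le> a"
  shows "(\<integral>\<^sup>+x. ennreal (1 / norm x) * indicator {x. lev x < a} x \<partial>lborel) = ennreal (3 / (2 * w) * a powr (2/3) / kap)"
proof -
  have "2 * pi * (w * a powr (1/3))\<^sup>2 = 3 / (2 * w) * a powr (2/3) / kap"
    using powr_third_powers(2)[OF assms] w_pos
    by (simp add: kap_def power_mult_distrib field_simps power2_eq_square power3_eq_cube)
  thus ?thesis using assms nn_integral_inverse_norm_ball[OF radius_nonneg] by (simp add: Collect_lev)
qed

lemma nn_integral_norm_square_lev:
  assumes "0 \<le> a"
  shows "(\<integral>\<^sup>+x. ennreal ((norm x)\<^sup>2) * indicator {x. lev x < a} x \<partial>lborel) = ennreal (3/5 * \<gamma> * a powr (5/3) / kap)"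
proof -
  have "4 * pi / 5 * (w * a powr (1/3)) ^ 5 = 3/5 * \<gamma> * a powr (5/3) / kap"
  proof -
    have w5: "w ^ 5 = \<gamma> * w ^ 3" using power_add[of w 2 3] by (simp add: w_square)
    have "(w * a powr (1/3)) ^ 5 = w ^ 5 * a powr (5/3)"
      unfolding powr_third_powers(1)[OF assms] by (rule power_mult_distrib)
    thus ?thesis unfolding w5 by (simp add: kap_def)
  qed
  thus ?thesis unfolding Collect_lev[OF assms] nn_integral_norm_square_ball[OF radius_nonneg] by (simp only:)
qed

text \<open>Inside the larger ball the potential is 2 pi B^2 - (2 pi / 3) |x|^2; integrating over
  the smaller ball gives (8/3) pi^2 (A^3 B^2 - A^5 / 5). This is the origin of the coefficient 1/5
  and of the exponents in \<open>overlap\<close>.\<close>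

lemma nn_integral_kmax_lev_le:
  assumes ab: "0 \<le> a" "a \<le> b"
  shows "(\<integral>\<^sup>+x. (\<integral>\<^sup>+y. ennreal (kmax x y) * indicator {y. lev y < b} y \<partial>lborel) * indicator {x. lev x < a} x \<partial>lborel)
    = ennreal (3 / (2 * w) * overlap a b / kap\<^sup>2)"
proof -
  define A B where "A = w * a powr (1/3)" and "B = w * b powr (1/3)"
  have A0: "0 \<le> A" and AB: "A \<le> B" unfolding A_def B_def using w_pos ab by (auto intro!: mult_left_mono powr_mono2)
  have b: "0 \<le> b" using ab by simp
  have "(\<integral>\<^sup>+x. (\<integral>\<^sup>+y. ennreal (kmax x y) * indicator {y. norm y < B} y \<partial>lborel) * indicator {x. norm x < A} x \<partial>lborel)
     + (\<integral>\<^sup>+x. ennreal (2 * pi / 3) * (ennreal ((norm x)\<^sup>2) * indicator {x. norm x < A} x) \<partial>(lborel :: (real^3) measure))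
     = (\<integral>\<^sup>+x. (\<integral>\<^sup>+y. ennreal (kmax x y) * indicator {y. norm y < B} y \<partial>lborel) * indicator {x. norm x < A} x
       + ennreal (2 * pi / 3) * (ennreal ((norm x)\<^sup>2) * indicator {x. norm x < A} x) \<partial>lborel)"
    by (rule nn_integral_add[symmetric]) measurable
  also have "\<dots> = (\<integral>\<^sup>+x. ennreal (2 * pi * B\<^sup>2) * indicator {x::real^3. norm x < A} x \<partial>lborel)"
  proof (rule nn_integral_cong_AE, rule AE_mp[OF AE_lborel_singleton[of 0]], rule AE_I2, rule impI)
    fix x :: "real^3" assume x: "x \<noteq> 0"
    show "(\<integral>\<^sup>+y. ennreal (kmax x y) * indicator {y. norm y < B} y \<partial>lborel) * indicator {x. norm x < A} x
       + ennreal (2 * pi / 3) * (ennreal ((norm x)\<^sup>2) * indicator {x. norm x < A} x)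
       = ennreal (2 * pi * B\<^sup>2) * indicator {x::real^3. norm x < A} x"
    proof (cases "norm x < A")
      case True
      hence xB: "norm x < B" using AB by simp
      have "(norm x)\<^sup>2 \<le> B\<^sup>2" using xB by (intro power_mono) auto
      hence nn: "0 \<le> 2 * pi * B\<^sup>2 - 2 * pi / 3 * (norm x)\<^sup>2"
        by (rule two_pi_diff_nonneg) simp
      have "(\<integral>\<^sup>+y. ennreal (kmax x y) * indicator {y. norm y < B} y \<partial>lborel) + ennreal (2 * pi / 3 * (norm x)\<^sup>2)
          = ennreal (2 * pi * B\<^sup>2)"
        unfolding nn_integral_kmax_ball[OF xB x] using nn by (subst ennreal_plus[symmetric]) simp_all
      moreover have "ennreal (2 * pi / 3 * (norm x)\<^sup>2) = ennreal (2 * pi / 3) * ennreal ((norm x)\<^sup>2)"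
        by (rule ennreal_mult') simp
      ultimately have "(\<integral>\<^sup>+y. ennreal (kmax x y) * indicator {y. norm y < B} y \<partial>lborel)
          + ennreal (2 * pi / 3) * ennreal ((norm x)\<^sup>2) = ennreal (2 * pi * B\<^sup>2)" by (simp only:)
      thus ?thesis using True by simp
    qed simp
  qed
  also have "\<dots> = ennreal (2 * pi * B\<^sup>2) * ennreal (4 / 3 * pi * A ^ 3)"
    using A0 by (subst nn_integral_cmult) (simp_all add: emeasure_norm_less)
  also have "\<dots> = ennreal (2 * pi * B\<^sup>2 * (4 / 3 * pi * A ^ 3))"
    by (rule ennreal_mult'[symmetric]) simp
  also have "(\<integral>\<^sup>+x. ennreal (2 * pi / 3) * (ennreal ((norm x)\<^sup>2) * indicator {x. norm x < A} x) \<partial>(lborel :: (real^3) measure))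
      = ennreal (2 * pi / 3 * (4 * pi / 5 * A ^ 5))"
    using A0 by (subst nn_integral_cmult) (simp_all add: nn_integral_norm_square_ball ennreal_mult'[symmetric])
  finally have eq: "(\<integral>\<^sup>+x. (\<integral>\<^sup>+y. ennreal (kmax x y) * indicator {y. norm y < B} y \<partial>lborel) * indicator {x. norm x < A} x \<partial>lborel)
     + ennreal (2 * pi / 3 * (4 * pi / 5 * A ^ 5)) = ennreal (2 * pi * B\<^sup>2 * (4 / 3 * pi * A ^ 3))" .
  have ov: "2 * pi * B\<^sup>2 * (4 / 3 * pi * A ^ 3) - 2 * pi / 3 * (4 * pi / 5 * A ^ 5) = 3 / (2 * w) * overlap a b / kap\<^sup>2"
  proof -
    have "overlap a b = a * b powr (2/3) - 1/5 * a powr (5/3)" using ab by (simp add: overlap_def)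
    also have "\<dots> = (a powr (1/3)) ^ 3 * (b powr (1/3)) ^ 2 - 1/5 * (a powr (1/3)) ^ 5"
      using powr_third_powers(1,3)[OF ab(1)] powr_third_powers(2)[OF b] by simp
    finally have o: "overlap a b = (a powr (1/3)) ^ 3 * (b powr (1/3)) ^ 2 - 1/5 * (a powr (1/3)) ^ 5" .
    have k2: "3 / (2 * w) / kap\<^sup>2 = 8/3 * pi\<^sup>2 * w ^ 5"
      using w_pos by (simp add: kap_def field_simps eval_nat_numeral)
    have poly: "2 * p * (v * \<beta>)\<^sup>2 * (4 / 3 * p * (v * \<alpha>) ^ 3) - 2 * p / 3 * (4 * p / 5 * (v * \<alpha>) ^ 5)
       = 8/3 * p\<^sup>2 * v ^ 5 * (\<alpha> ^ 3 * \<beta>\<^sup>2 - 1/5 * \<alpha> ^ 5)" for p v \<alpha> \<beta> :: real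
      by (simp add: field_simps eval_nat_numeral)
    have "3 / (2 * w) * overlap a b / kap\<^sup>2 = 3 / (2 * w) / kap\<^sup>2 * overlap a b" by simp
    thus ?thesis unfolding A_def B_def poly k2 o by (simp only:)
  qed
  have nn: "0 \<le> 3 / (2 * w) * overlap a b / kap\<^sup>2"
    using overlap_nonneg[OF ab(1) b] w_pos by simp
  have "2 * pi * B\<^sup>2 * (4 / 3 * pi * A ^ 3) = 3 / (2 * w) * overlap a b / kap\<^sup>2 + 2 * pi / 3 * (4 * pi / 5 * A ^ 5)"
    using ov by argo
  hence "ennreal (2 * pi * B\<^sup>2 * (4 / 3 * pi * A ^ 3)) = ennreal (3 / (2 * w) * overlap a b / kap\<^sup>2) + ennreal (2 * pi / 3 * (4 * pi / 5 * A ^ 5))"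
    using nn A0 by (simp only:) (rule ennreal_plus, simp_all)
  from trans[OF eq this] have "(\<integral>\<^sup>+x. (\<integral>\<^sup>+y. ennreal (kmax x y) * indicator {y. norm y < B} y \<partial>lborel) * indicator {x. norm x < A} x \<partial>lborel)
     = ennreal (3 / (2 * w) * overlap a b / kap\<^sup>2)"
    by (rule ennreal_add_ennreal_cancel)
  thus ?thesis using ab b by (simp add: Collect_lev A_def B_def)
qed

lemma nn_integral_kmax_lev:
  assumes a: "0 \<le> a" and b: "0 \<le> b"
  shows "(\<integral>\<^sup>+x. (\<integral>\<^sup>+y. ennreal (kmax x y) * indicator {y. lev y < b} y \<partial>lborel) * indicator {x. lev x < a} x \<partial>lborel)
    = ennreal (3 / (2 * w) * overlap a b / kap\<^sup>2)"
proof (cases "a \<le> b")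
  case True
  thus ?thesis using a by (rule nn_integral_kmax_lev_le[rotated])
next
  case False
  have pull: "(\<integral>\<^sup>+x. (\<integral>\<^sup>+y. ennreal (kmax x y) * indicator {y. lev y < b} y \<partial>lborel) * indicator {x. lev x < a} x \<partial>lborel)
     = (\<integral>\<^sup>+x. (\<integral>\<^sup>+y. ennreal (kmax x y) * indicator {y. lev y < b} y * indicator {x. lev x < a} x \<partial>lborel) \<partial>lborel)" for a b
    by (intro nn_integral_cong nn_integral_multc[symmetric]) measurable
  have "(\<integral>\<^sup>+x. (\<integral>\<^sup>+y. ennreal (kmax x y) * indicator {y. lev y < b} y * indicator {x. lev x < a} x \<partial>lborel) \<partial>lborel)
     = (\<integral>\<^sup>+y. (\<integral>\<^sup>+x. ennreal (kmax x y) * indicator {y. lev y < b} y * indicator {x. lev x < a} x \<partial>lborel) \<partial>lborel)"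
    by (rule lborel_pair.Fubini'[symmetric]) measurable
  also have "\<dots> = (\<integral>\<^sup>+y. (\<integral>\<^sup>+x. ennreal (kmax y x) * indicator {x. lev x < a} x * indicator {y. lev y < b} y \<partial>lborel) \<partial>lborel)"
    by (intro nn_integral_cong) (simp add: kmax_def max.commute mult_ac)
  also have "\<dots> = ennreal (3 / (2 * w) * overlap b a / kap\<^sup>2)"
    unfolding pull[symmetric] using False b by (intro nn_integral_kmax_lev_le) auto
  finally show ?thesis unfolding pull by (simp add: overlap_commute)
qed

end

section \<open>The transform\<close>

lemma nn_integral_eq_imp_AE_eq:
  fixes f g :: "'a \<Rightarrow> ennreal"
  assumes [measurable]: "f \<in> borel_measurable M" "g \<in> borel_measurable M"
    and le: "AE x in M. f x \<le> g x" and eq: "integral\<^sup>N M g \<le> integral\<^sup>N M f" and fin: "integral\<^sup>N M f < \<infinity>"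
  shows "AE x in M. f x = g x"
proof -
  have fin': "AE x in M. f x \<noteq> \<infinity>"
    using fin by (intro nn_integral_PInf_AE) auto
  have "integral\<^sup>N M f + (\<integral>\<^sup>+x. g x - f x \<partial>M) = (\<integral>\<^sup>+x. f x + (g x - f x) \<partial>M)"
    by (rule nn_integral_add[symmetric]) measurable
  also have "\<dots> = integral\<^sup>N M g"
    using le fin' by (intro nn_integral_cong_AE, eventually_elim) (simp add: add_diff_inverse_ennreal)
  finally have "integral\<^sup>N M f + (\<integral>\<^sup>+x. g x - f x \<partial>M) \<le> integral\<^sup>N M f + 0" using eq by simp
  hence "(\<integral>\<^sup>+x. g x - f x \<partial>M) = 0"
    using fin by (subst (asm) ennreal_add_left_cancel_le) auto
  hence "AE x in M. g x - f x = 0" by (subst (asm) nn_integral_0_iff_AE) auto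
  thus ?thesis using le fin'
    by eventually_elim (metis add.right_neutral add_diff_inverse_ennreal)
qed

lemma momentaD:
  assumes "\<tau> \<in> momenta"
  shows "\<tau> \<in> borel_measurable borel" "\<And>\<xi>. 0 \<le> \<tau> \<xi>" "integrable lborel \<tau>"
    "integrable lborel (\<lambda>\<xi>. (norm \<xi>)\<^sup>2 * \<tau> \<xi>)"
  using assms by (auto simp: momenta_def)

context tf_atom
begin

text \<open>Defined by a volume instead of a Fermi radius, so that Tonelli applies to arbitrary
  densities; for radially decreasing ones the two versions agree almost everywhere. At the origin
  the superlevel set may have infinite volume, which \<open>measure\<close> sends to 0.\<close>

definition Tr :: "(real^3 \<Rightarrow> real) \<Rightarrow> real^3 \<Rightarrow> real" where
  "Tr f x = kap * measure lborel {y. lev x < f y}"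

text \<open>The characteristic function of the phase-space set described by \<open>f\<close>.\<close>

definition occ :: "(real^3 \<Rightarrow> real) \<Rightarrow> real^3 \<Rightarrow> real^3 \<Rightarrow> ennreal" where
  "occ f x y = (if lev x < f y then 1 else 0)"

lemma occ_measurable[measurable (raw)]:
  assumes [measurable]: "f \<in> borel_measurable borel" "g \<in> measurable M borel" "h \<in> measurable M borel"
  shows "(\<lambda>z. occ f (g z) (h z)) \<in> borel_measurable M"
  unfolding occ_def by measurable

lemma occ_eq_indicator: "occ f x y = indicator {y. lev x < f y} y" "occ f x y = indicator {x. lev x < f y} x"
  by (auto simp: occ_def)

lemma nn_occ:
  assumes [measurable]: "f \<in> borel_measurable borel"
  shows "(\<integral>\<^sup>+y. occ f x y \<partial>lborel) = emeasure lborel {y. lev x < f y}"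
proof -
  have [measurable]: "{y. lev x < f y} \<in> sets borel" by measurable
  show ?thesis unfolding occ_eq_indicator(1) by simp
qed

lemma nn_occ_left:
  assumes "0 \<le> f y"
  shows "(\<integral>\<^sup>+x. occ f x y \<partial>lborel) = ennreal (f y / kap)"
  unfolding occ_eq_indicator(2) emeasure_lev_less[OF assms, symmetric] by (rule nn_integral_indicator) measurable

lemma Tr_nonneg: "0 \<le> Tr f x" using kap_pos by (simp add: Tr_def)

lemma Tr_measurable[measurable]:
  assumes [measurable]: "f \<in> borel_measurable borel"
  shows "Tr f \<in> borel_measurable borel"
proof -
  have "Tr f = (\<lambda>x. kap * enn2real (\<integral>\<^sup>+y. occ f x y \<partial>lborel))"
    by (intro ext) (simp add: Tr_def nn_occ measure_def)
  also have "\<dots> \<in> borel_measurable borel" by measurable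
  finally show ?thesis .
qed

lemma Tr_cong_AE:
  assumes eq: "AE x in lborel. f x = g x" and [measurable]: "f \<in> borel_measurable borel" "g \<in> borel_measurable borel"
  shows "Tr f = Tr g"
proof
  fix x
  have "measure lborel {y. lev x < f y} = measure lborel {y. lev x < g y}"
    using eq by (intro measure_eq_AE) (auto elim: eventually_mono)
  thus "Tr f x = Tr g x" by (simp add: Tr_def)
qed

text \<open>Markov's inequality at the positive level \<open>lev x\<close> makes the superlevel set
  finite, so its \<open>measure\<close> is its true volume. At the origin the level is 0 and the
  argument fails.\<close>

lemma nn_Tr:
  assumes [measurable]: "f \<in> borel_measurable borel" and nn: "\<And>y. 0 \<le> f y" and int: "integrable lborel f" and x: "x \<noteq> 0"
  shows "emeasure lborel {y. lev x < f y} = ennreal (Tr f x / kap)"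
    and "ennreal (Tr f x) = ennreal kap * (\<integral>\<^sup>+y. occ f x y \<partial>lborel)"
proof -
  have "ennreal (lev x) * (\<integral>\<^sup>+y. occ f x y \<partial>lborel) = (\<integral>\<^sup>+y. ennreal (lev x) * occ f x y \<partial>lborel)"
    by (rule nn_integral_cmult[symmetric]) measurable
  also have "\<dots> \<le> (\<integral>\<^sup>+y. ennreal (f y) \<partial>lborel)"
    by (intro nn_integral_mono) (auto simp: occ_def intro: ennreal_leI)
  also have "\<dots> = ennreal (integral\<^sup>L lborel f)" using int nn by (intro nn_integral_eq_integral) auto
  also have "\<dots> < top" by simp
  finally have "(\<integral>\<^sup>+y. occ f x y \<partial>lborel) < top"
    using lev_pos[OF x] by (auto simp: ennreal_mult_less_top)
  hence fin: "emeasure lborel {y. lev x < f y} < top" by (simp add: nn_occ)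
  hence "emeasure lborel {y. lev x < f y} = ennreal (measure lborel {y. lev x < f y})"
    by (intro emeasure_eq_ennreal_measure) auto
  thus *: "emeasure lborel {y. lev x < f y} = ennreal (Tr f x / kap)" using kap_pos by (simp add: Tr_def)
  show "ennreal (Tr f x) = ennreal kap * (\<integral>\<^sup>+y. occ f x y \<partial>lborel)"
    unfolding nn_occ[OF assms(1)] * using kap_pos Tr_nonneg[of f x] by (simp add: ennreal_mult'[symmetric])
qed

text \<open>Tonelli on the phase-space set: in the other order of integration the transform is
  replaced by integrals of u over centred balls.\<close>

lemma nn_Tr_weighted:
  assumes f[measurable]: "f \<in> borel_measurable borel" and nn: "\<And>y. 0 \<le> f y" and int: "integrable lborel f"
    and [measurable]: "u \<in> borel_measurable borel"
  shows "(\<integral>\<^sup>+x. u x * ennreal (Tr f x) \<partial>lborel) = ennreal kap * (\<integral>\<^sup>+y. (\<integral>\<^sup>+x. u x * occ f x y \<partial>lborel) \<partial>lborel)"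
proof -
  have "(\<integral>\<^sup>+x. u x * ennreal (Tr f x) \<partial>lborel) = (\<integral>\<^sup>+x. ennreal kap * (\<integral>\<^sup>+y. u x * occ f x y \<partial>lborel) \<partial>lborel)"
  proof (rule nn_integral_cong_AE, rule AE_mp[OF AE_lborel_singleton[of 0]], rule AE_I2, rule impI)
    fix x :: "real^3" assume "x \<noteq> 0"
    hence "u x * ennreal (Tr f x) = ennreal kap * (u x * (\<integral>\<^sup>+y. occ f x y \<partial>lborel))"
      by (simp add: nn_Tr(2)[OF f nn int] mult.left_commute)
    also have "u x * (\<integral>\<^sup>+y. occ f x y \<partial>lborel) = (\<integral>\<^sup>+y. u x * occ f x y \<partial>lborel)"
      by (rule nn_integral_cmult[symmetric]) measurable
    finally show "u x * ennreal (Tr f x) = ennreal kap * (\<integral>\<^sup>+y. u x * occ f x y \<partial>lborel)" .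
  qed
  also have "\<dots> = ennreal kap * (\<integral>\<^sup>+x. (\<integral>\<^sup>+y. u x * occ f x y \<partial>lborel) \<partial>lborel)"
    by (rule nn_integral_cmult) measurable
  also have "(\<integral>\<^sup>+x. (\<integral>\<^sup>+y. u x * occ f x y \<partial>lborel) \<partial>lborel) = (\<integral>\<^sup>+y. (\<integral>\<^sup>+x. u x * occ f x y \<partial>lborel) \<partial>lborel)"
    by (rule lborel_pair.Fubini'[symmetric]) measurable
  finally show ?thesis .
qed

lemma ennreal_kap_cancel: "0 \<le> a \<Longrightarrow> ennreal kap * ennreal (a / kap) = ennreal a"
  using kap_pos by (simp add: ennreal_mult'[symmetric])

lemma nn_kap_cancel:
  assumes [measurable]: "f \<in> borel_measurable borel" and "\<And>y. 0 \<le> f y"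
  shows "ennreal kap * (\<integral>\<^sup>+y. ennreal (f y / kap) \<partial>lborel) = (\<integral>\<^sup>+y. ennreal (f y) \<partial>lborel)"
  using assms(2) by (subst nn_integral_cmult[symmetric]) (simp_all add: ennreal_kap_cancel)

lemma nn_Tr_mass:
  assumes f[measurable]: "f \<in> borel_measurable borel" and nn: "\<And>y. 0 \<le> f y" and int: "integrable lborel f"
  shows "(\<integral>\<^sup>+x. ennreal (Tr f x) \<partial>lborel) = (\<integral>\<^sup>+y. ennreal (f y) \<partial>lborel)"
  using nn_Tr_weighted[OF f nn int, of "\<lambda>x. 1"] nn_kap_cancel[OF f nn] by (simp add: nn_occ_left nn)

lemma Tr_mass:
  assumes f[measurable]: "f \<in> borel_measurable borel" and nn: "\<And>y. 0 \<le> f y" and int: "integrable lborel f"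
  shows "integrable lborel (Tr f)" "integral\<^sup>L lborel (Tr f) = integral\<^sup>L lborel f"
proof -
  have fin: "(\<integral>\<^sup>+y. ennreal (f y) \<partial>lborel) = ennreal (integral\<^sup>L lborel f)"
    using int nn by (intro nn_integral_eq_integral) auto
  show "integrable lborel (Tr f)"
    by (rule integrableI_nonneg) (use nn_Tr_mass[OF f nn int] fin Tr_nonneg in auto)
  show "integral\<^sup>L lborel (Tr f) = integral\<^sup>L lborel f"
    using nn_Tr_mass[OF f nn int] nn Tr_nonneg by (simp add: integral_eq_nn_integral)
qed

lemma nn_kinetic_layers:
  assumes f[measurable]: "f \<in> borel_measurable borel" and nn: "\<And>y. 0 \<le> f y"
  shows "(\<integral>\<^sup>+y. ennreal ((norm y)\<^sup>2 * f y) \<partial>lborel)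
      = (\<integral>\<^sup>+x. ennreal kap * (\<integral>\<^sup>+y. ennreal ((norm y)\<^sup>2) * occ f x y \<partial>lborel) \<partial>lborel)"
proof -
  have "(\<integral>\<^sup>+x. ennreal kap * (\<integral>\<^sup>+y. ennreal ((norm y)\<^sup>2) * occ f x y \<partial>lborel) \<partial>lborel)
      = ennreal kap * (\<integral>\<^sup>+x. (\<integral>\<^sup>+y. ennreal ((norm y)\<^sup>2) * occ f x y \<partial>lborel) \<partial>lborel)"
    by (rule nn_integral_cmult) measurable
  also have "(\<integral>\<^sup>+x. (\<integral>\<^sup>+y. ennreal ((norm y)\<^sup>2) * occ f x y \<partial>lborel) \<partial>lborel)
      = (\<integral>\<^sup>+y. (\<integral>\<^sup>+x. ennreal ((norm y)\<^sup>2) * occ f x y \<partial>lborel) \<partial>lborel)"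
    by (rule lborel_pair.Fubini'[symmetric]) measurable
  also have "\<dots> = (\<integral>\<^sup>+y. ennreal ((norm y)\<^sup>2 * f y / kap) \<partial>lborel)"
  proof (rule nn_integral_cong)
    fix y :: "real^3"
    have "(\<integral>\<^sup>+x. ennreal ((norm y)\<^sup>2) * occ f x y \<partial>lborel) = ennreal ((norm y)\<^sup>2) * ennreal (f y / kap)"
      unfolding nn_occ_left[where f = f and y = y, OF nn, symmetric] by (rule nn_integral_cmult) measurable
    also have "\<dots> = ennreal ((norm y)\<^sup>2 * f y / kap)" by (simp add: ennreal_mult'[symmetric])
    finally show "(\<integral>\<^sup>+x. ennreal ((norm y)\<^sup>2) * occ f x y \<partial>lborel) = ennreal ((norm y)\<^sup>2 * f y / kap)" .
  qed
  also have "ennreal kap * \<dots> = (\<integral>\<^sup>+y. ennreal ((norm y)\<^sup>2 * f y) \<partial>lborel)"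
    by (rule nn_kap_cancel) (use nn in auto)
  finally show ?thesis by simp
qed

text \<open>With R the radius of the centred ball B of the same volume, (|\<xi>|^2 - R^2) (1_A -
  1_B) is nonnegative. Adding R^2 times the indicator of the other set expresses this without
  subtraction. Equality of the integrals forces pointwise equality, hence A = B off the sphere
  |\<xi>| = R.\<close>

lemma bathtub:
  assumes A[measurable]: "A \<in> sets borel" and vol: "emeasure lborel A = ennreal (r / kap)" and r: "0 \<le> r"
  shows "ennreal (3/5 * \<gamma> * r powr (5/3) / kap) \<le> (\<integral>\<^sup>+\<xi>. ennreal ((norm \<xi>)\<^sup>2) * indicator A \<xi> \<partial>lborel)"
    and "(\<integral>\<^sup>+\<xi>. ennreal ((norm \<xi>)\<^sup>2) * indicator A \<xi> \<partial>lborel) \<le> ennreal (3/5 * \<gamma> * r powr (5/3) / kap)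
      \<Longrightarrow> AE \<xi> in lborel. \<xi> \<in> A \<longleftrightarrow> lev \<xi> < r"
proof -
  define R where "R = w * r powr (1/3)"
  have R0: "0 \<le> R" unfolding R_def by (rule radius_nonneg)
  define B where "B = {\<xi>. lev \<xi> < r}"
  have [measurable]: "B \<in> sets borel" unfolding B_def by measurable
  have B: "\<xi> \<in> B \<longleftrightarrow> norm \<xi> < R" for \<xi> unfolding B_def R_def using lev_less_iff[OF r] by simp
  have volB: "emeasure lborel B = ennreal (r / kap)" unfolding B_def by (rule emeasure_lev_less[OF r])
  let ?K = "\<lambda>S. \<integral>\<^sup>+\<xi>. ennreal ((norm \<xi>)\<^sup>2) * indicator S \<xi> \<partial>(lborel :: (real^3) measure)"
  have KB: "?K B = ennreal (3/5 * \<gamma> * r powr (5/3) / kap)" unfolding B_def by (rule nn_integral_norm_square_lev[OF r])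
  let ?f = "\<lambda>\<xi>. ennreal ((norm \<xi>)\<^sup>2) * indicator B \<xi> + ennreal (R\<^sup>2) * indicator A \<xi>"
  let ?g = "\<lambda>\<xi>. ennreal ((norm \<xi>)\<^sup>2) * indicator A \<xi> + ennreal (R\<^sup>2) * indicator B \<xi>"
  define v where "v = R\<^sup>2 * (r / kap)"
  have vA: "(\<integral>\<^sup>+\<xi>. ennreal (R\<^sup>2) * indicator A \<xi> \<partial>lborel) = ennreal v"
    by (subst nn_integral_cmult) (simp_all add: vol v_def ennreal_mult'[symmetric])
  have vB: "(\<integral>\<^sup>+\<xi>. ennreal (R\<^sup>2) * indicator B \<xi> \<partial>lborel) = ennreal v"
    by (subst nn_integral_cmult) (simp_all add: volB v_def ennreal_mult'[symmetric])
  have If: "integral\<^sup>N lborel ?f = ?K B + ennreal v"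
    by (subst nn_integral_add) (simp_all add: vA)
  have Ig: "integral\<^sup>N lborel ?g = ?K A + ennreal v"
    by (subst nn_integral_add) (simp_all add: vB)
  have le: "?f \<xi> \<le> ?g \<xi>" for \<xi>
  proof -
    consider "\<xi> \<in> A" "\<xi> \<in> B" | "\<xi> \<in> A" "\<xi> \<notin> B" | "\<xi> \<notin> A" "\<xi> \<in> B" | "\<xi> \<notin> A" "\<xi> \<notin> B" by blast
    thus ?thesis
    proof cases
      case 2
      hence "R \<le> norm \<xi>" using B by (simp add: not_less)
      hence "R\<^sup>2 \<le> (norm \<xi>)\<^sup>2" using R0 by (rule power_mono)
      thus ?thesis using 2 by (simp add: ennreal_leI)
    next
      case 3
      hence "norm \<xi> \<le> R" using B by simp
      hence "(norm \<xi>)\<^sup>2 \<le> R\<^sup>2" by (rule power_mono) simp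
      thus ?thesis using 3 by (simp add: ennreal_leI)
    qed simp_all
  qed
  have "integral\<^sup>N lborel ?f \<le> integral\<^sup>N lborel ?g" by (intro nn_integral_mono le)
  hence "ennreal v + ?K B \<le> ennreal v + ?K A" unfolding If Ig by (simp add: add.commute)
  hence "?K B \<le> ?K A" by (subst (asm) ennreal_add_left_cancel_le) simp
  thus "ennreal (3/5 * \<gamma> * r powr (5/3) / kap) \<le> ?K A" by (simp only: KB)
  assume "?K A \<le> ennreal (3/5 * \<gamma> * r powr (5/3) / kap)"
  hence KA: "?K A \<le> ?K B" by (simp only: KB)
  have "AE \<xi> in lborel. ?f \<xi> = ?g \<xi>"
  proof (rule nn_integral_eq_imp_AE_eq)
    show "integral\<^sup>N lborel ?g \<le> integral\<^sup>N lborel ?f" unfolding If Ig by (intro add_right_mono KA)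
    show "integral\<^sup>N lborel ?f < \<infinity>" unfolding If KB by simp
  qed (use le in auto)
  thus "AE \<xi> in lborel. \<xi> \<in> A \<longleftrightarrow> lev \<xi> < r"
    using AE_norm_neq[of R]
  proof eventually_elim
    fix \<xi> :: "real^3" assume fg: "?f \<xi> = ?g \<xi>" and nR: "norm \<xi> \<noteq> R"
    have ne: "ennreal ((norm \<xi>)\<^sup>2) \<noteq> ennreal (R\<^sup>2)" using nR R0 by simp
    have "\<xi> \<in> A \<longleftrightarrow> \<xi> \<in> B" using fg ne by (cases "\<xi> \<in> A"; cases "\<xi> \<in> B") simp_all
    thus "\<xi> \<in> A \<longleftrightarrow> lev \<xi> < r" by (simp add: B_def)
  qed
qed

text \<open>\<open>\<tau>\<close> and \<open>\<rho>\<close> describe the same phase-space set.\<close>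

definition phase_dual :: "(real^3 \<Rightarrow> real) \<Rightarrow> (real^3 \<Rightarrow> real) \<Rightarrow> bool" where
  "phase_dual \<tau> \<rho> \<longleftrightarrow> (AE x in lborel. AE \<xi> in lborel. lev x < \<tau> \<xi> \<longleftrightarrow> lev \<xi> < \<rho> x)"

lemma phase_dual_sym:
  assumes [measurable]: "\<tau> \<in> borel_measurable borel" "\<rho> \<in> borel_measurable borel" and "phase_dual \<tau> \<rho>"
  shows "phase_dual \<rho> \<tau>"
proof -
  have "AE \<xi> in lborel. AE x in lborel. lev x < \<tau> \<xi> \<longleftrightarrow> lev \<xi> < \<rho> x"
    using assms(3) unfolding phase_dual_def
    by (subst (asm) lborel_pair.AE_commute) measurable
  thus ?thesis unfolding phase_dual_def by (auto elim!: eventually_mono)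
qed

lemma phase_dual_imp_Tr:
  assumes [measurable]: "\<tau> \<in> borel_measurable borel" "\<rho> \<in> borel_measurable borel" and nn: "\<And>\<xi>. 0 \<le> \<tau> \<xi>"
    and pd: "phase_dual \<tau> \<rho>"
  shows "AE \<xi> in lborel. \<tau> \<xi> = Tr \<rho> \<xi>"
proof -
  have "phase_dual \<rho> \<tau>" by (rule phase_dual_sym[OF _ _ pd]) measurable
  thus ?thesis unfolding phase_dual_def
  proof eventually_elim
    fix \<xi> assume *: "AE x in lborel. lev \<xi> < \<rho> x \<longleftrightarrow> lev x < \<tau> \<xi>"
    have "measure lborel {x. lev \<xi> < \<rho> x} = measure lborel {x. lev x < \<tau> \<xi>}"
      using * by (intro measure_eq_AE) (auto elim: eventually_mono)
    also have "\<dots> = \<tau> \<xi> / kap" using emeasure_lev_less[OF nn] nn kap_pos by (simp add: measure_def)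
    finally show "\<tau> \<xi> = Tr \<rho> \<xi>" using kap_pos by (simp add: Tr_def)
  qed
qed

definition EmTF :: "(real^3 \<Rightarrow> real) \<Rightarrow> real" where
  "EmTF \<tau> = (\<integral>\<xi>. (norm \<xi>)\<^sup>2 * \<tau> \<xi> \<partial>lborel) - 3 / (2 * w) * Z * (\<integral>\<xi>. \<tau> \<xi> powr (2/3) \<partial>lborel)
     + 3 / (4 * w) * (\<integral>p. overlap (\<tau> (fst p)) (\<tau> (snd p)) \<partial>(lborel \<Otimes>\<^sub>M lborel))"

lemma Tr_kinetic_pointwise:
  assumes \<tau>: "\<tau> \<in> momenta" and x: "x \<noteq> 0"
  shows "ennreal (3/5 * \<gamma> * Tr \<tau> x powr (5/3)) \<le> ennreal kap * (\<integral>\<^sup>+\<xi>. ennreal ((norm \<xi>)\<^sup>2) * occ \<tau> x \<xi> \<partial>lborel)"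
    and "ennreal kap * (\<integral>\<^sup>+\<xi>. ennreal ((norm \<xi>)\<^sup>2) * occ \<tau> x \<xi> \<partial>lborel) = ennreal (3/5 * \<gamma> * Tr \<tau> x powr (5/3))
      \<Longrightarrow> AE \<xi> in lborel. lev x < \<tau> \<xi> \<longleftrightarrow> lev \<xi> < Tr \<tau> x"
proof -
  note [measurable] = momentaD(1)[OF \<tau>]
  let ?A = "{\<xi>. lev x < \<tau> \<xi>}"
  have A: "?A \<in> sets borel" by measurable
  have vol: "emeasure lborel ?A = ennreal (Tr \<tau> x / kap)"
    using momentaD[OF \<tau>] x by (intro nn_Tr(1)) auto
  note bt = bathtub[OF A vol Tr_nonneg]
  have K: "ennreal kap * ennreal (3/5 * \<gamma> * Tr \<tau> x powr (5/3) / kap) = ennreal (3/5 * \<gamma> * Tr \<tau> x powr (5/3))"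
    using gamma_pos by (intro ennreal_kap_cancel) simp
  show "ennreal (3/5 * \<gamma> * Tr \<tau> x powr (5/3)) \<le> ennreal kap * (\<integral>\<^sup>+\<xi>. ennreal ((norm \<xi>)\<^sup>2) * occ \<tau> x \<xi> \<partial>lborel)"
    unfolding K[symmetric] occ_eq_indicator(1) by (intro mult_left_mono bt(1)) simp
  assume "ennreal kap * (\<integral>\<^sup>+\<xi>. ennreal ((norm \<xi>)\<^sup>2) * occ \<tau> x \<xi> \<partial>lborel) = ennreal (3/5 * \<gamma> * Tr \<tau> x powr (5/3))"
  hence "ennreal kap * (\<integral>\<^sup>+\<xi>. ennreal ((norm \<xi>)\<^sup>2) * indicator ?A \<xi> \<partial>lborel) = ennreal kap * ennreal (3/5 * \<gamma> * Tr \<tau> x powr (5/3) / kap)"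
    unfolding K[symmetric] occ_eq_indicator(1) .
  hence "(\<integral>\<^sup>+\<xi>. ennreal ((norm \<xi>)\<^sup>2) * indicator ?A \<xi> \<partial>lborel) = ennreal (3/5 * \<gamma> * Tr \<tau> x powr (5/3) / kap)"
    using kap_pos by (subst (asm) ennreal_mult_cancel_left) auto
  hence "AE \<xi> in lborel. \<xi> \<in> ?A \<longleftrightarrow> lev \<xi> < Tr \<tau> x" by (intro bt(2)) simp
  thus "AE \<xi> in lborel. lev x < \<tau> \<xi> \<longleftrightarrow> lev \<xi> < Tr \<tau> x" by simp
qed

text \<open>The momenta occupied at a position x fill a set of volume
  \<open>Tr \<tau> x / kap\<close>, to which the bathtub principle applies; integrating over x
  compares the kinetic energies. Equal finite integrals of ordered functions give equality for
  almost every x, hence slices that are balls.\<close>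

lemma Tr_kinetic:
  assumes \<tau>: "\<tau> \<in> momenta"
  shows "Tr \<tau> \<in> densities"
    and "3/5 * \<gamma> * (\<integral>x. Tr \<tau> x powr (5/3) \<partial>lborel) \<le> (\<integral>\<xi>. (norm \<xi>)\<^sup>2 * \<tau> \<xi> \<partial>lborel)"
    and "3/5 * \<gamma> * (\<integral>x. Tr \<tau> x powr (5/3) \<partial>lborel) = (\<integral>\<xi>. (norm \<xi>)\<^sup>2 * \<tau> \<xi> \<partial>lborel)
      \<Longrightarrow> phase_dual \<tau> (Tr \<tau>)"
proof -
  note [measurable] = momentaD(1)[OF \<tau>]
  have [measurable]: "Tr \<tau> \<in> borel_measurable borel" by measurable
  let ?T = "\<integral>\<xi>. (norm \<xi>)\<^sup>2 * \<tau> \<xi> \<partial>lborel"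
  let ?l = "\<lambda>x. ennreal (3/5 * \<gamma> * Tr \<tau> x powr (5/3))"
  let ?r = "\<lambda>x. ennreal kap * (\<integral>\<^sup>+\<xi>. ennreal ((norm \<xi>)\<^sup>2) * occ \<tau> x \<xi> \<partial>lborel)"
  have r: "integral\<^sup>N lborel ?r = ennreal ?T"
    unfolding nn_kinetic_layers[OF momentaD(1,2)[OF \<tau>], symmetric]
    using momentaD[OF \<tau>] by (intro nn_integral_eq_integral) auto
  have le: "AE x in lborel. ?l x \<le> ?r x"
    using AE_lborel_singleton[of "0::real^3"] by eventually_elim (rule Tr_kinetic_pointwise(1)[OF \<tau>])
  have l: "integral\<^sup>N lborel ?l \<le> ennreal ?T" unfolding r[symmetric] by (rule nn_integral_mono_AE[OF le])
  have int: "integrable lborel (\<lambda>x. 3/5 * \<gamma> * Tr \<tau> x powr (5/3))"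
  proof (rule integrableI_nonneg)
    show "(\<integral>\<^sup>+x. ?l x \<partial>lborel) < \<infinity>" using l by (rule le_less_trans) simp
  qed (use gamma_pos in auto)
  have "(\<lambda>x. Tr \<tau> x powr (5/3)) = (\<lambda>x. 5 / (3 * \<gamma>) * (3/5 * \<gamma> * Tr \<tau> x powr (5/3)))"
    using gamma_pos by simp
  hence int': "integrable lborel (\<lambda>x. Tr \<tau> x powr (5/3))"
    using integrable_mult_right[OF int, of "5 / (3 * \<gamma>)"] by (simp only:)
  show "Tr \<tau> \<in> densities"
    unfolding densities_def using int' Tr_nonneg Tr_mass(1)[OF momentaD(1,2,3)[OF \<tau>]] by auto
  have lI: "integral\<^sup>N lborel ?l = ennreal (3/5 * \<gamma> * (\<integral>x. Tr \<tau> x powr (5/3) \<partial>lborel))"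
    using nn_integral_eq_integral[OF int] gamma_pos by simp
  have T0: "0 \<le> ?T" using momentaD(2)[OF \<tau>] by (intro integral_nonneg_AE) simp
  show "3/5 * \<gamma> * (\<integral>x. Tr \<tau> x powr (5/3) \<partial>lborel) \<le> ?T"
    using l T0 unfolding lI by (subst (asm) ennreal_le_iff) simp_all
  assume "3/5 * \<gamma> * (\<integral>x. Tr \<tau> x powr (5/3) \<partial>lborel) = ?T"
  hence eq: "integral\<^sup>N lborel ?r = integral\<^sup>N lborel ?l" unfolding r lI by (simp only:)
  have "AE x in lborel. ?l x = ?r x"
  proof (rule nn_integral_eq_imp_AE_eq[OF _ _ le])
    show "integral\<^sup>N lborel ?r \<le> integral\<^sup>N lborel ?l" by (simp only: eq)
    show "integral\<^sup>N lborel ?l < \<infinity>" unfolding lI by simp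
  qed measurable
  thus "phase_dual \<tau> (Tr \<tau>)"
    unfolding phase_dual_def using AE_lborel_singleton[of "0::real^3"]
    by eventually_elim (rule Tr_kinetic_pointwise(2)[OF \<tau>], assumption, erule sym)
qed

text \<open>The attraction over a centred ball is proportional to the square of its radius, that is,
  to the power 2/3 of its volume; hence the exponent of \<tau>.\<close>

lemma nn_Tr_attraction:
  assumes \<tau>: "\<tau> \<in> momenta"
  shows "3 / (2 * w) * (\<integral>\<xi>. \<tau> \<xi> powr (2/3) \<partial>lborel) = (\<integral>x. 1 / norm x * Tr \<tau> x \<partial>lborel)"
proof -
  note [measurable] = momentaD(1)[OF \<tau>]
  have [measurable]: "Tr \<tau> \<in> borel_measurable borel" by measurable
  have "(\<integral>\<^sup>+x. ennreal (1 / norm x * Tr \<tau> x) \<partial>lborel) = (\<integral>\<^sup>+x. ennreal (1 / norm x) * ennreal (Tr \<tau> x) \<partial>lborel)"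
    by (intro nn_integral_cong ennreal_mult') simp
  also have "\<dots> = ennreal kap * (\<integral>\<^sup>+y. (\<integral>\<^sup>+x. ennreal (1 / norm x) * occ \<tau> x y \<partial>lborel) \<partial>lborel)"
    by (rule nn_Tr_weighted[OF momentaD(1,2,3)[OF \<tau>]]) measurable
  also have "\<dots> = ennreal kap * (\<integral>\<^sup>+y. ennreal (3 / (2 * w) * \<tau> y powr (2/3) / kap) \<partial>lborel)"
    unfolding occ_eq_indicator(2) nn_integral_inverse_norm_lev[OF momentaD(2)[OF \<tau>]] ..
  also have "\<dots> = (\<integral>\<^sup>+y. ennreal (3 / (2 * w) * \<tau> y powr (2/3)) \<partial>lborel)"
    by (rule nn_kap_cancel) (use w_pos in auto)
  finally have "(\<integral>x. 1 / norm x * Tr \<tau> x \<partial>lborel) = (\<integral>y. 3 / (2 * w) * \<tau> y powr (2/3) \<partial>lborel)"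
    using w_pos Tr_nonneg by (subst (1 2) integral_eq_nn_integral) auto
  thus ?thesis by simp
qed

text \<open>Unfolding both factors into layers by \<open>nn_Tr_weighted\<close> leaves, for each
  pair of momenta, the mutual energy of two centred balls, which is \<open>overlap\<close> up to
  constants.\<close>

lemma nn_Tr_repulsion:
  assumes \<tau>: "\<tau> \<in> momenta"
  shows "3 / (2 * w) * (\<integral>p. overlap (\<tau> (fst p)) (\<tau> (snd p)) \<partial>(lborel \<Otimes>\<^sub>M lborel)) = mx.Q (Tr \<tau>) (Tr \<tau>)"
proof -
  note m[measurable] = momentaD(1)[OF \<tau>]
  note nn = momentaD(2)[OF \<tau>]
  have \<rho>: "Tr \<tau> \<in> densities" by (rule Tr_kinetic(1)[OF \<tau>])
  have [measurable]: "Tr \<tau> \<in> borel_measurable borel" by measurable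
  note W = nn_Tr_weighted[OF momentaD(1,2,3)[OF \<tau>]]
  define P where "P = (\<lambda>\<eta> x. \<integral>\<^sup>+y. ennreal (kmax x y) * occ \<tau> y \<eta> \<partial>lborel)"
  have Pm[measurable]: "case_prod P \<in> borel_measurable (borel \<Otimes>\<^sub>M borel)"
    unfolding P_def by measurable
  have inner: "(\<integral>\<^sup>+y. ennreal (kmax x y) * ennreal (Tr \<tau> y) \<partial>lborel) = ennreal kap * (\<integral>\<^sup>+\<eta>. P \<eta> x \<partial>lborel)" for x
    unfolding P_def by (rule W) measurable
  have "ennreal (mx.Q (Tr \<tau>) (Tr \<tau>))
      = (\<integral>\<^sup>+x. (\<integral>\<^sup>+y. ennreal (Tr \<tau> x) * (ennreal (kmax x y) * ennreal (Tr \<tau> y)) \<partial>lborel) \<partial>lborel)"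
    by (rule mx.nn_Q[OF \<rho> \<rho>, symmetric])
  also have "\<dots> = (\<integral>\<^sup>+x. (\<integral>\<^sup>+y. ennreal (kmax x y) * ennreal (Tr \<tau> y) \<partial>lborel) * ennreal (Tr \<tau> x) \<partial>lborel)"
    by (subst nn_integral_cmult) (simp_all add: mult.commute)
  also have "\<dots> = (\<integral>\<^sup>+x. (ennreal kap * (\<integral>\<^sup>+\<eta>. P \<eta> x \<partial>lborel)) * ennreal (Tr \<tau> x) \<partial>lborel)"
    unfolding inner ..
  also have "\<dots> = ennreal kap * (\<integral>\<^sup>+\<xi>. (\<integral>\<^sup>+x. (ennreal kap * (\<integral>\<^sup>+\<eta>. P \<eta> x \<partial>lborel)) * occ \<tau> x \<xi> \<partial>lborel) \<partial>lborel)"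
    by (rule W) measurable
  also have "\<dots> = ennreal kap * (\<integral>\<^sup>+\<xi>. (\<integral>\<^sup>+\<eta>. ennreal kap * ennreal (3 / (2 * w) * overlap (\<tau> \<xi>) (\<tau> \<eta>) / kap\<^sup>2) \<partial>lborel) \<partial>lborel)"
  proof (rule arg_cong[where f = "\<lambda>t. ennreal kap * t"], rule nn_integral_cong)
    fix \<xi> :: "real^3"
    have "(\<integral>\<^sup>+x. (ennreal kap * (\<integral>\<^sup>+\<eta>. P \<eta> x \<partial>lborel)) * occ \<tau> x \<xi> \<partial>lborel)
        = (\<integral>\<^sup>+x. (\<integral>\<^sup>+\<eta>. ennreal kap * (P \<eta> x * occ \<tau> x \<xi>) \<partial>lborel) \<partial>lborel)"
    proof (rule nn_integral_cong)
      fix x :: "real^3"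
      have "(\<integral>\<^sup>+\<eta>. ennreal kap * (P \<eta> x * occ \<tau> x \<xi>) \<partial>lborel) = ennreal kap * (\<integral>\<^sup>+\<eta>. P \<eta> x * occ \<tau> x \<xi> \<partial>lborel)"
        by (rule nn_integral_cmult) measurable
      also have "(\<integral>\<^sup>+\<eta>. P \<eta> x * occ \<tau> x \<xi> \<partial>lborel) = (\<integral>\<^sup>+\<eta>. P \<eta> x \<partial>lborel) * occ \<tau> x \<xi>"
        by (rule nn_integral_multc) measurable
      finally show "(ennreal kap * (\<integral>\<^sup>+\<eta>. P \<eta> x \<partial>lborel)) * occ \<tau> x \<xi> = (\<integral>\<^sup>+\<eta>. ennreal kap * (P \<eta> x * occ \<tau> x \<xi>) \<partial>lborel)"
        by (simp only: mult.assoc)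
    qed
    also have "\<dots> = (\<integral>\<^sup>+\<eta>. (\<integral>\<^sup>+x. ennreal kap * (P \<eta> x * occ \<tau> x \<xi>) \<partial>lborel) \<partial>lborel)"
      by (rule lborel_pair.Fubini') measurable
    also have "\<dots> = (\<integral>\<^sup>+\<eta>. ennreal kap * ennreal (3 / (2 * w) * overlap (\<tau> \<xi>) (\<tau> \<eta>) / kap\<^sup>2) \<partial>lborel)"
    proof (rule nn_integral_cong)
      fix \<eta> :: "real^3"
      have "(\<integral>\<^sup>+x. ennreal kap * (P \<eta> x * occ \<tau> x \<xi>) \<partial>lborel) = ennreal kap * (\<integral>\<^sup>+x. P \<eta> x * occ \<tau> x \<xi> \<partial>lborel)"
        by (rule nn_integral_cmult) measurable
      also have "(\<integral>\<^sup>+x. P \<eta> x * occ \<tau> x \<xi> \<partial>lborel) = ennreal (3 / (2 * w) * overlap (\<tau> \<xi>) (\<tau> \<eta>) / kap\<^sup>2)"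
        unfolding P_def occ_eq_indicator(2) by (rule nn_integral_kmax_lev[OF nn nn])
      finally show "(\<integral>\<^sup>+x. ennreal kap * (P \<eta> x * occ \<tau> x \<xi>) \<partial>lborel)
          = ennreal kap * ennreal (3 / (2 * w) * overlap (\<tau> \<xi>) (\<tau> \<eta>) / kap\<^sup>2)" .
    qed
    finally show "(\<integral>\<^sup>+x. (ennreal kap * (\<integral>\<^sup>+\<eta>. P \<eta> x \<partial>lborel)) * occ \<tau> x \<xi> \<partial>lborel)
      = (\<integral>\<^sup>+\<eta>. ennreal kap * ennreal (3 / (2 * w) * overlap (\<tau> \<xi>) (\<tau> \<eta>) / kap\<^sup>2) \<partial>lborel)" .
  qed
  also have "\<dots> = (\<integral>\<^sup>+\<xi>. (\<integral>\<^sup>+\<eta>. ennreal (3 / (2 * w) * overlap (\<tau> \<xi>) (\<tau> \<eta>)) \<partial>lborel) \<partial>lborel)"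
  proof -
    have om[measurable]: "(\<lambda>p. overlap (\<tau> (fst p)) (\<tau> (snd p))) \<in> borel_measurable (borel \<Otimes>\<^sub>M borel)"
      unfolding overlap_def by measurable
    have "(\<integral>\<^sup>+\<eta>. ennreal kap * ennreal (3 / (2 * w) * overlap (\<tau> \<xi>) (\<tau> \<eta>) / kap\<^sup>2) \<partial>lborel)
        = (\<integral>\<^sup>+\<eta>. ennreal (3 / (2 * w) * overlap (\<tau> \<xi>) (\<tau> \<eta>) / kap) \<partial>lborel)" for \<xi>
      using kap_pos by (intro nn_integral_cong) (simp add: ennreal_mult'[symmetric] power2_eq_square mult.assoc)
    moreover have "ennreal kap * (\<integral>\<^sup>+\<xi>. (\<integral>\<^sup>+\<eta>. ennreal (3 / (2 * w) * overlap (\<tau> \<xi>) (\<tau> \<eta>) / kap) \<partial>lborel) \<partial>lborel)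
        = (\<integral>\<^sup>+\<xi>. ennreal kap * (\<integral>\<^sup>+\<eta>. ennreal (3 / (2 * w) * overlap (\<tau> \<xi>) (\<tau> \<eta>) / kap) \<partial>lborel) \<partial>lborel)"
      unfolding overlap_def by (rule nn_integral_cmult[symmetric]) measurable
    moreover have "ennreal kap * (\<integral>\<^sup>+\<eta>. ennreal (3 / (2 * w) * overlap (\<tau> \<xi>) (\<tau> \<eta>) / kap) \<partial>lborel)
        = (\<integral>\<^sup>+\<eta>. ennreal (3 / (2 * w) * overlap (\<tau> \<xi>) (\<tau> \<eta>)) \<partial>lborel)" for \<xi>
    proof (rule nn_kap_cancel)
      show "(\<lambda>\<eta>. 3 / (2 * w) * overlap (\<tau> \<xi>) (\<tau> \<eta>)) \<in> borel_measurable borel"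
        unfolding overlap_def by measurable
      show "0 \<le> 3 / (2 * w) * overlap (\<tau> \<xi>) (\<tau> \<eta>)" for \<eta> using w_pos overlap_nonneg[OF nn nn] by simp
    qed
    ultimately show ?thesis by (simp only:)
  qed
  also have "\<dots> = (\<integral>\<^sup>+p. ennreal (3 / (2 * w) * overlap (\<tau> (fst p)) (\<tau> (snd p))) \<partial>(lborel \<Otimes>\<^sub>M lborel))"
  proof -
    have [measurable]: "(\<lambda>p. overlap (\<tau> (fst p)) (\<tau> (snd p))) \<in> borel_measurable (lborel \<Otimes>\<^sub>M lborel)"
      unfolding overlap_def by measurable
    show ?thesis by (subst lborel.nn_integral_fst[symmetric]) simp_all
  qed
  finally have "ennreal (mx.Q (Tr \<tau>) (Tr \<tau>)) = (\<integral>\<^sup>+p. ennreal (3 / (2 * w) * overlap (\<tau> (fst p)) (\<tau> (snd p))) \<partial>(lborel \<Otimes>\<^sub>M lborel))" .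
  hence Q: "(\<integral>\<^sup>+p. ennreal (3 / (2 * w) * overlap (\<tau> (fst p)) (\<tau> (snd p))) \<partial>(lborel \<Otimes>\<^sub>M lborel)) = ennreal (mx.Q (Tr \<tau>) (Tr \<tau>))" ..
  have "(\<lambda>p. overlap (\<tau> (fst p)) (\<tau> (snd p))) \<in> borel_measurable (lborel \<Otimes>\<^sub>M lborel)"
    unfolding overlap_def by measurable
  hence "(\<integral>p. 3 / (2 * w) * overlap (\<tau> (fst p)) (\<tau> (snd p)) \<partial>(lborel \<Otimes>\<^sub>M lborel))
      = enn2real (\<integral>\<^sup>+p. ennreal (3 / (2 * w) * overlap (\<tau> (fst p)) (\<tau> (snd p))) \<partial>(lborel \<Otimes>\<^sub>M lborel))"
    using w_pos overlap_nonneg[OF nn nn] by (intro integral_eq_nn_integral AE_I2) simp_all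
  also have "\<dots> = mx.Q (Tr \<tau>) (Tr \<tau>)" unfolding Q using mx.Q_nonneg[OF \<rho> \<rho>] by simp
  finally have "(\<integral>p. 3 / (2 * w) * overlap (\<tau> (fst p)) (\<tau> (snd p)) \<partial>(lborel \<Otimes>\<^sub>M lborel)) = mx.Q (Tr \<tau>) (Tr \<tau>)" .
  thus ?thesis by simp
qed

theorem EmTF_eq:
  assumes \<tau>: "\<tau> \<in> momenta"
  shows "EmTF \<tau> = mx.En (Tr \<tau>) + ((\<integral>\<xi>. (norm \<xi>)\<^sup>2 * \<tau> \<xi> \<partial>lborel) - 3/5 * \<gamma> * (\<integral>x. Tr \<tau> x powr (5/3) \<partial>lborel))"
proof -
  have "(\<integral>x. Z / norm x * Tr \<tau> x \<partial>lborel) = Z * (\<integral>x. 1 / norm x * Tr \<tau> x \<partial>lborel)"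
    by (subst integral_mult_right_zero[symmetric]) (intro Bochner_Integration.integral_cong, auto)
  also have "\<dots> = 3 / (2 * w) * Z * (\<integral>\<xi>. \<tau> \<xi> powr (2/3) \<partial>lborel)"
    unfolding nn_Tr_attraction[OF \<tau>, symmetric] by simp
  finally have a: "(\<integral>x. Z / norm x * Tr \<tau> x \<partial>lborel) = 3 / (2 * w) * Z * (\<integral>\<xi>. \<tau> \<xi> powr (2/3) \<partial>lborel)" .
  have q: "1/2 * mx.Q (Tr \<tau>) (Tr \<tau>) = 3 / (4 * w) * (\<integral>p. overlap (\<tau> (fst p)) (\<tau> (snd p)) \<partial>(lborel \<Otimes>\<^sub>M lborel))"
    unfolding nn_Tr_repulsion[OF \<tau>, symmetric] by simp
  show ?thesis unfolding EmTF_def mx.En_def a q by simp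
qed

text \<open>The superlevel set A has the volume of a ball of radius R. Away from the origin, a point
  of A has all nearer points in A, so its ball is no larger than A; a point outside A has A within
  its ball. Comparing volumes locates both relative to R.\<close>

lemma phase_dual_of_radially_decreasing:
  assumes \<rho>: "\<rho> \<in> densities" and rad: "radially_decreasing \<rho>"
  shows "phase_dual \<rho> (Tr \<rho>)"
  unfolding phase_dual_def using AE_lborel_singleton[of "0::real^3"]
proof eventually_elim
  note [measurable] = densitiesD(1)[OF \<rho>]
  fix \<xi> :: "real^3" assume \<xi>: "\<xi> \<noteq> 0"
  let ?A = "{x. lev \<xi> < \<rho> x}"
  have A[measurable]: "?A \<in> sets borel" by measurable
  have vol: "emeasure lborel ?A = ennreal (Tr \<rho> \<xi> / kap)"
    using densitiesD[OF \<rho>] \<xi> by (intro nn_Tr(1)) auto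
  define R where "R = w * Tr \<rho> \<xi> powr (1/3)"
  have R0: "0 \<le> R" unfolding R_def by (rule radius_nonneg)
  have R: "lev x < Tr \<rho> \<xi> \<longleftrightarrow> norm x < R" for x unfolding R_def by (rule lev_less_iff[OF Tr_nonneg])
  have "emeasure lborel ?A = emeasure lborel {x. lev x < Tr \<rho> \<xi>}"
    unfolding vol by (rule emeasure_lev_less[OF Tr_nonneg, symmetric])
  also have "\<dots> = ennreal (4/3 * pi * R ^ 3)" unfolding R by (rule emeasure_norm_less[OF R0])
  finally have volR: "emeasure lborel ?A = ennreal (4/3 * pi * R ^ 3)" .
  have in_le: "norm x \<le> R" if x: "x \<noteq> 0" "x \<in> ?A" for x
  proof -
    have "emeasure lborel {y::real^3. norm y < norm x} \<le> emeasure lborel ?A"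
    proof (rule emeasure_mono_AE)
      show "AE y in lborel. y \<in> {y::real^3. norm y < norm x} \<longrightarrow> y \<in> ?A"
        using AE_lborel_singleton[of "0::real^3"]
      proof eventually_elim
        fix y :: "real^3" assume "y \<noteq> 0"
        thus "y \<in> {y::real^3. norm y < norm x} \<longrightarrow> y \<in> ?A"
          using rad[unfolded radially_decreasing_def, rule_format, of y x] x by auto
      qed
    qed measurable
    hence "ennreal (4/3 * pi * norm x ^ 3) \<le> ennreal (4/3 * pi * R ^ 3)"
      unfolding volR by (simp add: emeasure_norm_less)
    hence "4/3 * pi * norm x ^ 3 \<le> 4/3 * pi * R ^ 3" using R0 by (subst (asm) ennreal_le_iff) simp_all
    hence "norm x ^ 3 \<le> R ^ 3" by simp
    thus ?thesis using cube_less_iff[OF R0 norm_ge_zero[of x]] by (simp add: not_less[symmetric])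
  qed
  have out_ge: "R \<le> norm x" if x: "x \<noteq> 0" "x \<notin> ?A" for x
  proof -
    have "emeasure lborel ?A \<le> emeasure lborel {y::real^3. norm y < norm x}"
    proof (rule emeasure_mono)
      show "?A \<subseteq> {y::real^3. norm y < norm x}"
      proof (rule subsetI, rule CollectI, rule ccontr)
        fix y assume y: "y \<in> ?A" "\<not> norm y < norm x"
        hence "\<rho> y \<le> \<rho> x" using rad[unfolded radially_decreasing_def, rule_format, of x y] x by simp
        thus False using x y by simp
      qed
    qed measurable
    hence "ennreal (4/3 * pi * R ^ 3) \<le> ennreal (4/3 * pi * norm x ^ 3)"
      unfolding volR by (simp add: emeasure_norm_less)
    hence "4/3 * pi * R ^ 3 \<le> 4/3 * pi * norm x ^ 3" by (subst (asm) ennreal_le_iff) simp_all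
    hence "R ^ 3 \<le> norm x ^ 3" by simp
    thus ?thesis using cube_less_iff[OF norm_ge_zero[of x] R0] by (simp add: not_less[symmetric])
  qed
  show "AE x in lborel. lev \<xi> < \<rho> x \<longleftrightarrow> lev x < Tr \<rho> \<xi>"
    using AE_lborel_singleton[of "0::real^3"] AE_norm_neq[of R]
  proof eventually_elim
    fix x :: "real^3" assume x: "x \<noteq> 0" "norm x \<noteq> R"
    show "lev \<xi> < \<rho> x \<longleftrightarrow> lev x < Tr \<rho> \<xi>"
      unfolding R using in_le[OF x(1)] out_ge[OF x(1)] x(2) by fastforce
  qed
qed

text \<open>Duality being symmetric, the slices of \<open>Tr \<rho>\<close> are again centred balls,
  so the bathtub inequality becomes an equality and no kinetic energy is lost; on such densities the
  transform is an involution.\<close>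

theorem Tr_radially_decreasing:
  assumes \<rho>: "\<rho> \<in> densities" and rad: "radially_decreasing \<rho>"
  shows "Tr \<rho> \<in> momenta" "integral\<^sup>L lborel (Tr \<rho>) = integral\<^sup>L lborel \<rho>" "EmTF (Tr \<rho>) = mx.En \<rho>"
    "AE x in lborel. \<rho> x = Tr (Tr \<rho>) x"
proof -
  note d = densitiesD[OF \<rho>]
  note [measurable] = d(1)
  have [measurable]: "Tr \<rho> \<in> borel_measurable borel" by measurable
  have pd: "phase_dual \<rho> (Tr \<rho>)" by (rule phase_dual_of_radially_decreasing[OF \<rho> rad])
  show mass: "integral\<^sup>L lborel (Tr \<rho>) = integral\<^sup>L lborel \<rho>" by (rule Tr_mass(2)[OF d(1-3)])
  show inv: "AE x in lborel. \<rho> x = Tr (Tr \<rho>) x"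
    by (rule phase_dual_imp_Tr[OF _ _ d(2) pd]) measurable
  have pd': "AE x in lborel. AE \<xi> in lborel. lev x < Tr \<rho> \<xi> \<longleftrightarrow> lev \<xi> < \<rho> x"
    using phase_dual_sym[OF _ _ pd] unfolding phase_dual_def by simp
  have "(\<integral>\<^sup>+\<xi>. ennreal ((norm \<xi>)\<^sup>2 * Tr \<rho> \<xi>) \<partial>lborel)
      = (\<integral>\<^sup>+x. ennreal kap * (\<integral>\<^sup>+\<xi>. ennreal ((norm \<xi>)\<^sup>2) * occ (Tr \<rho>) x \<xi> \<partial>lborel) \<partial>lborel)"
    by (rule nn_kinetic_layers) (auto simp: Tr_nonneg)
  also have "\<dots> = (\<integral>\<^sup>+x. ennreal (3/5 * \<gamma> * \<rho> x powr (5/3)) \<partial>lborel)"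
  proof (rule nn_integral_cong_AE)
    show "AE x in lborel. ennreal kap * (\<integral>\<^sup>+\<xi>. ennreal ((norm \<xi>)\<^sup>2) * occ (Tr \<rho>) x \<xi> \<partial>lborel) = ennreal (3/5 * \<gamma> * \<rho> x powr (5/3))"
      using pd'
    proof eventually_elim
      fix x assume *: "AE \<xi> in lborel. lev x < Tr \<rho> \<xi> \<longleftrightarrow> lev \<xi> < \<rho> x"
      have "(\<integral>\<^sup>+\<xi>. ennreal ((norm \<xi>)\<^sup>2) * occ (Tr \<rho>) x \<xi> \<partial>lborel)
          = (\<integral>\<^sup>+\<xi>. ennreal ((norm \<xi>)\<^sup>2) * indicator {\<xi>. lev \<xi> < \<rho> x} \<xi> \<partial>lborel)"
        using * by (intro nn_integral_cong_AE, eventually_elim) (simp add: occ_def indicator_def)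
      also have "\<dots> = ennreal (3/5 * \<gamma> * \<rho> x powr (5/3) / kap)" by (rule nn_integral_norm_square_lev[OF d(2)])
      finally show "ennreal kap * (\<integral>\<^sup>+\<xi>. ennreal ((norm \<xi>)\<^sup>2) * occ (Tr \<rho>) x \<xi> \<partial>lborel) = ennreal (3/5 * \<gamma> * \<rho> x powr (5/3))"
        using gamma_pos by (simp only:) (rule ennreal_kap_cancel, simp)
    qed
  qed
  also have "\<dots> = ennreal (3/5 * \<gamma> * (\<integral>x. \<rho> x powr (5/3) \<partial>lborel))"
    using nn_integral_eq_integral[of lborel "\<lambda>x. 3/5 * \<gamma> * \<rho> x powr (5/3)"] d(4) gamma_pos by simp
  finally have kin: "(\<integral>\<^sup>+\<xi>. ennreal ((norm \<xi>)\<^sup>2 * Tr \<rho> \<xi>) \<partial>lborel) = ennreal (3/5 * \<gamma> * (\<integral>x. \<rho> x powr (5/3) \<partial>lborel))" .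
  have int2: "integrable lborel (\<lambda>\<xi>. (norm \<xi>)\<^sup>2 * Tr \<rho> \<xi>)"
    by (rule integrableI_nonneg) (use kin Tr_nonneg in auto)
  show mom: "Tr \<rho> \<in> momenta"
    unfolding momenta_def using Tr_nonneg Tr_mass(1)[OF d(1-3)] int2 by auto
  have I0: "0 \<le> (\<integral>x. \<rho> x powr (5/3) \<partial>lborel)" by (intro integral_nonneg_AE) simp
  have kin': "(\<integral>\<xi>. (norm \<xi>)\<^sup>2 * Tr \<rho> \<xi> \<partial>lborel) = 3/5 * \<gamma> * (\<integral>x. \<rho> x powr (5/3) \<partial>lborel)"
    using kin gamma_pos Tr_nonneg I0 by (subst integral_eq_nn_integral) auto
  have T: "Tr (Tr \<rho>) \<in> densities" by (rule Tr_kinetic(1)[OF mom])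
  note [measurable] = densitiesD(1)[OF T]
  have "(\<integral>x. Tr (Tr \<rho>) x powr (5/3) \<partial>lborel) = (\<integral>x. \<rho> x powr (5/3) \<partial>lborel)"
    using inv by (intro integral_cong_AE) (auto elim: eventually_mono)
  moreover have "mx.En (Tr (Tr \<rho>)) = mx.En \<rho>" by (rule mx.En_cong_AE[OF inv \<rho> T, symmetric])
  ultimately show "EmTF (Tr \<rho>) = mx.En \<rho>" unfolding EmTF_eq[OF mom] kin' by simp
qed

section \<open>Ground states\<close>

text \<open>Height s^3 on a ball of radius l / s carries a mass independent of s, while its kinetic
  and repulsive costs are O(s) and its attraction only helps. The sum is still radially decreasing,
  so its Coulomb energy and the momentum energy of its transform both equal its max-kernel
  energy.\<close>

lemma spread_out:
  assumes \<rho>: "\<rho> \<in> densities" and rad: "radially_decreasing \<rho>" and mass: "integral\<^sup>L lborel \<rho> < N" and \<delta>: "0 < \<delta>"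
  obtains \<sigma> where "\<sigma> \<in> densities" "radially_decreasing \<sigma>" "integral\<^sup>L lborel \<sigma> = N" "mx.En \<sigma> \<le> mx.En \<rho> + \<delta>"
proof -
  define l where "l = ((N - integral\<^sup>L lborel \<rho>) / (4/3 * pi)) powr (1/3)"
  have l: "0 < l" using mass by (simp add: l_def)
  have l3: "4/3 * pi * l ^ 3 = N - integral\<^sup>L lborel \<rho>"
    using powr_third_powers(3)[of "(N - integral\<^sup>L lborel \<rho>) / (4/3 * pi)"] mass unfolding l_def by simp
  have N: "0 < N" using mass densitiesD(5)[OF \<rho>] by simp
  \<comment> \<open>The cost per unit of s: N \<gamma> from the kinetic energy, 2 pi l^2 N from the
    potential of the added layer.\<close>
  define c where "c = N * (\<gamma> + 2 * pi * l\<^sup>2)"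
  have c: "0 < c" unfolding c_def using N gamma_pos by (intro mult_pos_pos add_pos_nonneg) auto
  define s where "s = min 1 (\<delta> / c)"
  have s: "0 < s" "s \<le> 1" using \<delta> c by (auto simp: s_def)
  have sc: "s * c \<le> \<delta>" using c by (simp add: s_def min_def field_simps)
  define R where "R = l / s"
  have R: "0 < R" using l s by (simp add: R_def)
  define B where "B = {x::real^3. norm x < R}"
  have B[measurable]: "B \<in> sets borel" unfolding B_def by measurable
  have Bvol: "emeasure lborel B = ennreal (4/3 * pi * R ^ 3)" unfolding B_def using R by (intro emeasure_norm_less) simp
  define h where "h = (\<lambda>x. s ^ 3 * indicator B x)"
  have h: "h \<in> densities" unfolding h_def using Bvol s by (intro densities_indicator B) auto
  have hI: "integral\<^sup>L lborel h = N - integral\<^sup>L lborel \<rho>"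
  proof -
    have "integral\<^sup>L lborel h = s ^ 3 * measure lborel B" by (simp add: h_def)
    also have "measure lborel B = 4/3 * pi * R ^ 3" using Bvol R by (simp add: measure_def)
    also have "s ^ 3 * (4/3 * pi * R ^ 3) = 4/3 * pi * l ^ 3" using s by (simp add: R_def power_divide)
    finally show ?thesis by (simp only: l3)
  qed
  note [measurable] = densitiesD(1)[OF \<rho>] densitiesD(1)[OF h]
  define \<sigma> where "\<sigma> = (\<lambda>x. 1 * \<rho> x + 1 * h x)"
  have \<sigma>: "\<sigma> \<in> densities" unfolding \<sigma>_def by (rule densities_comb[OF \<rho> h]) auto
  have \<sigma>I: "integral\<^sup>L lborel \<sigma> = N"
    unfolding \<sigma>_def using densitiesD(3)[OF \<rho>] densitiesD(3)[OF h] hI by simp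
  have \<sigma>rad: "radially_decreasing \<sigma>"
    unfolding radially_decreasing_def
  proof (intro allI impI)
    fix x y :: "real^3" assume xy: "x \<noteq> 0" "norm x \<le> norm y"
    have "\<rho> y \<le> \<rho> x" using rad xy unfolding radially_decreasing_def by blast
    moreover have "h y \<le> h x" using xy s by (auto simp: h_def B_def indicator_def)
    ultimately show "\<sigma> y \<le> \<sigma> x" by (simp add: \<sigma>_def)
  qed
  have kin: "(\<integral>x. \<sigma> x powr (5/3) \<partial>lborel) - (\<integral>x. \<rho> x powr (5/3) \<partial>lborel) \<le> 5/3 * (s * N)"
  proof -
    have "(\<integral>x. \<sigma> x powr (5/3) \<partial>lborel) - (\<integral>x. \<rho> x powr (5/3) \<partial>lborel) = (\<integral>x. \<sigma> x powr (5/3) - \<rho> x powr (5/3) \<partial>lborel)"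
      using densitiesD(4)[OF \<rho>] densitiesD(4)[OF \<sigma>] by simp
    also have "\<dots> \<le> (\<integral>x. 5/3 * s * \<sigma> x \<partial>lborel)"
    proof (rule integral_mono)
      fix x
      have nn: "0 \<le> \<sigma> x" "0 \<le> \<rho> x" using densitiesD(2) \<sigma> \<rho> by auto
      have "\<sigma> x powr (5/3) + 5/3 * \<sigma> x powr (2/3) * (\<rho> x - \<sigma> x) \<le> \<rho> x powr (5/3)"
        by (rule five_thirds_tangent[OF nn])
      moreover have "\<rho> x - \<sigma> x = - h x" by (simp add: \<sigma>_def)
      ultimately have 1: "\<sigma> x powr (5/3) - \<rho> x powr (5/3) \<le> 5/3 * (\<sigma> x powr (2/3) * h x)" by simp
      \<comment> \<open>On the ball \<sigma> \<ge> s^3, so t = \<sigma>^(1/3) is at least s \<ge>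
        s^2, and therefore t^2 s^3 \<le> s t^3.\<close>
      have 2: "\<sigma> x powr (2/3) * h x \<le> s * \<sigma> x"
      proof (cases "x \<in> B")
        case True
        define t where "t = \<sigma> x powr (1/3)"
        have \<sigma>3: "\<sigma> x = t ^ 3" "\<sigma> x powr (2/3) = t\<^sup>2" using powr_third_powers[OF nn(1)] by (simp_all add: t_def)
        have "s ^ 3 \<le> t ^ 3" using True nn unfolding \<sigma>3(1)[symmetric] by (simp add: \<sigma>_def h_def)
        moreover have t0: "0 \<le> t" by (simp add: t_def)
        ultimately have st: "s \<le> t" using cube_less_iff[of t s] s by (simp add: not_less[symmetric])
        have "s\<^sup>2 \<le> 1 * t" using s st by (simp add: power2_eq_square) (metis mult_left_le_one_le mult_mono less_imp_le order_trans mult.commute)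
        hence "t\<^sup>2 * s * s\<^sup>2 \<le> t\<^sup>2 * s * t" using s by (intro mult_left_mono) auto
        hence le: "t\<^sup>2 * s ^ 3 \<le> s * t ^ 3" by (simp add: power2_eq_square power3_eq_cube mult_ac)
        have "\<sigma> x powr (2/3) * h x = t\<^sup>2 * s ^ 3" unfolding \<sigma>3(2) using True by (simp add: h_def)
        thus ?thesis using le unfolding \<sigma>3(1)[symmetric] by simp
      next
        case False
        thus ?thesis using nn s by (simp add: h_def)
      qed
      show "\<sigma> x powr (5/3) - \<rho> x powr (5/3) \<le> 5/3 * s * \<sigma> x" using 1 2 by argo
    qed (use densitiesD(3,4)[OF \<sigma>] densitiesD(4)[OF \<rho>] in auto)
    also have "\<dots> = 5/3 * (s * N)" using \<sigma>I by simp
    finally show ?thesis .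
  qed
  have pot_h: "mx.pot h x \<le> 2 * pi * l\<^sup>2 * s" for x
  proof -
    have "ennreal (mx.pot h x) = (\<integral>\<^sup>+y. ennreal (kmax x y * h y) \<partial>lborel)" by (rule mx.nn_pot[OF h, symmetric])
    also have "\<dots> \<le> (\<integral>\<^sup>+y. ennreal (s ^ 3) * (ennreal (1 / norm y) * indicator B y) \<partial>lborel)"
    proof (rule nn_integral_mono_AE, rule AE_mp[OF AE_lborel_singleton[of 0]], rule AE_I2, rule impI)
      fix y :: "real^3" assume "y \<noteq> 0"
      hence "kmax x y \<le> 1 / norm y" unfolding kmax_def by (intro frac_le) auto
      hence "kmax x y * s ^ 3 \<le> s ^ 3 * (1 / norm y)" using s by (subst mult.commute) (intro mult_left_mono, auto)
      hence "ennreal (kmax x y * s ^ 3) \<le> ennreal (s ^ 3) * ennreal (1 / norm y)"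
        using s by (subst ennreal_mult'[symmetric]) (auto intro: ennreal_leI)
      thus "ennreal (kmax x y * h y) \<le> ennreal (s ^ 3) * (ennreal (1 / norm y) * indicator B y)"
        by (cases "y \<in> B") (simp_all add: h_def)
    qed
    also have "\<dots> = ennreal (s ^ 3) * ennreal (2 * pi * R\<^sup>2)"
      unfolding B_def using R by (subst nn_integral_cmult) (simp_all add: nn_integral_inverse_norm_ball)
    also have "\<dots> = ennreal (s ^ 3 * (2 * pi * R\<^sup>2))" using s by (intro ennreal_mult'[symmetric]) simp
    also have "s ^ 3 * (2 * pi * R\<^sup>2) = 2 * pi * l\<^sup>2 * s"
      using s by (simp add: R_def power_divide power2_eq_square power3_eq_cube)
    finally show ?thesis using s by (subst (asm) ennreal_le_iff) simp_all
  qed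
  have Qh: "mx.Q f h \<le> 2 * pi * l\<^sup>2 * s * integral\<^sup>L lborel f" if f: "f \<in> densities" for f
  proof -
    have "mx.Q f h \<le> (\<integral>x. f x * (2 * pi * l\<^sup>2 * s) \<partial>lborel)"
      unfolding mx.Q_def using pot_h densitiesD[OF f]
      by (intro integral_mono mx.integrable_mult_pot h mult_left_mono) auto
    thus ?thesis by (simp add: mult.commute)
  qed
  have "mx.Q \<sigma> \<sigma> = mx.Q \<rho> \<rho> + 2 * mx.Q \<rho> h + mx.Q h h"
    unfolding \<sigma>_def mx.Q_comb[OF \<rho> h] by simp
  hence "1/2 * mx.Q \<sigma> \<sigma> - 1/2 * mx.Q \<rho> \<rho> \<le> 2 * pi * l\<^sup>2 * s * integral\<^sup>L lborel \<rho> + 2 * pi * l\<^sup>2 * s * integral\<^sup>L lborel h"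
    using Qh[OF \<rho>] Qh[OF h] mx.Q_nonneg[OF h h] by argo
  also have "\<dots> = 2 * pi * l\<^sup>2 * s * N" unfolding hI by (simp add: distrib_left[symmetric])
  finally have Q: "1/2 * mx.Q \<sigma> \<sigma> - 1/2 * mx.Q \<rho> \<rho> \<le> 2 * pi * l\<^sup>2 * s * N" .
  have "0 \<le> (\<integral>x. Z / norm x * h x \<partial>lborel)" using Z_pos densitiesD(2)[OF h] by (intro integral_nonneg_AE) simp
  moreover have "(\<integral>x. Z / norm x * \<sigma> x \<partial>lborel) = 1 * (\<integral>x. Z / norm x * \<rho> x \<partial>lborel) + 1 * (\<integral>x. Z / norm x * h x \<partial>lborel)"
    unfolding \<sigma>_def by (rule mx.attraction_comb[OF \<rho> h])
  moreover have "3/5 * \<gamma> * ((\<integral>x. \<sigma> x powr (5/3) \<partial>lborel) - (\<integral>x. \<rho> x powr (5/3) \<partial>lborel)) \<le> 3/5 * \<gamma> * (5/3 * (s * N))"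
    using kin gamma_pos by (intro mult_left_mono) auto
  moreover have "3/5 * \<gamma> * (5/3 * (s * N)) + 2 * pi * l\<^sup>2 * s * N = s * c" by (simp add: c_def algebra_simps)
  ultimately have "mx.En \<sigma> \<le> mx.En \<rho> + \<delta>" using Q sc unfolding mx.En_def right_diff_distrib by argo
  thus ?thesis using that \<sigma> \<sigma>rad \<sigma>I by blast
qed

text \<open>The energy of \<tau> splits into that of \<open>Tr \<tau>\<close> and a kinetic excess.
  If the total is minimal both bounds are attained: the first identifies \<open>Tr \<tau>\<close>
  with \<rho> by uniqueness, the second makes \<tau> dual to \<open>Tr \<tau>\<close>, so \<tau> is
  recovered as the transform of \<rho>.\<close>

lemma Tr_lower_bound:
  assumes min: "\<And>\<sigma>. \<sigma> \<in> densities_le N \<Longrightarrow> mx.En \<rho> \<le> mx.En \<sigma>" and \<rho>: "\<rho> \<in> densities_le N"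
    and \<tau>: "\<tau> \<in> momenta" "integral\<^sup>L lborel \<tau> \<le> N"
  shows "mx.En \<rho> \<le> EmTF \<tau>" "EmTF \<tau> \<le> mx.En \<rho> \<Longrightarrow> AE \<xi> in lborel. \<tau> \<xi> = Tr \<rho> \<xi>"
proof -
  note m = momentaD[OF \<tau>(1)] and k = Tr_kinetic[OF \<tau>(1)]
  note [measurable] = m(1)
  have T: "Tr \<tau> \<in> densities_le N" using k(1) Tr_mass(2)[OF m(1-3)] \<tau>(2) by (simp add: densities_le_def)
  show "mx.En \<rho> \<le> EmTF \<tau>" using min[OF T] k(2) unfolding EmTF_eq[OF \<tau>(1)] by argo
  assume le: "EmTF \<tau> \<le> mx.En \<rho>"
  have 1: "mx.En (Tr \<tau>) \<le> mx.En \<rho>" using le k(2) unfolding EmTF_eq[OF \<tau>(1)] by argo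
  have 2: "3/5 * \<gamma> * (\<integral>x. Tr \<tau> x powr (5/3) \<partial>lborel) = (\<integral>\<xi>. (norm \<xi>)\<^sup>2 * \<tau> \<xi> \<partial>lborel)"
    using le k(2) min[OF T] unfolding EmTF_eq[OF \<tau>(1)] by argo
  have "AE x in lborel. Tr \<tau> x = \<rho> x" by (rule mx.minimizer_unique[OF \<rho> _ T 1]) (rule min)
  hence "Tr (Tr \<tau>) = Tr \<rho>"
    using \<rho> k(1) densitiesD(1) by (intro Tr_cong_AE) (auto simp: densities_le_def)
  moreover have "AE \<xi> in lborel. \<tau> \<xi> = Tr (Tr \<tau>) \<xi>"
    by (rule phase_dual_imp_Tr[OF _ _ m(2) k(3)[OF 2]]) measurable
  ultimately show "AE \<xi> in lborel. \<tau> \<xi> = Tr \<rho> \<xi>" by simp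
qed

section \<open>Fermi radii of radially decreasing densities\<close>

definition fermi_set :: "(real^3 \<Rightarrow> real) \<Rightarrow> real \<Rightarrow> real set" where
  "fermi_set \<rho> s = {R. 0 \<le> R \<and> (AE y in lborel. norm y > R \<longrightarrow> w * \<rho> y powr (1/3) < s)}"

text \<open>Radial monotonicity turns the almost-everywhere condition in \<open>fermi_set\<close>
  into a pointwise one on either side of the infimum.\<close>

lemma fermi_set_Inf:
  assumes \<rho>: "\<rho> \<in> densities" and rad: "radially_decreasing \<rho>" and s: "0 < s"
  shows "0 \<le> Inf (fermi_set \<rho> s)"
    and "y \<noteq> 0 \<Longrightarrow> norm y < Inf (fermi_set \<rho> s) \<Longrightarrow> s \<le> w * \<rho> y powr (1/3)"
    and "Inf (fermi_set \<rho> s) < norm y \<Longrightarrow> w * \<rho> y powr (1/3) < s"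
proof -
  note [measurable] = densitiesD(1)[OF \<rho>]
  have bdd: "bdd_below (fermi_set \<rho> s)" by (rule bdd_belowI[of _ 0]) (simp add: fermi_set_def)
  have dec: "w * \<rho> z powr (1/3) < s" if "y \<noteq> 0" "norm y \<le> norm z" "w * \<rho> y powr (1/3) < s" for y z
  proof -
    have "\<rho> z \<le> \<rho> y" using rad that unfolding radially_decreasing_def by blast
    hence "w * \<rho> z powr (1/3) \<le> w * \<rho> y powr (1/3)"
      using w_pos densitiesD(2)[OF \<rho>] by (intro mult_left_mono powr_mono2) auto
    thus ?thesis using that by simp
  qed
  have mem: "norm y \<in> fermi_set \<rho> s" if "y \<noteq> 0" "w * \<rho> y powr (1/3) < s" for y
    unfolding fermi_set_def using dec[OF that(1) _ that(2)] by (auto intro!: AE_I2)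
  have ne: "fermi_set \<rho> s \<noteq> {}"
  proof -
    \<comment> \<open>Half of s leaves room for the strict inequality in
      \<open>lev x < \<rho> y\<close>. If no y were below the threshold s, the superlevel set at
      this positive level would fill the whole space.\<close>
    define x where "x = (s / 2) *\<^sub>R (axis 1 1 :: real^3)"
    have x: "x \<noteq> 0" and nx: "norm x = s / 2" using s by (simp_all add: x_def)
    have fin: "emeasure lborel {y. lev x < \<rho> y} < \<infinity>"
      using nn_Tr(1)[OF densitiesD(1-3)[OF \<rho>] x] by simp
    have "\<exists>y. y \<noteq> 0 \<and> w * \<rho> y powr (1/3) < s"
    proof (rule ccontr)
      assume no: "\<not> ?thesis"
      have ge: "lev x < \<rho> y" if "y \<noteq> 0" for y
      proof -
        have "s \<le> w * \<rho> y powr (1/3)" using no that by (meson not_le)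
        thus ?thesis unfolding lev_less_iff[OF densitiesD(2)[OF \<rho>]] nx using s by linarith
      qed
      have "AE y in lborel. lev x < \<rho> y"
        by (rule AE_mp[OF AE_lborel_singleton[of 0]], rule AE_I2) (simp add: ge)
      hence "emeasure lborel {y. lev x < \<rho> y} = emeasure lborel (UNIV :: (real^3) set)"
        by (intro emeasure_eq_AE) auto
      thus False using fin by simp
    qed
    thus ?thesis using mem by blast
  qed
  show r0: "0 \<le> Inf (fermi_set \<rho> s)" using ne by (intro cInf_greatest) (auto simp: fermi_set_def)
  show "s \<le> w * \<rho> y powr (1/3)" if "y \<noteq> 0" "norm y < Inf (fermi_set \<rho> s)"
  proof (rule ccontr)
    assume "\<not> s \<le> w * \<rho> y powr (1/3)"
    hence "norm y \<in> fermi_set \<rho> s" using mem[OF that(1)] by simp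
    from cInf_lower[OF this bdd] show False using that by simp
  qed
  show "w * \<rho> y powr (1/3) < s" if y: "Inf (fermi_set \<rho> s) < norm y"
  proof -
    from cInf_lessD[OF ne y] obtain R where R: "R \<in> fermi_set \<rho> s" "R < norm y" by blast
    hence R0: "0 \<le> R" and AE: "AE z in lborel. norm z > R \<longrightarrow> w * \<rho> z powr (1/3) < s" by (auto simp: fermi_set_def)
    \<comment> \<open>The shell between R and |y| has positive volume, so it contains a point where
      the almost-everywhere condition holds, and monotonicity carries it out to y.\<close>
    have "\<exists>z. R < norm z \<and> norm z < norm y \<and> w * \<rho> z powr (1/3) < s"
    proof (rule ccontr)
      assume no: "\<not> ?thesis"
      have "emeasure lborel {z::real^3. norm z < norm y} \<le> emeasure lborel {z::real^3. norm z < R}"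
      proof (rule emeasure_mono_AE)
        show "AE z in lborel. z \<in> {z::real^3. norm z < norm y} \<longrightarrow> z \<in> {z. norm z < R}"
          using AE AE_norm_neq[of R] by eventually_elim (use no in force)
      qed measurable
      hence "ennreal (4/3 * pi * norm y ^ 3) \<le> ennreal (4/3 * pi * R ^ 3)"
        by (simp only: emeasure_norm_less R0 norm_ge_zero)
      hence "4/3 * pi * norm y ^ 3 \<le> 4/3 * pi * R ^ 3" using R0 by (subst (asm) ennreal_le_iff) simp_all
      hence "norm y ^ 3 \<le> R ^ 3" by simp
      thus False using cube_less_iff[OF R0 norm_ge_zero[of y]] R(2) by simp
    qed
    then obtain z where "R < norm z" "norm z < norm y" "w * \<rho> z powr (1/3) < s" by blast
    moreover from this have "z \<noteq> 0" using R0 by auto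
    ultimately show ?thesis by (intro dec[of z y]) auto
  qed
qed

end

lemma Inf_eq_approx:
  fixes X :: "real set"
  assumes lower: "\<And>x. x \<in> X \<Longrightarrow> e \<le> x" and approx: "\<And>\<delta>. 0 < \<delta> \<Longrightarrow> \<exists>x\<in>X. x \<le> e + \<delta>"
  shows "Inf X = e"
proof (rule antisym)
  have "bdd_below X" using lower by (rule bdd_belowI)
  show "Inf X \<le> e"
  proof (rule field_le_epsilon)
    fix \<delta> :: real assume "0 < \<delta>"
    then obtain x where "x \<in> X" "x \<le> e + \<delta>" using approx by blast
    thus "Inf X \<le> e + \<delta>" using cInf_lower[OF _ \<open>bdd_below X\<close>] by (meson order_trans)
  qed
  have "X \<noteq> {}" using approx[of 1] by auto
  thus "e \<le> Inf X" using lower by (rule cInf_greatest)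
qed

locale tf_physical =
  fixes q :: nat and Z :: real
  assumes q_pos: "0 < q" and nuclear_pos: "0 < Z"

sublocale tf_physical \<subseteq> tf_atom "gammaTF q" Z
  by standard (use q_pos nuclear_pos in \<open>auto simp: gammaTF_def\<close>)

context tf_physical
begin

lemma gamma_powr: "gammaTF q powr (-1/2) = 1 / w" "gammaTF q powr (-3/2) = 1 / w ^ 3"
proof -
  have w: "w = gammaTF q powr (1/2)" using gamma_pos by (simp add: w_def powr_half_sqrt)
  have w3: "w ^ 3 = gammaTF q powr (3/2)"
  proof -
    have "w ^ 3 = w powr 3" using w_pos by simp
    also have "\<dots> = gammaTF q powr (1/2 * 3)" unfolding w by (rule powr_powr)
    finally show ?thesis by simp
  qed
  show "gammaTF q powr (-1/2) = 1 / w"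
    unfolding w using powr_minus[of "gammaTF q" "1/2"] by (simp add: field_simps)
  show "gammaTF q powr (-3/2) = 1 / w ^ 3"
    unfolding w3 using powr_minus[of "gammaTF q" "3/2"] by (simp add: field_simps)
qed

section \<open>Passage from the given function classes to nonnegative representatives\<close>

lemma densities_I_set:
  assumes "\<rho> \<in> densities"
  shows "\<rho> \<in> I_set"
  using densitiesD[OF assms] by (simp add: I_set_def)

lemma I_set_abs:
  assumes "\<rho> \<in> I_set"
  shows "(\<lambda>x. \<bar>\<rho> x\<bar>) \<in> densities" "AE x in lborel. \<rho> x = \<bar>\<rho> x\<bar>" "(\<integral>x. \<bar>\<rho> x\<bar> \<partial>lborel) = integral\<^sup>L lborel \<rho>"
proof -
  have i: "integrable lborel \<rho>" "integrable lborel (\<lambda>x. \<bar>\<rho> x\<bar> powr (5/3))" "AE x in lborel. 0 \<le> \<rho> x"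
    using assms by (auto simp: I_set_def)
  have [measurable]: "\<rho> \<in> borel_measurable borel" using i(1) by auto
  show "(\<lambda>x. \<bar>\<rho> x\<bar>) \<in> densities" using i by (simp add: densities_def)
  show eq: "AE x in lborel. \<rho> x = \<bar>\<rho> x\<bar>" using i(3) by eventually_elim simp
  show "(\<integral>x. \<bar>\<rho> x\<bar> \<partial>lborel) = integral\<^sup>L lborel \<rho>"
    using i(3) by (intro integral_cong_AE) (auto elim: eventually_mono)
qed

lemma E_TF_eq:
  assumes \<rho>: "\<rho> \<in> I_set"
  shows "E_TF q Z \<rho> = cl.En (\<lambda>x. \<bar>\<rho> x\<bar>)"
proof -
  note a = I_set_abs[OF \<rho>]
  have [measurable]: "\<rho> \<in> borel_measurable borel" using \<rho> by (auto simp: I_set_def)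
  have "(\<integral>x. \<rho> x powr (5/3) \<partial>lborel) = (\<integral>x. \<bar>\<rho> x\<bar> powr (5/3) \<partial>lborel)"
    using a(2) by (intro integral_cong_AE) (auto elim: eventually_mono)
  moreover have "(\<integral>x. Z / norm x * \<rho> x \<partial>lborel) = (\<integral>x. Z / norm x * \<bar>\<rho> x\<bar> \<partial>lborel)"
    using a(2) by (intro integral_cong_AE) (auto elim: eventually_mono)
  moreover have "(\<integral>p. \<rho> (fst p) * \<rho> (snd p) / norm (fst p - snd p) \<partial>(lborel \<Otimes>\<^sub>M lborel))
      = cl.Q (\<lambda>x. \<bar>\<rho> x\<bar>) (\<lambda>x. \<bar>\<rho> x\<bar>)"
    unfolding cl.Q_pair(2)[OF a(1) a(1), symmetric]
  proof (rule integral_cong_AE)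
    show "AE p in lborel \<Otimes>\<^sub>M lborel. \<rho> (fst p) * \<rho> (snd p) / norm (fst p - snd p)
        = \<bar>\<rho> (fst p)\<bar> * (kcoul (fst p) (snd p) * \<bar>\<rho> (snd p)\<bar>)"
      using AE_lborel_fst[OF a(2)] AE_lborel_snd[OF a(2)]
    proof eventually_elim
      fix p :: "(real^3) \<times> (real^3)"
      assume e: "\<rho> (fst p) = \<bar>\<rho> (fst p)\<bar>" "\<rho> (snd p) = \<bar>\<rho> (snd p)\<bar>"
      have "\<rho> (fst p) * \<rho> (snd p) / norm (fst p - snd p) = \<rho> (fst p) * (kcoul (fst p) (snd p) * \<rho> (snd p))"
        by (simp add: kcoul_def)
      thus "\<rho> (fst p) * \<rho> (snd p) / norm (fst p - snd p) = \<bar>\<rho> (fst p)\<bar> * (kcoul (fst p) (snd p) * \<bar>\<rho> (snd p)\<bar>)"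
        by (simp only: e[symmetric])
    qed
  qed (unfold kcoul_def, measurable)
  ultimately show ?thesis by (simp add: E_TF_def cl.En_def)
qed

lemma E_TF_densities: "\<rho> \<in> densities \<Longrightarrow> E_TF q Z \<rho> = cl.En \<rho>"
  using E_TF_eq[OF densities_I_set, of \<rho>] densitiesD(2)[of \<rho>] by simp

lemma momenta_J_set:
  assumes "\<tau> \<in> momenta"
  shows "\<tau> \<in> J_set"
  using momentaD[OF assms] by (simp add: J_set_def distrib_right)

lemma J_set_abs:
  assumes "\<tau> \<in> J_set"
  shows "(\<lambda>\<xi>. \<bar>\<tau> \<xi>\<bar>) \<in> momenta" "AE \<xi> in lborel. \<tau> \<xi> = \<bar>\<tau> \<xi>\<bar>" "(\<integral>\<xi>. \<bar>\<tau> \<xi>\<bar> \<partial>lborel) = integral\<^sup>L lborel \<tau>"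
proof -
  have i: "\<tau> \<in> borel_measurable borel" "integrable lborel (\<lambda>\<xi>. (1 + (norm \<xi>)\<^sup>2) * \<tau> \<xi>)" "AE \<xi> in lborel. 0 \<le> \<tau> \<xi>"
    using assms by (auto simp: J_set_def)
  note [measurable] = i(1)
  have "integrable lborel (\<lambda>\<xi>. \<bar>\<tau> \<xi>\<bar>)"
  proof (rule Bochner_Integration.integrable_bound[OF i(2)])
    show "AE \<xi> in lborel. norm \<bar>\<tau> \<xi>\<bar> \<le> norm ((1 + (norm \<xi>)\<^sup>2) * \<tau> \<xi>)"
    proof (rule AE_I2)
      fix \<xi>
      have "1 * \<bar>\<tau> \<xi>\<bar> \<le> (1 + (norm \<xi>)\<^sup>2) * \<bar>\<tau> \<xi>\<bar>" by (intro mult_right_mono) auto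
      thus "norm \<bar>\<tau> \<xi>\<bar> \<le> norm ((1 + (norm \<xi>)\<^sup>2) * \<tau> \<xi>)" by (simp add: abs_mult)
    qed
  qed measurable
  moreover have "integrable lborel (\<lambda>\<xi>. (norm \<xi>)\<^sup>2 * \<bar>\<tau> \<xi>\<bar>)"
  proof (rule Bochner_Integration.integrable_bound[OF i(2)])
    show "AE \<xi> in lborel. norm ((norm \<xi>)\<^sup>2 * \<bar>\<tau> \<xi>\<bar>) \<le> norm ((1 + (norm \<xi>)\<^sup>2) * \<tau> \<xi>)"
    proof (rule AE_I2)
      fix \<xi>
      have "(norm \<xi>)\<^sup>2 * \<bar>\<tau> \<xi>\<bar> \<le> (1 + (norm \<xi>)\<^sup>2) * \<bar>\<tau> \<xi>\<bar>" by (intro mult_right_mono) auto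
      thus "norm ((norm \<xi>)\<^sup>2 * \<bar>\<tau> \<xi>\<bar>) \<le> norm ((1 + (norm \<xi>)\<^sup>2) * \<tau> \<xi>)" by (simp add: abs_mult)
    qed
  qed measurable
  ultimately show "(\<lambda>\<xi>. \<bar>\<tau> \<xi>\<bar>) \<in> momenta" by (simp add: momenta_def)
  show "AE \<xi> in lborel. \<tau> \<xi> = \<bar>\<tau> \<xi>\<bar>" using i(3) by eventually_elim simp
  show "(\<integral>\<xi>. \<bar>\<tau> \<xi>\<bar> \<partial>lborel) = integral\<^sup>L lborel \<tau>"
    using i(3) by (intro integral_cong_AE) (auto elim: eventually_mono)
qed

lemma E_mTF_cong_AE:
  assumes eq: "AE \<xi> in lborel. \<tau> \<xi> = \<sigma> \<xi>"
    and [measurable]: "\<tau> \<in> borel_measurable borel" "\<sigma> \<in> borel_measurable borel"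
  shows "E_mTF q Z \<tau> = E_mTF q Z \<sigma>"
proof -
  have "(\<integral>\<xi>. (norm \<xi>)\<^sup>2 * \<tau> \<xi> \<partial>lborel) = (\<integral>\<xi>. (norm \<xi>)\<^sup>2 * \<sigma> \<xi> \<partial>lborel)"
    using eq by (intro integral_cong_AE) (auto elim: eventually_mono)
  moreover have "(\<integral>\<xi>. \<tau> \<xi> powr (2/3) \<partial>lborel) = (\<integral>\<xi>. \<sigma> \<xi> powr (2/3) \<partial>lborel)"
    using eq by (intro integral_cong_AE) (auto elim: eventually_mono)
  moreover have "(\<integral>p. min (\<tau> (fst p)) (\<tau> (snd p)) * (max (\<tau> (fst p)) (\<tau> (snd p))) powr (2/3)
               - 1/5 * (min (\<tau> (fst p)) (\<tau> (snd p))) powr (5/3) \<partial>(lborel \<Otimes>\<^sub>M lborel))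
      = (\<integral>p. min (\<sigma> (fst p)) (\<sigma> (snd p)) * (max (\<sigma> (fst p)) (\<sigma> (snd p))) powr (2/3)
               - 1/5 * (min (\<sigma> (fst p)) (\<sigma> (snd p))) powr (5/3) \<partial>(lborel \<Otimes>\<^sub>M lborel))"
  proof (rule integral_cong_AE)
    show "AE p in lborel \<Otimes>\<^sub>M lborel. min (\<tau> (fst p)) (\<tau> (snd p)) * (max (\<tau> (fst p)) (\<tau> (snd p))) powr (2/3)
               - 1/5 * (min (\<tau> (fst p)) (\<tau> (snd p))) powr (5/3)
        = min (\<sigma> (fst p)) (\<sigma> (snd p)) * (max (\<sigma> (fst p)) (\<sigma> (snd p))) powr (2/3)
               - 1/5 * (min (\<sigma> (fst p)) (\<sigma> (snd p))) powr (5/3)"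
      using AE_lborel_fst[OF eq] AE_lborel_snd[OF eq] by eventually_elim simp
  qed measurable
  ultimately show ?thesis by (simp only: E_mTF_def)
qed

lemma E_mTF_momenta: "E_mTF q Z \<tau> = EmTF \<tau>"
  unfolding E_mTF_def EmTF_def overlap_def gamma_powr by simp

lemma E_mTF_eq:
  assumes \<tau>: "\<tau> \<in> J_set"
  shows "E_mTF q Z \<tau> = EmTF (\<lambda>\<xi>. \<bar>\<tau> \<xi>\<bar>)"
proof -
  have [measurable]: "\<tau> \<in> borel_measurable borel" using \<tau> by (auto simp: J_set_def)
  have "E_mTF q Z \<tau> = E_mTF q Z (\<lambda>\<xi>. \<bar>\<tau> \<xi>\<bar>)" by (rule E_mTF_cong_AE[OF J_set_abs(2)[OF \<tau>]]) measurable
  thus ?thesis by (simp add: E_mTF_momenta)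
qed

section \<open>The transform defined by the Fermi radius\<close>

lemma lev_le_iff:
  assumes "0 \<le> a"
  shows "lev x \<le> a \<longleftrightarrow> norm x \<le> w * a powr (1/3)"
proof -
  have "lev x \<le> a \<longleftrightarrow> (norm x / w) ^ 3 \<le> (a powr (1/3)) ^ 3"
    using powr_third_powers(3)[OF assms] by (simp add: lev_def)
  also have "\<dots> \<longleftrightarrow> norm x / w \<le> a powr (1/3)"
    using w_pos by (intro power_mono_iff) auto
  also have "\<dots> \<longleftrightarrow> norm x \<le> w * a powr (1/3)" using w_pos by (simp add: field_simps)
  finally show ?thesis .
qed

text \<open>The condition in the Fermi radius is strict, so its ball is the superlevel set with
  \<open>\<le>\<close>, in contrast to \<open>Tr\<close>. The radius is essential, so every
  representative \<open>\<rho>'\<close> gives the same value at \<xi> \<noteq> 0.\<close>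

lemma Ttrans_eq:
  assumes \<rho>: "\<rho> \<in> densities" and rad: "radially_decreasing \<rho>" and eq: "AE x in lborel. \<rho>' x = \<rho> x" and \<xi>: "\<xi> \<noteq> 0"
  shows "Ttrans q \<rho>' \<xi> = kap * measure lborel {y. lev \<xi> \<le> \<rho> y}"
proof -
  note [measurable] = densitiesD(1)[OF \<rho>]
  let ?s = "norm \<xi>"
  have s: "0 < ?s" using \<xi> by simp
  define r where "r = Inf (fermi_set \<rho> ?s)"
  have "fermi_radius q \<rho>' ?s = r"
  proof -
    have "(AE y in lborel. norm y > R \<longrightarrow> sqrt (gammaTF q) * \<bar>\<rho>' y\<bar> powr (1/3) < ?s)
        \<longleftrightarrow> (AE y in lborel. norm y > R \<longrightarrow> w * \<rho> y powr (1/3) < ?s)" for R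
    proof
      assume "AE y in lborel. norm y > R \<longrightarrow> sqrt (gammaTF q) * \<bar>\<rho>' y\<bar> powr (1/3) < ?s"
      thus "AE y in lborel. norm y > R \<longrightarrow> w * \<rho> y powr (1/3) < ?s"
        using eq by eventually_elim (simp add: w_def densitiesD(2)[OF \<rho>])
    next
      assume "AE y in lborel. norm y > R \<longrightarrow> w * \<rho> y powr (1/3) < ?s"
      thus "AE y in lborel. norm y > R \<longrightarrow> sqrt (gammaTF q) * \<bar>\<rho>' y\<bar> powr (1/3) < ?s"
        using eq by eventually_elim (simp add: w_def densitiesD(2)[OF \<rho>])
    qed
    thus ?thesis by (simp only: fermi_radius_def r_def fermi_set_def)
  qed
  hence T: "Ttrans q \<rho>' \<xi> = r ^ 3 / w ^ 3" unfolding Ttrans_def gamma_powr by simp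
  note F = fermi_set_Inf[OF \<rho> rad s, folded r_def]
  have "measure lborel {y. lev \<xi> \<le> \<rho> y} = measure lborel {y::real^3. norm y < r}"
  proof (rule measure_eq_AE)
    show "AE y in lborel. y \<in> {y. lev \<xi> \<le> \<rho> y} \<longleftrightarrow> y \<in> {y. norm y < r}"
      using AE_lborel_singleton[of "0::real^3"] AE_norm_neq[of r]
    proof eventually_elim
      fix y :: "real^3" assume y: "y \<noteq> 0" "norm y \<noteq> r"
      show "y \<in> {y. lev \<xi> \<le> \<rho> y} \<longleftrightarrow> y \<in> {y. norm y < r}"
        using F(2)[OF y(1)] F(3)[of y] y(2) lev_le_iff[OF densitiesD(2)[OF \<rho>], of \<xi> y] by fastforce
    qed
  qed measurable
  also have "\<dots> = 4/3 * pi * r ^ 3" using emeasure_norm_less[OF F(1)] F(1) by (simp add: measure_def)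
  finally have "kap * measure lborel {y. lev \<xi> \<le> \<rho> y} = kap * (4/3 * pi * r ^ 3)" by (simp only:)
  also have "\<dots> = r ^ 3 / w ^ 3" using w_pos by (simp add: kap_def)
  finally show ?thesis unfolding T by (simp only:)
qed

text \<open>The two transforms differ by the volume of the level set where \<rho> equals
  \<open>lev \<xi>\<close>, which is positive at plateaus. For fixed y the exceptional \<xi> form a
  sphere, so by Fubini plateaus are met for almost no \<xi>.\<close>

lemma Ttrans_AE_Tr:
  assumes \<rho>: "\<rho> \<in> densities" and rad: "radially_decreasing \<rho>" and eq: "AE x in lborel. \<rho>' x = \<rho> x"
  shows "AE \<xi> in lborel. Ttrans q \<rho>' \<xi> = Tr \<rho> \<xi>"
proof -
  note [measurable] = densitiesD(1)[OF \<rho>]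
  have "AE y in lborel. AE \<xi> in lborel. lev \<xi> \<noteq> \<rho> y"
  proof (rule AE_I2)
    fix y
    show "AE \<xi> in lborel. lev \<xi> \<noteq> \<rho> y"
      using AE_norm_neq[of "w * \<rho> y powr (1/3)"]
    proof eventually_elim
      fix \<xi> :: "real^3" assume "norm \<xi> \<noteq> w * \<rho> y powr (1/3)"
      thus "lev \<xi> \<noteq> \<rho> y"
        using lev_le_iff[OF densitiesD(2)[OF \<rho>], of \<xi> y] lev_less_iff[OF densitiesD(2)[OF \<rho>], of \<xi> y] by linarith
    qed
  qed
  hence "AE \<xi> in lborel. AE y in lborel. lev \<xi> \<noteq> \<rho> y"
    by (subst (asm) lborel_pair.AE_commute) measurable
  thus ?thesis using AE_lborel_singleton[of "0::real^3"]
  proof eventually_elim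
    fix \<xi> :: "real^3" assume *: "AE y in lborel. lev \<xi> \<noteq> \<rho> y" and \<xi>: "\<xi> \<noteq> 0"
    have "measure lborel {y. lev \<xi> \<le> \<rho> y} = measure lborel {y. lev \<xi> < \<rho> y}"
    proof (rule measure_eq_AE)
      show "AE y in lborel. y \<in> {y. lev \<xi> \<le> \<rho> y} \<longleftrightarrow> y \<in> {y. lev \<xi> < \<rho> y}"
        using * by eventually_elim auto
    qed measurable
    thus "Ttrans q \<rho>' \<xi> = Tr \<rho> \<xi>" using Ttrans_eq[OF \<rho> rad eq \<xi>] by (simp add: Tr_def)
  qed
qed

lemma Ttrans_measurable:
  assumes \<rho>: "\<rho> \<in> densities" and rad: "radially_decreasing \<rho>" and eq: "AE x in lborel. \<rho>' x = \<rho> x"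
  shows "Ttrans q \<rho>' \<in> borel_measurable borel"
proof -
  note [measurable] = densitiesD(1)[OF \<rho>]
  have nn: "(\<integral>\<^sup>+y. (if lev \<xi> \<le> \<rho> y then 1 else 0) \<partial>lborel) = emeasure lborel {y. lev \<xi> \<le> \<rho> y}" for \<xi>
  proof -
    have "(\<integral>\<^sup>+y. (if lev \<xi> \<le> \<rho> y then 1 else 0) \<partial>lborel) = (\<integral>\<^sup>+y. indicator {y. lev \<xi> \<le> \<rho> y} y \<partial>lborel)"
      by (intro nn_integral_cong) auto
    thus ?thesis by simp
  qed
  \<comment> \<open>At the origin the threshold is 0, no radius is admissible and the infimum is
    that of the empty set; one point does not affect measurability.\<close>
  have "Ttrans q \<rho>' = (\<lambda>\<xi>. if \<xi> = 0 then Ttrans q \<rho>' 0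
      else kap * enn2real (\<integral>\<^sup>+y. (if lev \<xi> \<le> \<rho> y then 1 else 0) \<partial>lborel))"
    by (intro ext) (simp add: Ttrans_eq[OF \<rho> rad eq] nn measure_def)
  also have "\<dots> \<in> borel_measurable borel" by measurable
  finally show ?thesis .
qed

lemma J_set_cong_AE:
  assumes \<tau>: "\<tau> \<in> momenta" and eq: "AE \<xi> in lborel. \<sigma> \<xi> = \<tau> \<xi>" and m[measurable]: "\<sigma> \<in> borel_measurable borel"
  shows "\<sigma> \<in> J_set" "integral\<^sup>L lborel \<sigma> = integral\<^sup>L lborel \<tau>" "E_mTF q Z \<sigma> = EmTF \<tau>"
proof -
  note [measurable] = momentaD(1)[OF \<tau>]
  have "integrable lborel (\<lambda>\<xi>. (1 + (norm \<xi>)\<^sup>2) * \<tau> \<xi>)"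
    using momenta_J_set[OF \<tau>] by (simp add: J_set_def)
  hence "integrable lborel (\<lambda>\<xi>. (1 + (norm \<xi>)\<^sup>2) * \<sigma> \<xi>)"
    using eq by (subst integrable_cong_AE[where g = "\<lambda>\<xi>. (1 + (norm \<xi>)\<^sup>2) * \<tau> \<xi>"]) (auto elim: eventually_mono)
  moreover have "AE \<xi> in lborel. 0 \<le> \<sigma> \<xi>" using eq by eventually_elim (simp add: momentaD(2)[OF \<tau>])
  ultimately show "\<sigma> \<in> J_set" by (simp add: J_set_def)
  show "integral\<^sup>L lborel \<sigma> = integral\<^sup>L lborel \<tau>" using eq by (intro integral_cong_AE) auto
  show "E_mTF q Z \<sigma> = EmTF \<tau>" unfolding E_mTF_momenta[symmetric] by (rule E_mTF_cong_AE[OF eq]) measurable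
qed

text \<open>One value e serves both problems, with lower bounds, rigidity and near-minimizers of
  exact mass N. For N > Z rigidity makes anything reaching e have mass Z, so within mass N the value
  is approached but not attained.\<close>

theorem ground_state:
  assumes N: "0 \<le> N"
  obtains \<rho> e where "\<rho> \<in> densities" "radially_decreasing \<rho>"
    "\<rho> \<in> I_bd (min N Z)" "E_TF q Z \<rho> = e"
    "\<And>\<sigma>. \<sigma> \<in> I_bd N \<Longrightarrow> e \<le> E_TF q Z \<sigma>"
    "\<And>\<sigma>. \<sigma> \<in> I_bd N \<Longrightarrow> E_TF q Z \<sigma> \<le> e \<Longrightarrow> AE x in lborel. \<sigma> x = \<rho> x"
    "Tr \<rho> \<in> J_bd (min N Z)" "E_mTF q Z (Tr \<rho>) = e"
    "\<And>\<tau>. \<tau> \<in> J_le N \<Longrightarrow> e \<le> E_mTF q Z \<tau>"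
    "\<And>\<tau>. \<tau> \<in> J_le N \<Longrightarrow> E_mTF q Z \<tau> \<le> e \<Longrightarrow> AE \<xi> in lborel. \<tau> \<xi> = Tr \<rho> \<xi>"
    "\<And>\<delta>. 0 < \<delta> \<Longrightarrow> \<exists>\<sigma>\<in>I_bd N. E_TF q Z \<sigma> \<le> e + \<delta>"
    "\<And>\<delta>. 0 < \<delta> \<Longrightarrow> \<exists>\<tau>\<in>J_bd N. E_mTF q Z \<tau> \<le> e + \<delta>"
proof -
  obtain \<rho> where \<rho>N: "\<rho> \<in> densities_le N" and rad: "radially_decreasing \<rho>" and mass: "integral\<^sup>L lborel \<rho> = min N Z"
    and mmin: "\<And>\<sigma>. \<sigma> \<in> densities_le N \<Longrightarrow> mx.En \<rho> \<le> mx.En \<sigma>"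
    and cmin: "\<And>\<sigma>. \<sigma> \<in> densities_le N \<Longrightarrow> cl.En \<rho> \<le> cl.En \<sigma>"
    by (rule atom_minimizer[OF N]) blast
  have \<rho>: "\<rho> \<in> densities" using \<rho>N by (simp add: densities_le_def)
  define e where "e = mx.En \<rho>"
  have ce: "cl.En \<rho> = e" unfolding e_def by (rule newton_En[OF \<rho> rad])
  note T = Tr_radially_decreasing[OF \<rho> rad]
  have abs_le: "(\<lambda>x. \<bar>\<sigma> x\<bar>) \<in> densities_le N" if "\<sigma> \<in> I_bd N" for \<sigma>
    using that I_set_abs[of \<sigma>] by (simp add: I_bd_def densities_le_def)
  have approx: "\<exists>\<sigma>. \<sigma> \<in> densities \<and> radially_decreasing \<sigma> \<and> integral\<^sup>L lborel \<sigma> = N \<and> mx.En \<sigma> \<le> e + \<delta>"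
    if \<delta>: "0 < \<delta>" for \<delta>
  proof (cases "N \<le> Z")
    case True
    thus ?thesis using \<rho> rad mass \<delta> unfolding e_def by (intro exI[of _ \<rho>]) simp
  next
    case False
    hence "integral\<^sup>L lborel \<rho> < N" using mass by simp
    from spread_out[OF \<rho> rad this \<delta>] show ?thesis unfolding e_def by metis
  qed
  show ?thesis
  proof (rule that[OF \<rho> rad])
    show "\<rho> \<in> I_bd (min N Z)" using densities_I_set[OF \<rho>] mass by (simp add: I_bd_def)
    show "E_TF q Z \<rho> = e" by (simp add: E_TF_densities[OF \<rho>] ce)
    show "e \<le> E_TF q Z \<sigma>" if "\<sigma> \<in> I_bd N" for \<sigma>
      using cmin[OF abs_le[OF that]] E_TF_eq[of \<sigma>] that ce by (simp add: I_bd_def)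
    show "AE x in lborel. \<sigma> x = \<rho> x" if \<sigma>: "\<sigma> \<in> I_bd N" "E_TF q Z \<sigma> \<le> e" for \<sigma>
    proof -
      have I: "\<sigma> \<in> I_set" using \<sigma> by (simp add: I_bd_def)
      have "AE x in lborel. \<bar>\<sigma> x\<bar> = \<rho> x"
      proof (rule cl.minimizer_unique[OF \<rho>N _ abs_le[OF \<sigma>(1)]])
        show "cl.En \<rho> \<le> cl.En s" if "s \<in> densities_le N" for s by (rule cmin[OF that])
        show "cl.En (\<lambda>x. \<bar>\<sigma> x\<bar>) \<le> cl.En \<rho>" using \<sigma>(2) E_TF_eq[OF I] ce by simp
      qed
      thus ?thesis using I_set_abs(2)[OF I] by eventually_elim simp
    qed
    show "Tr \<rho> \<in> J_bd (min N Z)" using momenta_J_set[OF T(1)] T(2) mass by (simp add: J_bd_def)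
    show "E_mTF q Z (Tr \<rho>) = e" unfolding E_mTF_momenta T(3) e_def ..
    show "e \<le> E_mTF q Z \<tau>" if \<tau>: "\<tau> \<in> J_le N" for \<tau>
    proof -
      have J: "\<tau> \<in> J_set" "integral\<^sup>L lborel \<tau> \<le> N" using \<tau> by (auto simp: J_le_def)
      have "(\<integral>\<xi>. \<bar>\<tau> \<xi>\<bar> \<partial>lborel) \<le> N" using J_set_abs(3)[OF J(1)] J(2) by simp
      from Tr_lower_bound(1)[OF mmin \<rho>N J_set_abs(1)[OF J(1)] this]
      show ?thesis unfolding E_mTF_eq[OF J(1)] e_def .
    qed
    show "AE \<xi> in lborel. \<tau> \<xi> = Tr \<rho> \<xi>" if \<tau>: "\<tau> \<in> J_le N" "E_mTF q Z \<tau> \<le> e" for \<tau>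
    proof -
      have J: "\<tau> \<in> J_set" "integral\<^sup>L lborel \<tau> \<le> N" using \<tau> by (auto simp: J_le_def)
      have "(\<integral>\<xi>. \<bar>\<tau> \<xi>\<bar> \<partial>lborel) \<le> N" using J_set_abs(3)[OF J(1)] J(2) by simp
      moreover have "EmTF (\<lambda>\<xi>. \<bar>\<tau> \<xi>\<bar>) \<le> mx.En \<rho>" using \<tau>(2) unfolding E_mTF_eq[OF J(1)] e_def .
      ultimately have "AE \<xi> in lborel. \<bar>\<tau> \<xi>\<bar> = Tr \<rho> \<xi>"
        using Tr_lower_bound(2)[OF mmin \<rho>N J_set_abs(1)[OF J(1)]] by blast
      thus ?thesis using J_set_abs(2)[OF J(1)] by eventually_elim simp
    qed
    fix \<delta> :: real assume "0 < \<delta>"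
    then obtain \<sigma> where \<sigma>: "\<sigma> \<in> densities" "radially_decreasing \<sigma>" "integral\<^sup>L lborel \<sigma> = N" "mx.En \<sigma> \<le> e + \<delta>"
      using approx by blast
    have "E_TF q Z \<sigma> \<le> e + \<delta>" using \<sigma>(4) by (simp add: E_TF_densities[OF \<sigma>(1)] newton_En[OF \<sigma>(1,2)])
    thus "\<exists>\<sigma>\<in>I_bd N. E_TF q Z \<sigma> \<le> e + \<delta>"
      using densities_I_set[OF \<sigma>(1)] \<sigma>(3) by (auto simp: I_bd_def)
    note S = Tr_radially_decreasing[OF \<sigma>(1,2)]
    have "E_mTF q Z (Tr \<sigma>) \<le> e + \<delta>" unfolding E_mTF_momenta S(3) by (rule \<sigma>(4))
    thus "\<exists>\<tau>\<in>J_bd N. E_mTF q Z \<tau> \<le> e + \<delta>"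
      using momenta_J_set[OF S(1)] S(2) \<sigma>(3) by (auto simp: J_bd_def)
  qed
qed

end

theorem theorem2:
  fixes q :: nat and Z :: real
  assumes "0 < q" and "0 < Z"
  shows "(\<forall>N::real. 0 \<le> N \<longrightarrow>
            (INF \<tau>\<in>J_bd N. E_mTF q Z \<tau>) = (INF \<rho>\<in>I_bd N. E_TF q Z \<rho>))
       \<and> (\<forall>N::real. \<forall>\<rho>m. 0 \<le> N \<and> N \<le> Z \<and> is_minimizer (E_TF q Z) (I_bd N) \<rho>m \<longrightarrow>
            is_unique_minimizer (E_mTF q Z) (J_bd N) (Ttrans q \<rho>m))
       \<and> (\<forall>N::real. Z < N \<longrightarrow> \<not> (\<exists>\<tau>. is_minimizer (E_mTF q Z) (J_bd N) \<tau>))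
       \<and> (\<forall>N::real. 0 \<le> N \<longrightarrow>
            (\<exists>\<tau>m. is_unique_minimizer (E_mTF q Z) (J_le N) \<tau>m \<and> \<tau>m \<in> J_bd (min N Z)))"
proof -
  interpret tf_physical q Z by standard (use assms in auto)
  have bd_le: "\<tau> \<in> J_le N" if "\<tau> \<in> J_bd N" for \<tau> N
    using that by (simp add: J_bd_def J_le_def)
  show ?thesis
  proof (intro conjI allI impI notI)
    fix N :: real assume N: "0 \<le> N"
    obtain \<rho> e where
      I: "\<And>\<sigma>. \<sigma> \<in> I_bd N \<Longrightarrow> e \<le> E_TF q Z \<sigma>" "\<And>\<delta>. 0 < \<delta> \<Longrightarrow> \<exists>\<sigma>\<in>I_bd N. E_TF q Z \<sigma> \<le> e + \<delta>"
      and J: "\<And>\<tau>. \<tau> \<in> J_le N \<Longrightarrow> e \<le> E_mTF q Z \<tau>" "\<And>\<delta>. 0 < \<delta> \<Longrightarrow> \<exists>\<tau>\<in>J_bd N. E_mTF q Z \<tau> \<le> e + \<delta>"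
      by (rule ground_state[OF N]) blast
    have "(INF \<tau>\<in>J_bd N. E_mTF q Z \<tau>) = e"
      by (rule Inf_eq_approx) (use J bd_le in blast)+
    moreover have "(INF \<rho>\<in>I_bd N. E_TF q Z \<rho>) = e"
      by (rule Inf_eq_approx) (use I in blast)+
    ultimately show "(INF \<tau>\<in>J_bd N. E_mTF q Z \<tau>) = (INF \<rho>\<in>I_bd N. E_TF q Z \<rho>)" by simp
  next
    fix N :: real and \<rho>m
    assume "0 \<le> N \<and> N \<le> Z \<and> is_minimizer (E_TF q Z) (I_bd N) \<rho>m"
    hence N: "0 \<le> N" "min N Z = N" and m: "\<rho>m \<in> I_bd N" "\<And>\<sigma>. \<sigma> \<in> I_bd N \<Longrightarrow> E_TF q Z \<rho>m \<le> E_TF q Z \<sigma>"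
      by (auto simp: is_minimizer_def)
    obtain \<rho> e where \<rho>: "\<rho> \<in> densities" "radially_decreasing \<rho>" "\<rho> \<in> I_bd (min N Z)" "E_TF q Z \<rho> = e"
      and uI: "\<And>\<sigma>. \<sigma> \<in> I_bd N \<Longrightarrow> E_TF q Z \<sigma> \<le> e \<Longrightarrow> AE x in lborel. \<sigma> x = \<rho> x"
      and T: "Tr \<rho> \<in> J_bd (min N Z)" "E_mTF q Z (Tr \<rho>) = e"
      and J: "\<And>\<tau>. \<tau> \<in> J_le N \<Longrightarrow> e \<le> E_mTF q Z \<tau>"
      and uJ: "\<And>\<tau>. \<tau> \<in> J_le N \<Longrightarrow> E_mTF q Z \<tau> \<le> e \<Longrightarrow> AE \<xi> in lborel. \<tau> \<xi> = Tr \<rho> \<xi>"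
      by (rule ground_state[OF N(1)]) blast
    \<comment> \<open>Uniqueness identifies the given minimizer with the radial density up to a null
      set, which the essential Fermi radius ignores.\<close>
    have "E_TF q Z \<rho>m \<le> e" using m(2)[of \<rho>] \<rho>(3,4) N(2) by simp
    hence eq: "AE x in lborel. \<rho>m x = \<rho> x" by (rule uI[OF m(1)])
    have tt: "AE \<xi> in lborel. Ttrans q \<rho>m \<xi> = Tr \<rho> \<xi>" by (rule Ttrans_AE_Tr[OF \<rho>(1,2) eq])
    note C = J_set_cong_AE[OF Tr_radially_decreasing(1)[OF \<rho>(1,2)] tt Ttrans_measurable[OF \<rho>(1,2) eq]]
    have E: "E_mTF q Z (Ttrans q \<rho>m) = e" using C(3) T(2) by (simp add: E_mTF_momenta)
    have mem: "Ttrans q \<rho>m \<in> J_bd N" using C(1,2) T(1) N(2) by (simp add: J_bd_def)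
    show "is_unique_minimizer (E_mTF q Z) (J_bd N) (Ttrans q \<rho>m)"
      unfolding is_unique_minimizer_def is_minimizer_def
    proof (intro conjI ballI allI impI mem)
      show "E_mTF q Z (Ttrans q \<rho>m) \<le> E_mTF q Z \<tau>" if "\<tau> \<in> J_bd N" for \<tau>
        unfolding E by (rule J[OF bd_le[OF that]])
      fix g assume g: "g \<in> J_bd N \<and> (\<forall>y\<in>J_bd N. E_mTF q Z g \<le> E_mTF q Z y)"
      hence "E_mTF q Z g \<le> e" using mem E by metis
      hence "AE \<xi> in lborel. g \<xi> = Tr \<rho> \<xi>" using uJ bd_le g by blast
      thus "AE \<xi> in lborel. g \<xi> = Ttrans q \<rho>m \<xi>" using tt by eventually_elim simp
    qed
  next
    fix N :: real assume N: "Z < N" and "\<exists>\<tau>. is_minimizer (E_mTF q Z) (J_bd N) \<tau>"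
    then obtain \<tau> where \<tau>: "\<tau> \<in> J_bd N" "\<And>\<sigma>. \<sigma> \<in> J_bd N \<Longrightarrow> E_mTF q Z \<tau> \<le> E_mTF q Z \<sigma>"
      by (auto simp: is_minimizer_def)
    have N0: "0 \<le> N" using N assms(2) by simp
    obtain \<rho> e where T: "Tr \<rho> \<in> J_bd (min N Z)"
      and uJ: "\<And>\<tau>. \<tau> \<in> J_le N \<Longrightarrow> E_mTF q Z \<tau> \<le> e \<Longrightarrow> AE \<xi> in lborel. \<tau> \<xi> = Tr \<rho> \<xi>"
      and ap: "\<And>\<delta>. 0 < \<delta> \<Longrightarrow> \<exists>\<tau>\<in>J_bd N. E_mTF q Z \<tau> \<le> e + \<delta>"
      by (rule ground_state[OF N0]) blast
    \<comment> \<open>A minimizer of mass N would reach the relaxed infimum e; rigidity then makes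
      it equal to \<open>Tr \<rho>\<close>, whose mass is Z < N.\<close>
    have "E_mTF q Z \<tau> \<le> e"
    proof (rule field_le_epsilon)
      fix \<delta> :: real assume "0 < \<delta>"
      then obtain \<sigma> where "\<sigma> \<in> J_bd N" "E_mTF q Z \<sigma> \<le> e + \<delta>" using ap by blast
      thus "E_mTF q Z \<tau> \<le> e + \<delta>" using \<tau>(2) by (meson order_trans)
    qed
    hence "AE \<xi> in lborel. \<tau> \<xi> = Tr \<rho> \<xi>" by (rule uJ[OF bd_le[OF \<tau>(1)]])
    hence "integral\<^sup>L lborel \<tau> = integral\<^sup>L lborel (Tr \<rho>)"
      using \<tau>(1) T by (intro integral_cong_AE) (auto simp: J_bd_def J_set_def)
    thus False using \<tau>(1) T N by (simp add: J_bd_def)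
  next
    fix N :: real assume N: "0 \<le> N"
    obtain \<rho> e where T: "Tr \<rho> \<in> J_bd (min N Z)" "E_mTF q Z (Tr \<rho>) = e"
      and J: "\<And>\<tau>. \<tau> \<in> J_le N \<Longrightarrow> e \<le> E_mTF q Z \<tau>"
      and uJ: "\<And>\<tau>. \<tau> \<in> J_le N \<Longrightarrow> E_mTF q Z \<tau> \<le> e \<Longrightarrow> AE \<xi> in lborel. \<tau> \<xi> = Tr \<rho> \<xi>"
      by (rule ground_state[OF N]) blast
    have mem: "Tr \<rho> \<in> J_le N" using T(1) by (auto simp: J_bd_def J_le_def)
    show "\<exists>\<tau>m. is_unique_minimizer (E_mTF q Z) (J_le N) \<tau>m \<and> \<tau>m \<in> J_bd (min N Z)"
    proof (intro exI[of _ "Tr \<rho>"] conjI T(1))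
      show "is_unique_minimizer (E_mTF q Z) (J_le N) (Tr \<rho>)"
        unfolding is_unique_minimizer_def is_minimizer_def
      proof (intro conjI ballI allI impI mem)
        show "E_mTF q Z (Tr \<rho>) \<le> E_mTF q Z \<tau>" if "\<tau> \<in> J_le N" for \<tau> unfolding T(2) by (rule J[OF that])
        fix g assume g: "g \<in> J_le N \<and> (\<forall>y\<in>J_le N. E_mTF q Z g \<le> E_mTF q Z y)"
        hence "E_mTF q Z g \<le> e" using mem T(2) by metis
        thus "AE \<xi> in lborel. g \<xi> = Tr \<rho> \<xi>" using uJ g by blast
      qed
    qed
  qed
qed

end
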